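(* Let $V_0$ be a $1$-periodic function on $\mathbb{R}$, let $\tau_1,\tau_2\in[0,1]$, and put $V_1(x)=V_0(x+\tau_1)$ and $V_2(x)=V_0(x-\tau_2)$ for $x\in\mathbb{R}$, and $V(x)=V_1(x)$ for $x\ge 0$, $V(x)=V_2(x)$ for $x<0$. Let $\lambda<\min\sigma\left(-\frac{d^2}{dx^2}+V\right)$. Let $u_-^{(1)}$ be the Bloch mode decaying at $-\infty$ of $-\frac{d^2}{dx^2}+V_1(x)-\lambda$, let $u_+^{(2)}$ be the Bloch mode decaying at $+\infty$ of $-\frac{d^2}{dx^2}+V_2(x)-\lambda$, and set $$I_1:=\int_{-1}^0\big(V_2(x)-V_1(x)\big)\,u_-^{(1)}(x)^2\,dx,\qquad I_2:=\int_0^1\big(V_1(x)-V_2(x)\big)\,u_+^{(2)}(x)^2\,dx .$$ Suppose $I_1<0$ or $I_2<0$. Then the equation $$-u''+V(x)u-\lambda u=\Gamma(x)|u|^{p-1}u\quad\text{on }\mathbb{R},$$ where $\Gamma(x)=\Gamma_0(x+\tau_1)$ for $x\ge 0$ and $\Gamma(x)=\Gamma_0(x-\tau_2)$ for $x<0$, has a strong ground state irrespectively of the choice of $p$ with $1<p<\infty$ and of the choice of the $1$-periodic function $\Gamma_0$ with $\operatorname{ess\,sup}\Gamma_0>0$.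
   Context: Bloch modes: $u_-^{(1)}$ is a nontrivial solution of $-u''+(V_1(x)-\lambda)u=0$ on $\mathbb{R}$ of the form $u_-^{(1)}(x)=p_-^{(1)}(x)e^{\kappa_1x}$ with $\kappa_1>0$ and $p_-^{(1)}$ $1$-periodic; $u_+^{(2)}$ is a nontrivial solution of $-u''+(V_2(x)-\lambda)u=0$ on $\mathbb{R}$ of the form $u_+^{(2)}(x)=p_+^{(2)}(x)e^{-\kappa_2x}$ with $\kappa_2>0$ and $p_+^{(2)}$ $1$-periodic. $\sigma(\cdot)$ denotes the spectrum. Strong ground state: a strong ground state of $-u''+V(x)u-\lambda u=\Gamma(x)|u|^{p-1}u$ on $\mathbb{R}$ is a minimizer of the energy $$J(u)=\int_{\mathbb{R}}\tfrac12\big(|u'|^2+(V(x)-\lambda)u^2\big)-\tfrac1{p+1}\Gamma(x)|u|^{p+1}\,dx$$ over the Nehari manifold $$N=\Big\{u\in H^1(\mathbb{R})\setminus\{0\}:\ \int_{\mathbb{R}}|u'|^2+(V(x)-\lambda)u^2-\Gamma(x)|u|^{p+1}\,dx=0\Big\}.$$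
   Formalization: The functions V_0 and Γ_0 are assumed to be Lebesgue measurable and essentially bounded; for arbitrary 1-periodic functions the operator -d²/dx²+V and the energy J on H^1 need not be defined. *)

theory Defs
  imports "HOL-Analysis.Analysis" "HOL-Probability.Essential_Supremum"
begin

text \<open>
  Elements of Lebesgue and Sobolev spaces are represented by functions; equality in these spaces
  is equality almost everywhere.
\<close>

definition L2 :: "(real \<Rightarrow> 'a::euclidean_space) set" where
  "L2 = {f. f \<in> borel_measurable lebesgue \<and> integrable lebesgue (\<lambda>x. (norm (f x))\<^sup>2)}"

definition L2_norm :: "(real \<Rightarrow> 'a::euclidean_space) \<Rightarrow> real" where
  "L2_norm f = sqrt (LINT x|lebesgue. (norm (f x))\<^sup>2)"

definition L_infinity :: "(real \<Rightarrow> real) set" where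
  "L_infinity = {f. f \<in> borel_measurable lebesgue \<and> (\<exists>C. AE x in lebesgue. \<bar>f x\<bar> \<le> C)}"

definition test_function :: "(real \<Rightarrow> real) \<Rightarrow> bool" where
  "test_function \<phi> \<longleftrightarrow>
     (\<forall>n x. (deriv ^^ n) \<phi> differentiable (at x)) \<and> (\<exists>R. \<forall>x. R < \<bar>x\<bar> \<longrightarrow> \<phi> x = 0)"

definition has_weak_derivative ::
    "(real \<Rightarrow> 'a::euclidean_space) \<Rightarrow> (real \<Rightarrow> 'a) \<Rightarrow> bool" where
  "has_weak_derivative u g \<longleftrightarrow>
     (\<forall>a b. set_integrable lebesgue {a..b} u \<and> set_integrable lebesgue {a..b} g) \<and>
     (\<forall>\<phi>. test_function \<phi> \<longrightarrow>
        (LINT x|lebesgue. deriv \<phi> x *\<^sub>R u x) = - (LINT x|lebesgue. \<phi> x *\<^sub>R g x))"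

text \<open>
  Weak derivatives are unique up to null sets, and everything below depends on
  \<open>weak_deriv u\<close> only up to null sets.
\<close>

definition weak_deriv :: "(real \<Rightarrow> 'a::euclidean_space) \<Rightarrow> (real \<Rightarrow> 'a)" where
  "weak_deriv u = (SOME g. has_weak_derivative u g)"

definition H1_space :: "(real \<Rightarrow> 'a::euclidean_space) set" where
  "H1_space = {u \<in> L2. \<exists>g \<in> L2. has_weak_derivative u g}"

definition H2_space :: "(real \<Rightarrow> 'a::euclidean_space) set" where
  "H2_space = {u \<in> H1_space. weak_deriv u \<in> H1_space}"

text \<open>
  \<open>L2_resolvent_set D A\<close> consists of those \<open>z\<close> for which \<open>A - z : D \<rightarrow> L\<^sup>2(\<real>; \<complex>)\<close> is a bijection
  with bounded inverse.
\<close>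

definition L2_resolvent_set ::
    "(real \<Rightarrow> complex) set \<Rightarrow> ((real \<Rightarrow> complex) \<Rightarrow> (real \<Rightarrow> complex)) \<Rightarrow> complex set" where
  "L2_resolvent_set D A =
     {z. \<exists>C. \<forall>f \<in> L2. \<exists>u \<in> D.
        (AE x in lebesgue. A u x - z * u x = f x) \<and>
        (\<forall>v \<in> D. (AE x in lebesgue. A v x - z * v x = f x) \<longrightarrow> (AE x in lebesgue. v x = u x)) \<and>
        L2_norm u \<le> C * L2_norm f}"

definition L2_spectrum ::
    "(real \<Rightarrow> complex) set \<Rightarrow> ((real \<Rightarrow> complex) \<Rightarrow> (real \<Rightarrow> complex)) \<Rightarrow> complex set" where
  "L2_spectrum D A = - L2_resolvent_set D A"

definition schroedinger :: "(real \<Rightarrow> real) \<Rightarrow> (real \<Rightarrow> complex) \<Rightarrow> (real \<Rightarrow> complex)" where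
  "schroedinger V u = (\<lambda>x. - weak_deriv (weak_deriv u) x + of_real (V x) * u x)"

text \<open>
  For bounded \<open>V\<close> the operator \<open>-d\<^sup>2/dx\<^sup>2 + V\<close> with domain \<open>H\<^sup>2(\<real>)\<close> is self-adjoint, so its
  spectrum is real and is recorded here as a set of reals.
\<close>

definition schroedinger_spectrum :: "(real \<Rightarrow> real) \<Rightarrow> real set" where
  "schroedinger_spectrum V = {s. complex_of_real s \<in> L2_spectrum H2_space (schroedinger V)}"

definition is_minimum :: "real \<Rightarrow> real set \<Rightarrow> bool" where
  "is_minimum m S \<longleftrightarrow> m \<in> S \<and> (\<forall>s \<in> S. m \<le> s)"

text \<open>
  \<open>-u'' + q u = 0\<close> on \<open>\<real>\<close> in the sense of Caratheodory: \<open>u\<close> is differentiable, \<open>u'\<close> is locally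
  absolutely continuous and \<open>u'' = q u\<close> almost everywhere.
\<close>

definition ode_solution :: "(real \<Rightarrow> real) \<Rightarrow> (real \<Rightarrow> real) \<Rightarrow> bool" where
  "ode_solution q u \<longleftrightarrow>
     (\<exists>u'. (\<forall>x. (u has_real_derivative u' x) (at x)) \<and>
           (\<forall>a b. a \<le> b \<longrightarrow>
              set_integrable lebesgue {a..b} (\<lambda>x. q x * u x) \<and>
              u' b - u' a = (LINT x:{a..b}|lebesgue. q x * u x)))"

definition bloch_mode :: "(real \<Rightarrow> real) \<Rightarrow> real \<Rightarrow> real \<Rightarrow> (real \<Rightarrow> real) \<Rightarrow> bool" where
  "bloch_mode W lam k u \<longleftrightarrow>
     ode_solution (\<lambda>x. W x - lam) u \<and> (\<exists>x. u x \<noteq> 0) \<and>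
     (\<exists>p. (\<forall>x. p (x + 1) = p x) \<and> (\<forall>x. u x = p x * exp (k * x)))"

definition bloch_mode_decaying_at_minus_infinity ::
    "(real \<Rightarrow> real) \<Rightarrow> real \<Rightarrow> (real \<Rightarrow> real) \<Rightarrow> bool" where
  "bloch_mode_decaying_at_minus_infinity W lam u \<longleftrightarrow> (\<exists>\<kappa>>0. bloch_mode W lam \<kappa> u)"

definition bloch_mode_decaying_at_plus_infinity ::
    "(real \<Rightarrow> real) \<Rightarrow> real \<Rightarrow> (real \<Rightarrow> real) \<Rightarrow> bool" where
  "bloch_mode_decaying_at_plus_infinity W lam u \<longleftrightarrow> (\<exists>\<kappa>>0. bloch_mode W lam (- \<kappa>) u)"

definition interface :: "(real \<Rightarrow> real) \<Rightarrow> (real \<Rightarrow> real) \<Rightarrow> real \<Rightarrow> real" where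
  "interface f g = (\<lambda>x. if x \<ge> 0 then f x else g x)"

definition energy ::
    "(real \<Rightarrow> real) \<Rightarrow> real \<Rightarrow> (real \<Rightarrow> real) \<Rightarrow> real \<Rightarrow> (real \<Rightarrow> real) \<Rightarrow> real" where
  "energy V lam G p u =
     (LINT x|lebesgue. 1/2 * (\<bar>weak_deriv u x\<bar>\<^sup>2 + (V x - lam) * (u x)\<^sup>2)
                         - 1/(p + 1) * G x * \<bar>u x\<bar> powr (p + 1))"

definition nehari_manifold ::
    "(real \<Rightarrow> real) \<Rightarrow> real \<Rightarrow> (real \<Rightarrow> real) \<Rightarrow> real \<Rightarrow> (real \<Rightarrow> real) set" where
  "nehari_manifold V lam G p =
     {u \<in> H1_space. \<not> (AE x in lebesgue. u x = 0) \<and>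
        (LINT x|lebesgue. \<bar>weak_deriv u x\<bar>\<^sup>2 + (V x - lam) * (u x)\<^sup>2
                            - G x * \<bar>u x\<bar> powr (p + 1)) = 0}"

definition strong_ground_state ::
    "(real \<Rightarrow> real) \<Rightarrow> real \<Rightarrow> (real \<Rightarrow> real) \<Rightarrow> real \<Rightarrow> (real \<Rightarrow> real) \<Rightarrow> bool" where
  "strong_ground_state V lam G p u \<longleftrightarrow>
     u \<in> nehari_manifold V lam G p \<and>
     (\<forall>v \<in> nehari_manifold V lam G p. energy V lam G p u \<le> energy V lam G p v)"

end

theory Submission
  imports Defs "HOL-Library.Function_Algebras" "HOL-Complex_Analysis.Great_Picard" "HOL-Probability.Distributions"
begin

text \<open>
  Let \<open>a\<close> be the quadratic form and \<open>G(u) = \<integral> \<Gamma> |u|\<^bsup>p+1\<^esup>\<close>. By scaling, ground states are the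
  minimizers of \<open>a\<close> on \<open>{G = 1}\<close>; let \<open>S\<close> be the infimum. The form is positive definite: if
  its infimum \<open>\<mu>\<close> on the \<open>L\<^sup>2\<close> sphere were in the resolvent set, testing with the resolvent of an almost
  minimizer would give a contradiction. A minimizing sequence, translated by integers so that it
  does not vanish, has a nonzero weak limit, and strict concavity of \<open>t\<^bsup>2/(p+1)\<^esup>\<close> rules out a
  splitting. So either \<open>S\<close> is attained, or the translations escape and \<open>S\<close> is attained in one of
  the two periodic problems, hence in both, since their coefficients are translates of each other.
  In the latter case a periodic minimizer is moved far away from the interface on one side and its
  tail on the other side is replaced by a multiple of the Bloch mode; if \<open>I\<^sub>1 < 0\<close> or \<open>I\<^sub>2 < 0\<close>, this
  competitor is at least as good as \<open>S\<close>, so that \<open>S\<close> is attained anyway.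
\<close>

text \<open>The gain brought by the Bloch tail is proportional to the square of its amplitude, and
  this amplitude tends to zero as the periodic minimizer moves away from the interface. So there is
  no fixed gain, and every error has to be of higher order than this square. Errors come from the
  nonlinearity only; there \<open>p + 1 > 2\<close> supplies a factor \<open>M powr (p - 1)\<close>,
  where \<open>M\<close> bounds the tail, and this factor tends to zero. That is why neither
  \<open>p\<close> nor \<open>\<Gamma>0\<close> enters the condition. The integrals
  \<open>I1\<close> and \<open>I2\<close> extend over a single period, but the mode is multiplied by
  a constant from one period to the next; hence their signs are those of the integrals over a
  half-line, which are geometric series. Since \<open>\<Gamma>0\<close> may change sign,
  \<open>G\<close> may be negative, which explains the truncation \<open>max 0\<close> in the
  inequality that characterizes \<open>S\<close>. Weak limits are obtained as strong limits of
  convex combinations. The form is merely semidefinite on pairs of functions, because pairs that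
  agree almost everywhere are not identified.\<close>

section \<open>Primitives of locally integrable functions\<close>

text \<open>The vector space structure on functions makes convex hulls of sets of functions available.\<close>

instantiation "fun" :: (type, real_vector) real_vector
begin
definition scaleR_fun_def: "scaleR r f = (\<lambda>x. r *\<^sub>R f x)"
instance by standard (auto simp: scaleR_fun_def fun_eq_iff algebra_simps)
end

text \<open>Local absolute continuity, with the derivative carried along as data. Every derivative
  that occurs is thus a given function, and almost everywhere differentiability never has to be
  discussed.\<close>

definition AC :: "(real \<Rightarrow> real) \<Rightarrow> (real \<Rightarrow> real) \<Rightarrow> bool" where
  "AC u g \<longleftrightarrow> (\<forall>a b. set_integrable lebesgue {a..b} g) \<and>
     (\<forall>a b. a \<le> b \<longrightarrow> u b - u a = (LINT x:{a..b}|lebesgue. g x))"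

lemma AC_integrable: "AC u g \<Longrightarrow> set_integrable lebesgue {a..b} g"
  by (simp add: AC_def)

lemma AC_eq: "AC u g \<Longrightarrow> a \<le> b \<Longrightarrow> (LINT x:{a..b}|lebesgue. g x) = u b - u a"
  by (simp add: AC_def)

lemma set_integral_Icc_combine:
  fixes f :: "real \<Rightarrow> real"
  assumes "set_integrable lebesgue {a..c} f" "a \<le> b" "b \<le> c"
  shows "(LINT x:{a..c}|lebesgue. f x) = (LINT x:{a..b}|lebesgue. f x) + (LINT x:{b..c}|lebesgue. f x)"
proof -
  have *: "set_integrable lebesgue {a..b} f" "set_integrable lebesgue {b..c} f"
    using assms by (auto intro: set_integrable_subset)
  show ?thesis
    using assms * Henstock_Kurzweil_Integration.integral_combine[of a b c f]
    by (simp add: set_lebesgue_integral_eq_integral)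
qed

lemma continuous_lebesgue_measurable:
  fixes u :: "real \<Rightarrow> real"
  assumes "continuous_on UNIV u" shows "u \<in> borel_measurable lebesgue"
  using continuous_imp_measurable_on_sets_lebesgue[OF assms] by (simp add: lebesgue_on_UNIV_eq)

lemma AC_continuous:
  assumes "AC u g" shows "continuous_on UNIV u"
proof -
  have "isCont u x" for x
  proof -
    have gi: "set_integrable lebesgue {c..d} g" for c d using assms AC_integrable by blast
    have "continuous_on {x-1..x+1} (\<lambda>y. integral {x-1..y} g)"
      using indefinite_integral_continuous_1[OF set_lebesgue_integral_eq_integral(1)[OF gi]] by blast
    moreover have "integral {x-1..y} g = u y - u (x-1)" if "y \<in> {x-1..x+1}" for y
      using AC_eq[OF assms, of "x-1" y] that set_lebesgue_integral_eq_integral(2)[OF gi] by auto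
    ultimately have "continuous_on {x-1..x+1} (\<lambda>y. u y - u (x-1))"
      by (metis (no_types, lifting) continuous_on_cong)
    from continuous_on_add[OF this continuous_on_const[of _ "u (x-1)"]]
    have "continuous_on {x-1..x+1} u" by simp
    then have "continuous_on {x-1<..<x+1} u" by (rule continuous_on_subset) auto
    then show ?thesis by (simp add: continuous_on_eq_continuous_at)
  qed
  then show ?thesis by (simp add: continuous_on_eq_continuous_at)
qed

lemma AC_measurable: "AC u g \<Longrightarrow> u \<in> borel_measurable lebesgue"
  using AC_continuous continuous_lebesgue_measurable by blast

lemma locally_integrable_measurable:
  fixes g :: "real \<Rightarrow> real"
  assumes "\<And>a b. set_integrable lebesgue {a..b} g"
  shows "g \<in> borel_measurable lebesgue"
proof (rule borel_measurable_LIMSEQ_real)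
  show "(\<lambda>x. indicator {-real n..real n} x *\<^sub>R g x) \<in> borel_measurable lebesgue" for n
    using assms[of "-real n" "real n"] unfolding set_integrable_def by auto
  fix x :: real
  have "\<forall>\<^sub>F n in sequentially. indicator {-real n..real n} x *\<^sub>R g x = g x"
    using eventually_ge_at_top[of "nat \<lceil>\<bar>x\<bar>\<rceil>"]
  proof eventually_elim
    case (elim n)
    then have "\<bar>x\<bar> \<le> real n" by linarith
    then show ?case by (auto simp: indicator_def abs_le_iff)
  qed
  then show "(\<lambda>n. indicator {-real n..real n} x *\<^sub>R g x) \<longlonglongrightarrow> g x"
    by (rule tendsto_eventually)
qed

lemma AC_deriv_measurable: "AC u g \<Longrightarrow> g \<in> borel_measurable lebesgue"
  using locally_integrable_measurable AC_integrable by blast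

lemma set_integrable_continuous_mult:
  fixes u g :: "real \<Rightarrow> real"
  assumes "continuous_on UNIV u" "set_integrable lebesgue {a..b} g"
  shows "set_integrable lebesgue {a..b} (\<lambda>x. u x * g x)"
proof -
  have "compact (u ` {a..b})"
    by (intro compact_continuous_image continuous_on_subset[OF assms(1)]) auto
  then obtain K where K: "\<And>x. x \<in> {a..b} \<Longrightarrow> \<bar>u x\<bar> \<le> K"
    unfolding compact_eq_bounded_closed bounded_iff by (metis imageI real_norm_def)
  have m: "(\<lambda>x. indicator {a..b} x *\<^sub>R g x) \<in> borel_measurable lebesgue"
    using assms(2) unfolding set_integrable_def by auto
  have mu: "u \<in> borel_measurable lebesgue" using assms(1) by (rule continuous_lebesgue_measurable)
  have m: "(\<lambda>x. u x * (indicator {a..b} x *\<^sub>R g x)) \<in> borel_measurable lebesgue"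
    using m mu by measurable
  have i: "integrable lebesgue (\<lambda>x. K * (indicator {a..b} x *\<^sub>R g x))"
    using assms(2) unfolding set_integrable_def by simp
  have b: "AE x in lebesgue. norm (u x * (indicator {a..b} x *\<^sub>R g x)) \<le> norm (K * (indicator {a..b} x *\<^sub>R g x))"
    using K by (intro AE_I2) (auto simp: abs_mult indicator_def intro!: mult_right_mono order_trans[OF K])
  have "integrable lebesgue (\<lambda>x. u x * (indicator {a..b} x *\<^sub>R g x))"
    by (rule Bochner_Integration.integrable_bound[OF i m b])
  then show ?thesis unfolding set_integrable_def by (simp add: mult.left_commute)
qed

text \<open>
  The defect of the product formula is additive over intervals and bounded on short intervals by
  the oscillation of the factors times \<open>\<integral> |g| + |h|\<close>, so it vanishes.
\<close>

lemma AC_mult: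
  assumes ug: "AC u g" and vh: "AC v h"
  shows "AC (\<lambda>x. u x * v x) (\<lambda>x. g x * v x + u x * h x)"
proof -
  have cu: "continuous_on UNIV u" and cv: "continuous_on UNIV v"
    using AC_continuous ug vh by auto
  have gi: "set_integrable lebesgue {a..b} g" and hi: "set_integrable lebesgue {a..b} h" for a b
    using ug vh AC_integrable by auto
  define f where "f = (\<lambda>x. g x * v x + u x * h x)"
  define k where "k = (\<lambda>x. \<bar>g x\<bar> + \<bar>h x\<bar>)"
  have gvi: "set_integrable lebesgue {a..b} (\<lambda>x. g x * v x)" for a b
    using set_integrable_continuous_mult[OF cv gi] by (simp add: mult.commute)
  have uhi: "set_integrable lebesgue {a..b} (\<lambda>x. u x * h x)" for a b
    using set_integrable_continuous_mult[OF cu hi] by simp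
  have fi: "set_integrable lebesgue {a..b} f" for a b
    unfolding f_def by (intro set_integral_add gvi uhi)
  have ki: "set_integrable lebesgue {a..b} k" for a b
    unfolding k_def by (intro set_integral_add set_integrable_abs gi hi)
  define E where "E a b = u b * v b - u a * v a - (LINT x:{a..b}|lebesgue. f x)" for a b
  have Eadd: "E a c = E a b + E b c" if "a \<le> b" "b \<le> c" for a b c
    unfolding E_def using set_integral_Icc_combine[OF fi that] by simp
  have est: "\<bar>E a b\<bar> \<le> w * (LINT x:{a..b}|lebesgue. k x)"
    if ab: "a \<le> b" and w: "\<And>x. x \<in> {a..b} \<Longrightarrow> \<bar>v a - v x\<bar> \<le> w" "\<And>x. x \<in> {a..b} \<Longrightarrow> \<bar>u b - u x\<bar> \<le> w" for a b w
  proof -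
    \<comment> \<open>Freezing \<open>v\<close> at the left end and \<open>u\<close> at the right
      end splits the increment of the product without a remainder, so that only oscillations of the
      factors survive in the comparison with \<open>f\<close>.\<close>
    have "E a b = v a * (u b - u a) + u b * (v b - v a) - (LINT x:{a..b}|lebesgue. f x)"
      unfolding E_def by (simp add: algebra_simps)
    also have "\<dots> = (LINT x:{a..b}|lebesgue. v a * g x) + (LINT x:{a..b}|lebesgue. u b * h x) - (LINT x:{a..b}|lebesgue. f x)"
      using AC_eq[OF ug ab] AC_eq[OF vh ab] by simp
    also have "\<dots> = (LINT x:{a..b}|lebesgue. v a * g x + u b * h x - f x)"
      using gi hi fi by (subst set_integral_diff(2)) (auto simp: set_integral_add(2) intro!: set_integral_add)
    finally have "E a b = (LINT x:{a..b}|lebesgue. v a * g x + u b * h x - f x)" .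
    moreover have "set_integrable lebesgue {a..b} (\<lambda>x. v a * g x + u b * h x - f x)"
      using gi hi fi by (auto intro!: set_integral_add set_integral_diff)
    ultimately have "\<bar>E a b\<bar> \<le> (LINT x:{a..b}|lebesgue. \<bar>v a * g x + u b * h x - f x\<bar>)"
      using set_integral_norm_bound by fastforce
    also have "\<dots> \<le> (LINT x:{a..b}|lebesgue. w * k x)"
    proof (rule set_integral_mono)
      show "set_integrable lebesgue {a..b} (\<lambda>x. \<bar>v a * g x + u b * h x - f x\<bar>)"
        using gi hi fi by (auto intro!: set_integral_add set_integral_diff set_integrable_abs)
      fix x assume x: "x \<in> {a..b}"
      have "v a * g x + u b * h x - f x = (v a - v x) * g x + (u b - u x) * h x"
        unfolding f_def by (simp add: algebra_simps)
      also have "\<bar>\<dots>\<bar> \<le> \<bar>v a - v x\<bar> * \<bar>g x\<bar> + \<bar>u b - u x\<bar> * \<bar>h x\<bar>"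
        by (metis abs_mult abs_triangle_ineq)
      also have "\<dots> \<le> w * \<bar>g x\<bar> + w * \<bar>h x\<bar>"
        by (intro add_mono mult_right_mono w x) auto
      finally show "\<bar>v a * g x + u b * h x - f x\<bar> \<le> w * k x" by (simp add: k_def algebra_simps)
    qed (use ki in auto)
    finally show ?thesis by simp
  qed
  have "E A B = 0" if AB: "A \<le> B" for A B
  proof -
    define M where "M = (LINT x:{A..B}|lebesgue. k x)"
    have M0: "M \<ge> 0" unfolding M_def k_def set_lebesgue_integral_def by (intro integral_nonneg_AE) auto
    have "\<bar>E A B\<bar> \<le> e * M" if e: "e > 0" for e
    proof -
      have uc: "uniformly_continuous_on {A..B} u" "uniformly_continuous_on {A..B} v"
        using cu cv continuous_on_subset by (blast intro: compact_uniformly_continuous)+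
      obtain d1 where d1: "d1 > 0" "\<forall>x\<in>{A..B}. \<forall>x'\<in>{A..B}. dist x' x < d1 \<longrightarrow> dist (u x') (u x) < e"
        using uc(1)[unfolded uniformly_continuous_on_def, THEN spec, THEN mp, OF e] by blast
      obtain d2 where d2: "d2 > 0" "\<forall>x\<in>{A..B}. \<forall>x'\<in>{A..B}. dist x' x < d2 \<longrightarrow> dist (v x') (v x) < e"
        using uc(2)[unfolded uniformly_continuous_on_def, THEN spec, THEN mp, OF e] by blast
      define D where "D = min d1 d2 / 2"
      have D: "D > 0" using d1(1) d2(1) by (simp add: D_def)
      have one: "\<bar>E a b\<bar> \<le> e * (LINT x:{a..b}|lebesgue. k x)"
        if "A \<le> a" "a \<le> b" "b \<le> B" "b - a \<le> D" for a b
      proof (rule est)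
        fix x assume x: "x \<in> {a..b}"
        have "dist a x < d2" "dist b x < d1"
          using x that d1(1) d2(1) unfolding D_def dist_real_def by auto
        then show "\<bar>v a - v x\<bar> \<le> e" "\<bar>u b - u x\<bar> \<le> e"
          using d1(2)[rule_format, of x b] d2(2)[rule_format, of x a] x that by (auto simp: dist_real_def)
      qed fact
      have many: "A \<le> a \<Longrightarrow> a \<le> b \<Longrightarrow> b \<le> B \<Longrightarrow> b - a \<le> real n * D \<Longrightarrow> \<bar>E a b\<bar> \<le> e * (LINT x:{a..b}|lebesgue. k x)" for n a b
      proof (induction n arbitrary: b)
        case 0 then show ?case using one[of a b] D by auto
      next
        case (Suc n)
        \<comment> \<open>The last piece of length at most \<open>D\<close> is cut off on the right;
          the maximum keeps the cut inside \<open>{a..b}\<close>.\<close>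
        define c where "c = max a (b - D)"
        have c: "a \<le> c" "c \<le> b" using Suc D by (auto simp: c_def)
        have "real n * D \<ge> 0" using D by simp
        then have "c - a \<le> real n * D" using Suc.prems unfolding c_def by (auto simp: algebra_simps max_def)
        then have "\<bar>E a c\<bar> \<le> e * (LINT x:{a..c}|lebesgue. k x)" using Suc c by auto
        moreover have "\<bar>E c b\<bar> \<le> e * (LINT x:{c..b}|lebesgue. k x)"
          using c Suc.prems by (intro one) (auto simp: c_def)
        ultimately show ?case
          using Eadd[OF c] set_integral_Icc_combine[OF ki c] by (auto simp: algebra_simps)
      qed
      obtain n :: nat where "(B - A) / D \<le> real n" using real_arch_simple by blast
      then have "B - A \<le> real n * D" using D by (simp add: field_simps)
      then show ?thesis unfolding M_def using many[of A B n] AB by auto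
    qed
    then have "\<bar>E A B\<bar> \<le> 0 + e" if "e > 0" for e
    proof -
      have "\<bar>E A B\<bar> \<le> e / (M + 1) * M" by (rule \<open>\<And>e. e > 0 \<Longrightarrow> \<bar>E A B\<bar> \<le> e * M\<close>) (use M0 that in auto)
      also have "\<dots> \<le> e" using M0 that by (simp add: field_simps)
      finally show ?thesis by simp
    qed
    then have "\<bar>E A B\<bar> \<le> 0" by (rule field_le_epsilon)
    then show ?thesis by simp
  qed
  then show ?thesis unfolding AC_def E_def using fi by (auto simp: f_def)
qed

section \<open>Square-integrable functions, the space \<open>H1\<close> and its quadratic
  forms\<close>

lemma scaleR_fun_apply [simp]: "(r *\<^sub>R f) x = r *\<^sub>R f x"
  by (simp add: scaleR_fun_def)

lemma L2_real_iff: "f \<in> L2 \<longleftrightarrow> f \<in> borel_measurable lebesgue \<and> integrable lebesgue (\<lambda>x. (f x)\<^sup>2)"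
  for f :: "real \<Rightarrow> real"
  by (simp add: L2_def)

lemma L2_D:
  fixes f :: "real \<Rightarrow> real"
  assumes "f \<in> L2"
  shows "f \<in> borel_measurable lebesgue" "integrable lebesgue (\<lambda>x. (f x)\<^sup>2)"
  using assms by (simp_all add: L2_real_iff)

lemma abs_mult_le_sum_squares: "\<bar>a * b\<bar> \<le> a\<^sup>2 + (b::real)\<^sup>2"
proof -
  have "0 \<le> (\<bar>a\<bar> - \<bar>b\<bar>)\<^sup>2 + a\<^sup>2 + b\<^sup>2" by simp
  then show ?thesis by (simp add: power2_eq_square abs_mult algebra_simps)
qed

lemma L2_mult_integrable:
  fixes u v :: "real \<Rightarrow> real"
  assumes "u \<in> L2" "v \<in> L2" shows "integrable lebesgue (\<lambda>x. u x * v x)"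
proof (rule Bochner_Integration.integrable_bound)
  show "integrable lebesgue (\<lambda>x. (u x)\<^sup>2 + (v x)\<^sup>2)" using assms by (simp add: L2_D)
  show "(\<lambda>x. u x * v x) \<in> borel_measurable lebesgue" using assms by (simp add: L2_D borel_measurable_times)
  show "AE x in lebesgue. norm (u x * v x) \<le> norm ((u x)\<^sup>2 + (v x)\<^sup>2)"
    using abs_mult_le_sum_squares by (intro AE_I2) (simp add: order_trans[OF abs_mult_le_sum_squares])
qed

lemma L_infinity_mult_integrable:
  fixes q u :: "real \<Rightarrow> real"
  assumes "q \<in> L_infinity" "integrable lebesgue u" shows "integrable lebesgue (\<lambda>x. q x * u x)"
proof -
  obtain C where C: "AE x in lebesgue. \<bar>q x\<bar> \<le> C" and m: "q \<in> borel_measurable lebesgue"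
    using assms(1) by (auto simp: L_infinity_def)
  show ?thesis
  proof (rule Bochner_Integration.integrable_bound)
    show "integrable lebesgue (\<lambda>x. C * u x)" using assms(2) by simp
    show "(\<lambda>x. q x * u x) \<in> borel_measurable lebesgue" using m assms(2) by (simp add: borel_measurable_times)
    show "AE x in lebesgue. norm (q x * u x) \<le> norm (C * u x)"
      using C by eventually_elim (auto simp: abs_mult intro: mult_right_mono)
  qed
qed

lemma L2_add: "f \<in> L2 \<Longrightarrow> g \<in> L2 \<Longrightarrow> (\<lambda>x. f x + g x) \<in> L2" for f g :: "real \<Rightarrow> real"
  using L2_mult_integrable[of f g] by (auto simp: L2_real_iff power2_sum mult.assoc)

lemma L2_scale: "f \<in> L2 \<Longrightarrow> (\<lambda>x. c * f x) \<in> L2" for f :: "real \<Rightarrow> real"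
  by (auto simp: L2_real_iff power_mult_distrib)

lemma L2_diff: "f \<in> L2 \<Longrightarrow> g \<in> L2 \<Longrightarrow> (\<lambda>x. f x - g x) \<in> L2" for f g :: "real \<Rightarrow> real"
  using L2_add[of f "\<lambda>x. (-1) * g x"] L2_scale[of g "-1"] by simp

lemma AC_add: "AC u g \<Longrightarrow> AC v h \<Longrightarrow> AC (\<lambda>x. u x + v x) (\<lambda>x. g x + h x)"
  unfolding AC_def by (auto simp: set_integral_add algebra_simps)

lemma AC_scale: "AC u g \<Longrightarrow> AC (\<lambda>x. c * u x) (\<lambda>x. c * g x)"
  unfolding AC_def by (auto simp: algebra_simps)

lemma AC_const: "AC (\<lambda>x. c) (\<lambda>x. 0)"
  unfolding AC_def by (simp add: set_integrable_def set_lebesgue_integral_def)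

text \<open>
  An element of \<open>H\<^sup>1(\<real>)\<close> is represented by the pair of its continuous representative and its weak
  derivative.
\<close>

definition H1 :: "((real \<Rightarrow> real) \<times> (real \<Rightarrow> real)) set" where
  "H1 = {P. AC (fst P) (snd P) \<and> fst P \<in> L2 \<and> snd P \<in> L2}"

lemma H1_D: assumes "P \<in> H1" shows "AC (fst P) (snd P)" "fst P \<in> L2" "snd P \<in> L2"
  using assms by (auto simp: H1_def)

lemma H1_subspace: "subspace H1"
proof (rule subspaceI)
  show "0 \<in> H1" by (simp add: H1_def zero_fun_def AC_const L2_def)
  fix P Q c assume P: "P \<in> H1"
  show "c *\<^sub>R P \<in> H1"
    using P unfolding H1_def by (auto simp: scaleR_fun_def AC_scale L2_scale)
  assume Q: "Q \<in> H1"
  show "P + Q \<in> H1"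
    using P Q unfolding H1_def by (auto simp: plus_fun_def AC_add L2_add)
qed

lemmas H1_add = subspace_add[OF H1_subspace]
  and H1_diff = subspace_diff[OF H1_subspace]
  and H1_scale = subspace_scale[OF H1_subspace]

text \<open>The form of the operator \<open>-u'' + q u\<close> after integration by parts. For
  \<open>q = V - lam\<close> its diagonal is the form \<open>a\<close> of the overview.\<close>

definition bil :: "(real \<Rightarrow> real) \<Rightarrow> (real \<Rightarrow> real) \<times> (real \<Rightarrow> real) \<Rightarrow> (real \<Rightarrow> real) \<times> (real \<Rightarrow> real) \<Rightarrow> real" where
  "bil q P Q = (LINT x|lebesgue. snd P x * snd Q x + q x * (fst P x * fst Q x))"

lemma bil_integrable:
  assumes "q \<in> L_infinity" "P \<in> H1" "Q \<in> H1"
  shows "integrable lebesgue (\<lambda>x. snd P x * snd Q x + q x * (fst P x * fst Q x))"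
  using assms by (intro Bochner_Integration.integrable_add L_infinity_mult_integrable L2_mult_integrable) (auto simp: H1_D)

lemma bil_commute: "bil q P Q = bil q Q P"
  unfolding bil_def by (simp add: mult.commute)

lemma bil_add_left:
  assumes "q \<in> L_infinity" "P \<in> H1" "P' \<in> H1" "Q \<in> H1"
  shows "bil q (P + P') Q = bil q P Q + bil q P' Q"
  unfolding bil_def
  by (subst Bochner_Integration.integral_add[symmetric])
     (use assms in \<open>auto intro!: bil_integrable Bochner_Integration.integral_cong simp: algebra_simps\<close>)

lemma bil_scale_left: "bil q (c *\<^sub>R P) Q = c * bil q P Q"
  unfolding bil_def
  by (subst integral_mult_right_zero[symmetric])
     (auto intro!: Bochner_Integration.integral_cong simp: algebra_simps)

abbreviation "form q P \<equiv> bil q P P"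

lemma bil_split:
  assumes "q \<in> L_infinity" "P \<in> H1" "Q \<in> H1"
  shows "bil q P Q = (LINT x|lebesgue. snd P x * snd Q x) + (LINT x|lebesgue. q x * (fst P x * fst Q x))"
  unfolding bil_def using assms
  by (intro Bochner_Integration.integral_add L_infinity_mult_integrable L2_mult_integrable) (auto simp: H1_D)

section \<open>Vanishing at infinity and pointwise bounds\<close>

lemma small_value:
  fixes F :: "real \<Rightarrow> real"
  assumes F: "set_integrable lebesgue S F" and S: "\<And>n. \<exists>a. {a..a + real n} \<subseteq> S" and "0 < e"
  shows "\<exists>y\<in>S. \<bar>F y\<bar> < e"
proof (rule ccontr)
  assume "\<not> ?thesis"
  then have ge: "e \<le> \<bar>F y\<bar>" if "y \<in> S" for y using that by force
  obtain n :: nat where n: "(LINT x:S|lebesgue. \<bar>F x\<bar>) / e < real n" using reals_Archimedean2 by blast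
  obtain a where a: "{a..a + real n} \<subseteq> S" using S by blast
  have Fa: "set_integrable lebesgue S (\<lambda>x. \<bar>F x\<bar>)" using F by (rule set_integrable_abs)
  have "e * real n = (LINT x|lebesgue. indicator {a..a+real n} x * e)" by (simp add: measure_completion)
  also have "\<dots> \<le> (LINT x|lebesgue. indicator S x * \<bar>F x\<bar>)"
  proof (rule integral_mono_AE)
    show "integrable lebesgue (\<lambda>x. indicator {a..a+real n} x * e)"
      by (intro integrable_mult_left) simp
    show "integrable lebesgue (\<lambda>x. indicator S x * \<bar>F x\<bar>)" using Fa by (simp add: set_integrable_def)
    show "AE x in lebesgue. indicator {a..a+real n} x * e \<le> indicator S x * \<bar>F x\<bar>"
      using a ge by (intro AE_I2) (auto simp: indicator_def)
  qed
  also have "\<dots> = (LINT x:S|lebesgue. \<bar>F x\<bar>)" by (simp add: set_lebesgue_integral_def)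
  finally show False using n \<open>0 < e\<close> by (simp add: field_simps)
qed

text \<open>An integrable \<open>F\<close> cannot stay above a positive bound on arbitrarily long
  intervals, so there are points \<open>y n\<close> tending to minus infinity along which
  \<open>F\<close> tends to zero. Such a sequence is enough to remove the boundary term.\<close>

lemma AC_integral_atMost:
  assumes A: "AC F f" and F: "set_integrable lebesgue {..x} F" and f: "set_integrable lebesgue {..x} f"
  shows "(LINT t:{..x}|lebesgue. f t) = F x"
proof -
  have "\<exists>y. y \<le> x - real n \<and> \<bar>F y\<bar> < 1 / real (Suc n)" for n
  proof -
    have "set_integrable lebesgue {..x - real n} F" using F by (rule set_integrable_subset) auto
    moreover have "\<exists>a. {a..a + real m} \<subseteq> {..x - real n}" for m
      by (intro exI[of _ "x - real n - real m"]) auto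
    ultimately show ?thesis using small_value[of "{..x - real n}" F "1 / real (Suc n)"] by auto
  qed
  then obtain y where y: "\<And>n. y n \<le> x - real n" "\<And>n. \<bar>F (y n)\<bar> < 1 / real (Suc n)" by metis
  have "(\<lambda>n. F (y n)) \<longlonglongrightarrow> 0"
  proof (rule Lim_null_comparison)
    show "\<forall>\<^sub>F n in sequentially. norm (F (y n)) \<le> 1 / real (Suc n)"
      using y(2) less_imp_le by (intro always_eventually) auto
  qed (rule LIMSEQ_Suc[OF lim_1_over_n])
  then have "(\<lambda>n. F x - F (y n)) \<longlonglongrightarrow> F x - 0" by (intro tendsto_intros)
  moreover have "F x - F (y n) = (LINT t:{y n..x}|lebesgue. f t)" for n
    using AC_eq[OF A, of "y n" x] y(1)[of n] by simp
  moreover have "(\<lambda>n. LINT t:{y n..x}|lebesgue. f t) \<longlonglongrightarrow> (LINT t:{..x}|lebesgue. f t)"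
    unfolding set_lebesgue_integral_def
  proof (rule integral_dominated_convergence)
    show "integrable lebesgue (\<lambda>t. norm (indicator {..x} t *\<^sub>R f t))"
      using f unfolding set_integrable_def by (rule integrable_norm)
    show "(\<lambda>t. indicator {..x} t *\<^sub>R f t) \<in> borel_measurable lebesgue"
      using f unfolding set_integrable_def by auto
    show "(\<lambda>t. indicator {y n..x} t *\<^sub>R f t) \<in> borel_measurable lebesgue" for n
      using AC_integrable[OF A, of "y n" x] unfolding set_integrable_def by auto
    show "AE t in lebesgue. norm (indicator {y n..x} t *\<^sub>R f t) \<le> norm (indicator {..x} t *\<^sub>R f t)" for n
      by (intro AE_I2) (auto simp: indicator_def)
    show "AE t in lebesgue. (\<lambda>n. indicator {y n..x} t *\<^sub>R f t) \<longlonglongrightarrow> indicator {..x} t *\<^sub>R f t"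
    proof (intro AE_I2 tendsto_eventually)
      fix t
      show "\<forall>\<^sub>F n in sequentially. indicator {y n..x} t *\<^sub>R f t = indicator {..x} t *\<^sub>R f t"
        using eventually_ge_at_top[of "nat \<lceil>x - t\<rceil>"]
      proof eventually_elim
        case (elim n)
        then have "x - real n \<le> t" by linarith
        then show ?case using y(1)[of n] by (auto simp: indicator_def)
      qed
    qed
  qed
  ultimately show ?thesis using LIMSEQ_unique by fastforce
qed

lemma set_integrable_of_integrable:
  fixes f :: "real \<Rightarrow> real"
  shows "integrable lebesgue f \<Longrightarrow> S \<in> sets lebesgue \<Longrightarrow> set_integrable lebesgue S f"
  unfolding set_integrable_def by (simp add: integrable_real_mult_indicator mult.commute)

text \<open>The boundary values vanish along sequences at both ends. Applied to a product by means
  of \<open>AC_mult\<close>, this is integration by parts on the whole line.\<close>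

lemma AC_integral_eq_0:
  assumes A: "AC F f" and F: "integrable lebesgue F" and f: "integrable lebesgue f"
  shows "(LINT t|lebesgue. f t) = 0"
proof -
  have si: "set_integrable lebesgue S F" "set_integrable lebesgue S f" if "S \<in> sets lebesgue" for S
    using F f that by (auto intro: set_integrable_of_integrable)
  have "\<exists>y. y \<ge> real n \<and> \<bar>F y\<bar> < 1 / real (Suc n)" for n
  proof -
    have "\<exists>a. {a..a + real m} \<subseteq> {real n..}" for m by (intro exI[of _ "real n"]) auto
    then show ?thesis using small_value[of "{real n..}" F "1 / real (Suc n)"] si by auto
  qed
  then obtain y where y: "\<And>n. y n \<ge> real n" "\<And>n. \<bar>F (y n)\<bar> < 1 / real (Suc n)" by metis
  have "(\<lambda>n. F (y n)) \<longlonglongrightarrow> 0"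
  proof (rule Lim_null_comparison)
    show "\<forall>\<^sub>F n in sequentially. norm (F (y n)) \<le> 1 / real (Suc n)"
      using y(2) less_imp_le by (intro always_eventually) auto
  qed (rule LIMSEQ_Suc[OF lim_1_over_n])
  moreover have "F (y n) = (LINT t:{..y n}|lebesgue. f t)" for n
    using AC_integral_atMost[OF A si, of "y n"] by simp
  moreover have "(\<lambda>n. LINT t:{..y n}|lebesgue. f t) \<longlonglongrightarrow> (LINT t|lebesgue. f t)"
    unfolding set_lebesgue_integral_def
  proof (rule integral_dominated_convergence)
    show "integrable lebesgue (\<lambda>t. norm (f t))"
      using f by (rule integrable_norm)
    show "f \<in> borel_measurable lebesgue" using f by auto
    show "(\<lambda>t. indicator {..y n} t *\<^sub>R f t) \<in> borel_measurable lebesgue" for n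
      using si(2)[of "{..y n}"] unfolding set_integrable_def by auto
    show "AE t in lebesgue. norm (indicator {..y n} t *\<^sub>R f t) \<le> norm (f t)" for n
      by (intro AE_I2) (auto simp: indicator_def)
    show "AE t in lebesgue. (\<lambda>n. indicator {..y n} t *\<^sub>R f t) \<longlonglongrightarrow> f t"
    proof (intro AE_I2 tendsto_eventually)
      fix t
      show "\<forall>\<^sub>F n in sequentially. indicator {..y n} t *\<^sub>R f t = f t"
        using eventually_ge_at_top[of "nat \<lceil>t\<rceil>"]
      proof eventually_elim
        case (elim n)
        then have "t \<le> real n" by linarith
        then show ?case using y(1)[of n] by (auto simp: indicator_def)
      qed
    qed
  qed
  ultimately show ?thesis using LIMSEQ_unique by fastforce
qed

lemma AC_square: "AC u g \<Longrightarrow> AC (\<lambda>x. (u x)\<^sup>2) (\<lambda>x. 2 * (u x * g x))"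
  using AC_mult[of u g u g] by (simp add: power2_eq_square algebra_simps)

lemma H1_square_integrable: "P \<in> H1 \<Longrightarrow> integrable lebesgue (\<lambda>x. (snd P x)\<^sup>2 + (fst P x)\<^sup>2)"
  by (simp add: H1_D L2_D)

text \<open>The derivative \<open>2 u u'\<close> of the square is at most \<open>u'^2 + u^2\<close>.
  The bound involves only what lies to the left of \<open>x\<close>; this makes a minimizer that is
  shifted far to the right uniformly small on the negative half-line.\<close>

lemma H1_pointwise_atMost:
  assumes P: "P \<in> H1"
  shows "(fst P x)\<^sup>2 \<le> (LINT t:{..x}|lebesgue. (snd P t)\<^sup>2 + (fst P t)\<^sup>2)"
proof -
  have i: "integrable lebesgue (\<lambda>x. 2 * (fst P x * snd P x))" "integrable lebesgue (\<lambda>x. (fst P x)\<^sup>2)"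
    using P by (auto simp: H1_D L2_D L2_mult_integrable)
  have "(fst P x)\<^sup>2 = (LINT t:{..x}|lebesgue. 2 * (fst P t * snd P t))"
    using AC_square[OF H1_D(1)[OF P]] i
    by (intro AC_integral_atMost[symmetric]) (auto intro: set_integrable_of_integrable)
  also have "\<dots> \<le> (LINT t:{..x}|lebesgue. (snd P t)\<^sup>2 + (fst P t)\<^sup>2)"
  proof (rule set_integral_mono)
    show "2 * (fst P t * snd P t) \<le> (snd P t)\<^sup>2 + (fst P t)\<^sup>2" for t
      using sum_squares_bound[of "fst P t" "snd P t"] by (simp add: algebra_simps)
  qed (use i H1_square_integrable[OF P] in \<open>auto intro!: set_integrable_of_integrable\<close>)
  finally show ?thesis .
qed

lemma H1_pointwise:
  assumes P: "P \<in> H1"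
  shows "(fst P x)\<^sup>2 \<le> (LINT t|lebesgue. (snd P t)\<^sup>2 + (fst P t)\<^sup>2)"
proof -
  have "(fst P x)\<^sup>2 \<le> (LINT t:{..x}|lebesgue. (snd P t)\<^sup>2 + (fst P t)\<^sup>2)" by (rule H1_pointwise_atMost[OF P])
  also have "\<dots> \<le> (LINT t|lebesgue. (snd P t)\<^sup>2 + (fst P t)\<^sup>2)"
    unfolding set_lebesgue_integral_def
    using H1_square_integrable[OF P] set_integrable_of_integrable[OF H1_square_integrable[OF P], of "{..x}"]
    by (intro integral_mono_AE AE_I2) (auto simp: indicator_def set_integrable_def)
  finally show ?thesis .
qed

section \<open>Translations, reflection and cutting at the interface\<close>

lemma AE_lebesgue_affine:
  assumes "AE x in lebesgue. P x" and c: "c = 1 \<or> c = (-1::real)"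
  shows "AE x in lebesgue. P (t + c * x)"
proof -
  have m: "(\<lambda>x. t + c * x) \<in> lebesgue \<rightarrow>\<^sub>M lebesgue"
    using lebesgue_affine_measurable[where c= "\<lambda>x::real. c"] c by auto
  have eq: "lebesgue = density (distr lebesgue lebesgue (\<lambda>x. t + c * x)) (\<lambda>_. ennreal \<bar>c\<bar>)"
    using c by (intro lebesgue_real_affine) auto
  have "AE x in density (distr lebesgue lebesgue (\<lambda>x. t + c * x)) (\<lambda>_. ennreal \<bar>c\<bar>). P x"
    by (simp only: eq[symmetric] assms(1))
  then have "AE x in distr lebesgue lebesgue (\<lambda>x. t + c * x). P x"
    using c by (auto simp: AE_density)
  then show ?thesis using AE_distrD[OF m] by blast
qed

lemma measurable_affine:
  fixes f :: "real \<Rightarrow> real"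
  assumes "f \<in> borel_measurable lebesgue" "c \<noteq> 0"
  shows "(\<lambda>x. f (t + c * x)) \<in> borel_measurable lebesgue"
  using borel_measurable_affine[OF assms, of t] by simp

lemma L_infinity_affine: "q \<in> L_infinity \<Longrightarrow> c = 1 \<or> c = -1 \<Longrightarrow> (\<lambda>x. q (t + c * x)) \<in> L_infinity"
  unfolding L_infinity_def using AE_lebesgue_affine[of "\<lambda>x. \<bar>q x\<bar> \<le> _" c t] measurable_affine[of q c t] by fastforce

lemma L2_affine: "q \<in> L2 \<Longrightarrow> c \<noteq> 0 \<Longrightarrow> (\<lambda>x. q (t + c * x)) \<in> L2" for q :: "real \<Rightarrow> real"
  unfolding L2_real_iff using measurable_affine[of q c t] lebesgue_integrable_real_affine[of "\<lambda>x. (q x)\<^sup>2" c t] by auto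

lemma AC_affine:
  assumes A: "AC u g" and c: "c = 1 \<or> c = -1"
  shows "AC (\<lambda>x. u (t + c * x)) (\<lambda>x. c * g (t + c * x))"
proof -
  define I where "I a b = (if c = 1 then {t + a..t + b} else {t - b..t - a})" for a b
  have ind: "indicat_real {a..b} x = indicat_real (I a b) (t + c * x)" for a b x
    using c by (auto simp: indicator_def I_def)
  have int: "set_integrable lebesgue (I a b) g" for a b
    using AC_integrable[OF A] by (auto simp: I_def)
  have gi: "set_integrable lebesgue {a..b} (\<lambda>x. g (t + c * x))" for a b
    using lebesgue_integrable_real_affine[OF int[of a b, unfolded set_integrable_def], of c t] c
    by (auto simp: set_integrable_def ind)
  moreover have "u (t + c * b) - u (t + c * a) = (LINT x:{a..b}|lebesgue. c * g (t + c * x))" if "a \<le> b" for a b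
  proof -
    have "(LINT x:{a..b}|lebesgue. c * g (t + c * x)) = c * (LINT x|lebesgue. indicator (I a b) (t + c * x) *\<^sub>R g (t + c * x))"
      by (simp add: set_lebesgue_integral_def ind)
    also have "\<dots> = c * (LINT x:I a b|lebesgue. g x)"
      using lebesgue_integral_real_affine[of c "\<lambda>x. indicator (I a b) x *\<^sub>R g x" t] c
      by (auto simp: set_lebesgue_integral_def)
    also have "\<dots> = u (t + c * b) - u (t + c * a)"
      using c that AC_eq[OF A, of "t + a" "t + b"] AC_eq[OF A, of "t - b" "t - a"] by (auto simp: I_def)
    finally show ?thesis by simp
  qed
  ultimately show ?thesis unfolding AC_def by simp
qed

text \<open>The value \<open>c = 1\<close> gives the translations, and \<open>c = -1\<close> with
  \<open>t = 0\<close> the reflection that exchanges the two sides of the interface.\<close>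

definition aff :: "real \<Rightarrow> real \<Rightarrow> (real \<Rightarrow> real) \<times> (real \<Rightarrow> real) \<Rightarrow> (real \<Rightarrow> real) \<times> (real \<Rightarrow> real)" where
  "aff c t P = (\<lambda>x. fst P (t + c * x), \<lambda>x. c * snd P (t + c * x))"

lemma aff_H1: "P \<in> H1 \<Longrightarrow> c = 1 \<or> c = -1 \<Longrightarrow> aff c t P \<in> H1"
  unfolding H1_def aff_def using AC_affine[of "fst P" "snd P" c t] L2_affine[of "fst P" c t] L2_scale[OF L2_affine[of "snd P" c t], of c]
  by auto

lemma bil_aff: "c = 1 \<or> c = -1 \<Longrightarrow> bil (\<lambda>x. q (t + c * x)) (aff c t P) (aff c t Q) = bil q P Q"
  unfolding bil_def
  by (subst lebesgue_integral_real_affine[of c "\<lambda>x. snd P x * snd Q x + q x * (fst P x * fst Q x)" t]) (auto simp: aff_def)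

definition cutneg :: "(real \<Rightarrow> real) \<Rightarrow> real \<Rightarrow> real" where
  "cutneg f x = (if x < 0 then f x else 0)"

text \<open>The condition \<open>h 0 = 0\<close> excludes a jump at the cut. It is met by the
  difference of two functions that agree at the interface.\<close>

lemma AC_cutneg:
  assumes A: "AC h k" and 0: "h 0 = 0" shows "AC (cutneg h) (cutneg k)"
proof -
  have "cutneg k = (\<lambda>x. indicator {..<0} x *\<^sub>R k x)" by (auto simp: cutneg_def fun_eq_iff)
  then have ki: "set_integrable lebesgue {a..b} (cutneg k)" for a b
    using integrable_mult_indicator[of "{..<0::real}" lebesgue, OF _ AC_integrable[OF A, of a b, unfolded set_integrable_def]]
    by (simp add: set_integrable_def mult.left_commute)
  have neg: "(LINT x:{a..b}|lebesgue. cutneg k x) = cutneg h b - cutneg h a" if "a \<le> b" "b \<le> 0" for a b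
  proof -
    have "AE x in lebesgue. x \<noteq> (0::real)"
      by (rule AE_I[where N="{0}"]) auto
    then have "(LINT x:{a..b}|lebesgue. cutneg k x) = (LINT x:{a..b}|lebesgue. k x)"
      unfolding set_lebesgue_integral_def
      using ki[of a b] AC_integrable[OF A, of a b] that
      by (intro integral_cong_AE) (auto simp: set_integrable_def indicator_def cutneg_def elim!: eventually_mono)
    then show ?thesis using AC_eq[OF A, of a b] that 0 by (auto simp: cutneg_def)
  qed
  have pos: "(LINT x:{a..b}|lebesgue. cutneg k x) = cutneg h b - cutneg h a" if "a \<le> b" "0 \<le> a" for a b
  proof -
    have "(LINT x:{a..b}|lebesgue. cutneg k x) = (LINT (x::real)|lebesgue. (0::real))"
      unfolding set_lebesgue_integral_def
      by (rule Bochner_Integration.integral_cong) (use that in \<open>auto simp: indicator_def cutneg_def\<close>)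
    then show ?thesis using that 0 by (auto simp: cutneg_def)
  qed
  have "cutneg h b - cutneg h a = (LINT x:{a..b}|lebesgue. cutneg k x)" if "a \<le> b" for a b
  proof -
    consider "b \<le> 0" | "0 \<le> a" | "a \<le> 0" "0 \<le> b" by linarith
    then show ?thesis
    proof cases
      case 3
      then show ?thesis using set_integral_Icc_combine[OF ki 3] neg[of a 0] pos[of 0 b] by simp
    qed (use neg pos that in auto)
  qed
  then show ?thesis unfolding AC_def using ki by auto
qed

lemma H1_by_parts:
  assumes P: "P \<in> H1" and v: "AC v r" "v \<in> L2" "r \<in> L2"
  shows "(LINT x|lebesgue. snd P x * v x) = - (LINT x|lebesgue. fst P x * r x)"
proof -
  have i: "integrable lebesgue (\<lambda>x. snd P x * v x)" "integrable lebesgue (\<lambda>x. fst P x * r x)" "integrable lebesgue (\<lambda>x. fst P x * v x)"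
    using P v by (auto simp: L2_mult_integrable H1_D)
  have "(LINT x|lebesgue. snd P x * v x + fst P x * r x) = 0"
    using i by (intro AC_integral_eq_0[OF AC_mult[OF H1_D(1)[OF P] v(1)]]) auto
  then show ?thesis using i by simp
qed

section \<open>Weak derivatives\<close>

text \<open>Differentiability of order \<open>n\<close> by recursion on existing derivatives instead
  of \<open>deriv ^^ n\<close>, so that closure under sums, products and affine substitutions
  follows by induction on \<open>n\<close>.\<close>

fun cdiff :: "nat \<Rightarrow> (real \<Rightarrow> real) \<Rightarrow> bool" where
  "cdiff 0 f = True"
| "cdiff (Suc n) f = (\<exists>f'. (\<forall>x. (f has_real_derivative f' x) (at x)) \<and> cdiff n f')"

lemma cdiff_deriv_funpow: "cdiff (Suc n) f \<Longrightarrow> (deriv ^^ n) f differentiable (at x)"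
proof (induction n arbitrary: f)
  case 0
  then show ?case by (auto simp: real_differentiable_def)
next
  case (Suc n)
  then obtain f' where f': "\<And>x. (f has_real_derivative f' x) (at x)" "cdiff (Suc n) f'" by auto
  then have "deriv f = f'" by (auto intro: DERIV_imp_deriv)
  then show ?case using Suc.IH[OF f'(2)] by (simp add: funpow_swap1)
qed

lemma cdiff_const: "cdiff n (\<lambda>x. c)"
proof (induction n arbitrary: c)
  case (Suc n)
  show ?case using Suc[of 0] by (auto intro!: exI[of _ "\<lambda>x. 0"])
qed simp

lemma cdiff_Suc_D: "cdiff (Suc n) f \<Longrightarrow> cdiff n f"
proof (induction n arbitrary: f)
  case (Suc n)
  then obtain f' where f': "\<forall>x. (f has_real_derivative f' x) (at x)" "cdiff (Suc n) f'" by auto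
  then have "cdiff n f'" using Suc.IH by blast
  then show ?case using f' by auto
qed simp

lemma cdiff_add: "cdiff n f \<Longrightarrow> cdiff n g \<Longrightarrow> cdiff n (\<lambda>x. f x + g x)"
proof (induction n arbitrary: f g)
  case (Suc n)
  obtain f' where f': "\<forall>x. (f has_real_derivative f' x) (at x)" "cdiff n f'" using Suc.prems(1) by auto
  obtain g' where g': "\<forall>x. (g has_real_derivative g' x) (at x)" "cdiff n g'" using Suc.prems(2) by auto
  show ?case using f' g' Suc.IH by (auto intro!: exI[of _ "\<lambda>x. f' x + g' x"] DERIV_add)
qed simp

lemma cdiff_mult: "cdiff n f \<Longrightarrow> cdiff n g \<Longrightarrow> cdiff n (\<lambda>x. f x * g x)"
proof (induction n arbitrary: f g)
  case (Suc n)
  obtain f' where f': "\<forall>x. (f has_real_derivative f' x) (at x)" "cdiff n f'" using Suc.prems(1) by auto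
  obtain g' where g': "\<forall>x. (g has_real_derivative g' x) (at x)" "cdiff n g'" using Suc.prems(2) by auto
  have "cdiff n f" "cdiff n g" using Suc.prems cdiff_Suc_D by blast+
  then have "cdiff n (\<lambda>x. f x * g' x + f' x * g x)" using f' g' Suc.IH by (intro cdiff_add) auto
  then show ?case using f' g' by (auto intro!: exI[of _ "\<lambda>x. f x * g' x + f' x * g x"] DERIV_mult')
qed simp

lemma cdiff_scale: "cdiff n f \<Longrightarrow> cdiff n (\<lambda>x. c * f x)"
  by (intro cdiff_mult cdiff_const)

lemma cdiff_affine: "cdiff n f \<Longrightarrow> cdiff n (\<lambda>x. f (c * x + d))"
proof (induction n arbitrary: f)
  case (Suc n)
  obtain f' where f': "\<And>x. (f has_real_derivative f' x) (at x)" "cdiff n f'" using Suc.prems(1) by auto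
  have "((\<lambda>x. f (c * x + d)) has_real_derivative f' (c * x + d) * c) (at x)" for x
    by (rule DERIV_chain2[OF f'(1)]) (auto intro!: derivative_eq_intros)
  moreover have "cdiff n (\<lambda>x. f' (c * x + d) * c)" using Suc.IH[OF f'(2)] cdiff_mult cdiff_const by blast
  ultimately show ?case by (auto intro!: exI[of _ "\<lambda>x. f' (c * x + d) * c"])
qed simp

text \<open>The functions \<open>x^(-k) exp(-1/x)\<close>, extended by zero. Their span is closed
  under differentiation, so that smoothness at the origin reduces to a single limit valid for all
  \<open>k\<close>.\<close>

definition flat :: "nat \<Rightarrow> real \<Rightarrow> real" where
  "flat k x = (if x > 0 then inverse x ^ k * exp (- inverse x) else 0)"

lemma flat_at_right: "((\<lambda>x. inverse x ^ k * exp (- inverse x)) \<longlongrightarrow> (0::real)) (at_right 0)"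
proof -
  have "((\<lambda>x. inverse x ^ k / exp (inverse x)) \<longlongrightarrow> (0::real)) (at_right 0)"
    by (rule filterlim_compose[OF tendsto_power_div_exp_0 filterlim_inverse_at_top_right])
  then show ?thesis by (simp add: exp_minus divide_inverse)
qed

lemma flat_deriv: "(flat k has_real_derivative flat (k + 2) x + (- real k) * flat (k + 1) x) (at x)"
proof -
  consider "x > 0" | "x = 0" | "x < 0" by linarith
  then show ?thesis
  proof cases
    case 1
    have "((\<lambda>x. inverse x ^ k * exp (- inverse x)) has_real_derivative
        inverse x ^ (k+2) * exp (- inverse x) + (- real k) * (inverse x ^ (k+1) * exp (- inverse x))) (at x)"
      using 1 by (auto intro!: derivative_eq_intros simp: power2_eq_square algebra_simps)
        (cases k; simp add: field_simps)
    then have "((\<lambda>x. inverse x ^ k * exp (- inverse x)) has_real_derivative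
        flat (k + 2) x + (- real k) * flat (k + 1) x) (at x)" using 1 by (simp add: flat_def)
    then show ?thesis
      by (rule DERIV_cong_ev[THEN iffD1, rotated -1])
         (use 1 eventually_nhds_in_open[of "{0<..}" x] in \<open>auto simp: flat_def elim!: eventually_mono\<close>)
  next
    case 2
    have "((\<lambda>h. (flat k (0 + h) - flat k 0) / h) \<longlongrightarrow> 0) (at 0)"
    proof (rule filterlim_split_at)
      show "((\<lambda>h. (flat k (0 + h) - flat k 0) / h) \<longlongrightarrow> 0) (at_left 0)"
        by (rule tendsto_eventually) (auto simp: eventually_at_left_field flat_def intro!: exI[of _ "-1"])
      have "\<forall>\<^sub>F h in at_right 0. inverse h ^ (Suc k) * exp (- inverse h) = (flat k (0 + h) - flat k 0) / h"
        by (auto simp: eventually_at_right_field flat_def field_simps intro!: exI[of _ "1"])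
      then show "((\<lambda>h. (flat k (0 + h) - flat k 0) / h) \<longlongrightarrow> 0) (at_right 0)"
        using flat_at_right[of "Suc k"] by (rule Lim_transform_eventually[rotated])
    qed
    then show ?thesis using 2 by (simp add: DERIV_def flat_def)
  next
    case 3
    have "((\<lambda>x. 0) has_real_derivative flat (k + 2) x + (- real k) * flat (k + 1) x) (at x)"
      using 3 by (simp add: flat_def)
    then show ?thesis
      by (rule DERIV_cong_ev[THEN iffD1, rotated -1])
         (use 3 eventually_nhds_in_open[of "{..<0}" x] in \<open>auto simp: flat_def elim!: eventually_mono\<close>)
  qed
qed

lemma cdiff_flat: "cdiff n (flat k)"
proof (induction n arbitrary: k)
  case (Suc n)
  have "cdiff n (\<lambda>x. flat (k + 2) x + (- real k) * flat (k + 1) x)"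
    by (intro cdiff_add cdiff_scale Suc)
  then show ?case
    unfolding cdiff.simps using flat_deriv
    by (intro exI[of _ "\<lambda>x. flat (k + 2) x + (- real k) * flat (k + 1) x"] conjI allI)
qed simp

lemma AC_of_derivative:
  assumes d: "\<And>x. (f has_real_derivative f' x) (at x)" and c: "continuous_on UNIV f'"
  shows "AC f f'"
proof -
  have i: "set_integrable lebesgue {a..b} f'" for a b
    by (rule absolutely_integrable_continuous_real) (rule continuous_on_subset[OF c], simp)
  have "f b - f a = (LINT x:{a..b}|lebesgue. f' x)" if "a \<le> b" for a b
    using fundamental_theorem_of_calculus[of a b f f'] that d set_lebesgue_integral_eq_integral(2)[OF i, of a b]
    by (metis has_real_derivative_iff_has_vector_derivative has_vector_derivative_at_within integral_unique)
  then show ?thesis using i by (auto simp: AC_def)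
qed

lemma continuous_antiderivative:
  assumes "continuous_on UNIV (f :: real \<Rightarrow> real)"
  obtains F where "\<And>x. (F has_real_derivative f x) (at x)"
proof -
  have "\<exists>F. \<forall>x::real. -\<infinity> < ereal x \<longrightarrow> ereal x < \<infinity> \<longrightarrow> (F has_vector_derivative f x) (at x)"
    using assms by (intro einterval_antiderivative) (auto simp: continuous_on_eq_continuous_at)
  then show ?thesis using that by (auto simp: has_real_derivative_iff_has_vector_derivative)
qed

lemma cdiff_continuous: "cdiff (Suc n) f \<Longrightarrow> continuous_on UNIV f"
  unfolding cdiff.simps using continuous_at_imp_continuous_on DERIV_isCont by blast

text \<open>The step is the normalized primitive of the bump \<open>r\<close>, which is supported in
  the unit interval. Its derivative \<open>\<rho>\<close> has integral 1 and later serves to correct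
  the mean value of a test function.\<close>

lemma smooth_step_exists:
  obtains s \<rho> :: "real \<Rightarrow> real" where "\<And>x. (s has_real_derivative \<rho> x) (at x)" "\<And>n. cdiff n \<rho>"
    "\<And>x. x \<le> 0 \<Longrightarrow> s x = 0" "\<And>x. x \<ge> 1 \<Longrightarrow> s x = 1" "\<And>x. 0 \<le> s x" "\<And>x. s x \<le> 1"
    "\<And>x. x \<le> 0 \<Longrightarrow> \<rho> x = 0" "\<And>x. x \<ge> 1 \<Longrightarrow> \<rho> x = 0"
proof -
  define r where "r x = flat 0 x * flat 0 ((-1) * x + 1)" for x
  have r: "cdiff n r" for n unfolding r_def by (intro cdiff_mult cdiff_affine cdiff_flat)
  have cr: "continuous_on UNIV r" using cdiff_continuous[OF r] .
  have r0: "r x \<ge> 0" and r1: "x \<le> 0 \<Longrightarrow> r x = 0" "x \<ge> 1 \<Longrightarrow> r x = 0" for x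
    by (auto simp: r_def flat_def)
  obtain F where F: "\<And>x. (F has_real_derivative r x) (at x)" using continuous_antiderivative[OF cr] by blast
  have mono: "F x \<le> F y" if "x \<le> y" for x y
    using DERIV_nonneg_imp_nondecreasing[OF that] F r0 by metis
  have const: "F x = F y" if "x \<le> y" "\<And>z. z \<in> {x..y} \<Longrightarrow> r z = 0" for x y
  proof -
    have "\<exists>c. \<forall>z\<in>{x..y}. F z = c"
    proof (rule has_field_derivative_zero_constant)
      show "(F has_real_derivative 0) (at z within {x..y})" if "z \<in> {x..y}" for z
        using F[of z] \<open>\<And>z. z \<in> {x..y} \<Longrightarrow> r z = 0\<close>[OF that] by (simp add: has_field_derivative_at_within)
    qed simp
    then show ?thesis using that(1) by auto
  qed
  \<comment> \<open>Equality would make the monotone \<open>F\<close> constant on the unit interval,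
    against \<open>r (1/2) > 0\<close>.\<close>
  have "F 0 < F 1"
  proof -
    have "F 0 \<noteq> F 1"
    proof
      assume eq: "F 0 = F 1"
      have "F x = F 0" if "x \<in> {0<..<1}" for x using mono[of 0 x] mono[of x 1] eq that by auto
      then have "\<forall>\<^sub>F x in nhds (1/2). F x = F 0"
        using eventually_nhds_in_open[of "{0<..<1::real}" "1/2"] by (auto elim!: eventually_mono)
      then have "((\<lambda>x. F 0) has_real_derivative r (1/2)) (at (1/2))"
        using F[of "1/2"] DERIV_cong_ev[of "1/2" "1/2" F "\<lambda>x. F 0" "r (1/2)" "r (1/2)"] by blast
      then have "r (1/2) = 0" using DERIV_unique DERIV_const by blast
      then show False by (simp add: r_def flat_def)
    qed
    then show ?thesis using mono[of 0 1] by simp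
  qed
  define s where "s x = inverse (F 1 - F 0) * (F x - F 0)" for x
  define \<rho> where "\<rho> x = inverse (F 1 - F 0) * r x" for x
  have le0: "F x = F 0" if "x \<le> 0" for x using const[OF that] r1 by auto
  have ge1: "F x = F 1" if "x \<ge> 1" for x using const[OF that] r1 by auto
  show ?thesis
  proof (rule that[of s \<rho>])
    show "(s has_real_derivative \<rho> x) (at x)" for x
      unfolding s_def \<rho>_def by (auto intro!: derivative_eq_intros F)
    show "cdiff n \<rho>" for n unfolding \<rho>_def by (intro cdiff_scale r)
    show "x \<le> 0 \<Longrightarrow> s x = 0" "x \<ge> 1 \<Longrightarrow> s x = 1" for x
      using le0[of x] ge1[of x] \<open>F 0 < F 1\<close> by (simp_all add: s_def)
    have "F 0 \<le> F x \<and> F x \<le> F 1" for x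
    proof -
      consider "x \<le> 0" | "0 \<le> x" "x \<le> 1" | "x \<ge> 1" by linarith
      then show ?thesis
        using mono[of 0 x] mono[of x 1] le0[of x] ge1[of x] \<open>F 0 < F 1\<close> by cases auto
    qed
    then show "0 \<le> s x" "s x \<le> 1" for x
      using \<open>F 0 < F 1\<close> by (simp_all add: s_def field_simps)
  qed (auto simp: \<rho>_def r1)
qed

lemma test_functionI:
  assumes "\<And>n. cdiff n \<phi>" "\<And>x. \<bar>x\<bar> > R \<Longrightarrow> \<phi> x = 0"
  shows "test_function \<phi>"
  unfolding test_function_def using assms cdiff_deriv_funpow by blast

lemma test_functionD:
  assumes "test_function \<phi>"
  obtains R where "AC \<phi> (deriv \<phi>)" "continuous_on UNIV (deriv \<phi>)" "continuous_on UNIV \<phi>"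
    "\<And>x. \<bar>x\<bar> > R \<Longrightarrow> \<phi> x = 0" "\<And>x. \<bar>x\<bar> > R \<Longrightarrow> deriv \<phi> x = 0"
proof -
  have d: "((deriv ^^ n) \<phi>) differentiable (at x)" for n x using assms by (auto simp: test_function_def)
  obtain R where R: "\<And>x. \<bar>x\<bar> > R \<Longrightarrow> \<phi> x = 0" using assms by (auto simp: test_function_def)
  have D: "(\<phi> has_real_derivative deriv \<phi> x) (at x)" for x
    using d[of 0 x] by (simp add: DERIV_deriv_iff_real_differentiable)
  have c: "continuous_on UNIV (deriv \<phi>)"
    using d[of 1] by (auto intro!: continuous_at_imp_continuous_on differentiable_imp_continuous_within)
  have c': "continuous_on UNIV \<phi>"
    using d[of 0] by (auto intro!: continuous_at_imp_continuous_on differentiable_imp_continuous_within)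
  have "deriv \<phi> x = 0" if x: "\<bar>x\<bar> > R" for x
  proof -
    have "open {y. \<bar>y\<bar> > R}" by (intro open_Collect_less continuous_intros)
    then have "\<forall>\<^sub>F y in nhds x. \<phi> y = 0"
      using eventually_nhds_in_open[of "{y. \<bar>y\<bar> > R}" x] x R by (auto elim!: eventually_mono)
    then have "((\<lambda>x. 0) has_real_derivative deriv \<phi> x) (at x)"
      using D[of x] DERIV_cong_ev[of x x \<phi> "\<lambda>x. 0"] by blast
    then show ?thesis using DERIV_unique DERIV_const by blast
  qed
  then show ?thesis using that AC_of_derivative[OF D c] c c' R by blast
qed

lemma integrable_of_compact_support:
  fixes f :: "real \<Rightarrow> real"
  assumes "set_integrable lebesgue {-R..R} f" "\<And>x. \<bar>x\<bar> > R \<Longrightarrow> f x = 0"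
  shows "integrable lebesgue f"
proof -
  have "f = (\<lambda>x. indicator {-R..R} x *\<^sub>R f x)"
    using assms(2) by (force simp: indicator_def)
  then show ?thesis using assms(1) unfolding set_integrable_def by simp
qed

lemma continuous_integrable_mult:
  fixes f :: "real \<Rightarrow> real"
  assumes "continuous_on UNIV f" "\<And>x. \<bar>x\<bar> > R \<Longrightarrow> f x = 0" "\<And>a b. set_integrable lebesgue {a..b} u"
  shows "integrable lebesgue (\<lambda>x. f x * u x)"
  by (rule integrable_of_compact_support[of R]) (auto intro: set_integrable_continuous_mult assms simp: assms(2))

lemma continuous_set_integrable:
  fixes f :: "real \<Rightarrow> real"
  shows "continuous_on UNIV f \<Longrightarrow> set_integrable lebesgue {a..b} f"
  by (rule absolutely_integrable_continuous_real) (auto intro: continuous_on_subset)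

lemma AC_test_by_parts:
  assumes A: "AC U g" and t: "test_function \<phi>"
  shows "(LINT x|lebesgue. deriv \<phi> x * U x) = - (LINT x|lebesgue. \<phi> x * g x)"
proof -
  obtain R where R: "AC \<phi> (deriv \<phi>)" "continuous_on UNIV (deriv \<phi>)" "continuous_on UNIV \<phi>"
    "\<And>x. \<bar>x\<bar> > R \<Longrightarrow> \<phi> x = 0" "\<And>x. \<bar>x\<bar> > R \<Longrightarrow> deriv \<phi> x = 0" using test_functionD[OF t] by metis
  have Ui: "set_integrable lebesgue {a..b} U" for a b
    using AC_continuous[OF A] by (rule continuous_set_integrable)
  have i: "integrable lebesgue (\<lambda>x. deriv \<phi> x * U x)" "integrable lebesgue (\<lambda>x. \<phi> x * g x)" "integrable lebesgue (\<lambda>x. \<phi> x * U x)"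
    using continuous_integrable_mult[OF R(2,5) Ui] continuous_integrable_mult[OF R(3,4) Ui]
      continuous_integrable_mult[OF R(3,4) AC_integrable[OF A]] by auto
  have "(LINT x|lebesgue. deriv \<phi> x * U x + \<phi> x * g x) = 0"
    using i by (intro AC_integral_eq_0[OF AC_mult[OF R(1) A]]) auto
  then show ?thesis using i by simp
qed

section \<open>Functions determined by their integrals over intervals\<close>

lemma AE_neq_real: "AE x in lebesgue. x \<noteq> (c::real)"
  by (rule AE_I[where N="{c}"]) auto

text \<open>
  Sets are approximated from outside by open sets, and open sets are decomposed into intervals.
\<close>

lemma set_integral_open_nonpos:
  fixes f :: "real \<Rightarrow> real"
  assumes f: "\<And>a b. set_integrable lebesgue {a..b} f"
    and le: "\<And>a b. a \<le> b \<Longrightarrow> (LINT x:{a..b}|lebesgue. f x) \<le> 0"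
    and O: "open S" "S \<subseteq> {-R..R}"
  shows "(LINT x:S|lebesgue. f x) \<le> 0"
proof -
  let ?C = "components S"
  have opn: "open K" if "K \<in> ?C" for K using open_components O(1) that by blast
  have dj: "pairwise disjnt ?C" using pairwise_disjoint_components[of S] by (simp add: pairwise_def disjnt_def)
  have "countable ?C" using countable_disjoint_open_subsets[OF opn dj] by blast
  \<comment> \<open>An enumeration of the countably many components; indices that are not codes of
    components receive the empty set.\<close>
  define A where "A i = (if i \<in> to_nat_on ?C ` ?C then from_nat_into ?C i else {})" for i
  have AC: "A i \<in> ?C \<or> A i = {}" for i
    using \<open>countable ?C\<close> by (auto simp: A_def)
  have UA: "(\<Union>i. A i) = S"
  proof -
    have "(\<Union>i. A i) = \<Union>?C"
    proof
      show "(\<Union>i. A i) \<subseteq> \<Union>?C" using AC by fastforce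
      show "\<Union>?C \<subseteq> (\<Union>i. A i)"
      proof
        fix x assume "x \<in> \<Union>?C"
        then obtain K where K: "K \<in> ?C" "x \<in> K" by (rule UnionE)
        then have "A (to_nat_on ?C K) = K" using \<open>countable ?C\<close> by (simp add: A_def)
        then show "x \<in> (\<Union>i. A i)" using K(2) by blast
      qed
    qed
    then show ?thesis by simp
  qed
  have disj: "A i \<inter> A j = {}" if "i \<noteq> j" for i j
  proof (cases "i \<in> to_nat_on ?C ` ?C \<and> j \<in> to_nat_on ?C ` ?C")
    case True
    then obtain K L where KL: "K \<in> ?C" "L \<in> ?C" "i = to_nat_on ?C K" "j = to_nat_on ?C L" by auto
    then have "A i = K" "A j = L" "K \<noteq> L" using \<open>countable ?C\<close> that by (auto simp: A_def)
    then show ?thesis using KL dj by (auto simp: pairwise_def disjnt_def)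
  next
    case False
    then show ?thesis by (auto simp: A_def)
  qed
  have meas: "A i \<in> sets lebesgue" for i using AC[of i] opn by auto
  have Sint: "set_integrable lebesgue S f"
    using f[of "-R" R] by (rule set_integrable_subset) (use O in auto)
  have comp: "(LINT x:K|lebesgue. f x) \<le> 0" if K: "K \<in> ?C" for K
  proof -
    have KS: "K \<subseteq> {-R..R}" using O(2) in_components_subset[OF K] by auto
    have Kne: "K \<noteq> {}" using in_components_nonempty[OF K] .
    have Kcon: "is_interval K" using in_components_connected[OF K] by (simp add: is_interval_connected_1)
    have bb: "bdd_above K" "bdd_below K" using KS by (meson bdd_above_Icc bdd_below_Icc bdd_above_mono bdd_below_mono)+
    have sub: "K \<subseteq> {Inf K..Sup K}" using bb by (auto intro: cInf_lower cSup_upper)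
    have sup: "{Inf K<..<Sup K} \<subseteq> K"
    proof
      fix x assume x: "x \<in> {Inf K<..<Sup K}"
      obtain a where a: "a \<in> K" "a < x" using x cInf_lessD[OF Kne, of x] by auto
      obtain b where b: "b \<in> K" "x < b" using x less_cSupD[OF Kne, of x] by auto
      show "x \<in> K" using mem_is_interval_1_I[OF Kcon a(1) b(1)] a b by simp
    qed
    \<comment> \<open>A component is an interval and differs from the closed interval with the same
      ends by at most two points.\<close>
    have "(LINT x:K|lebesgue. f x) = (LINT x:{Inf K..Sup K}|lebesgue. f x)"
    proof (rule set_integral_cong_set)
      show "set_borel_measurable lebesgue {Inf K..Sup K} f"
        using f unfolding set_integrable_def set_borel_measurable_def by auto
      have "set_integrable lebesgue K f"
        using f[of "-R" R] by (rule set_integrable_subset) (use opn[OF K] KS in auto)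
      then show "set_borel_measurable lebesgue K f"
        unfolding set_integrable_def set_borel_measurable_def by auto
      show "AE x in lebesgue. (x \<in> {Inf K..Sup K}) = (x \<in> K)"
        using AE_neq_real[of "Inf K"] AE_neq_real[of "Sup K"]
      proof eventually_elim
        case (elim x) then show ?case using sub sup by (auto simp: less_le)
      qed
    qed
    also have "\<dots> \<le> 0" using sub Kne by (intro le) auto
    finally show ?thesis .
  qed
  have le0: "(LINT x:A i|lebesgue. f x) \<le> 0" for i
    using AC[of i] comp by (auto simp: set_lebesgue_integral_def)
  have "(\<lambda>n. LINT x:(\<Union>i<n. A i)|lebesgue. f x) \<longlonglongrightarrow> (LINT x:(\<Union>n. \<Union>i<n. A i)|lebesgue. f x)"
  proof (rule set_integral_cont_up)
    have "(\<Union>n. \<Union>i<n. A i) = S" using UA by auto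
    then show "set_integrable lebesgue (\<Union>n. \<Union>i<n. A i) f" using Sint by simp
    show "incseq (\<lambda>n. \<Union>i<n. A i)" by (force simp: incseq_def)
  qed (use meas in auto)
  moreover have "(\<Union>n. \<Union>i<n. A i) = S" using UA by auto
  moreover have "(LINT x:(\<Union>i<n. A i)|lebesgue. f x) \<le> 0" for n
  proof -
    have "set_integrable lebesgue (A i) f" for i
      using Sint by (rule set_integrable_subset) (use meas UA in auto)
    then have "(LINT x:(\<Union>i<n. A i)|lebesgue. f x) = (\<Sum>i<n. (LINT x:A i|lebesgue. f x))"
      by (intro set_integral_finite_Union) (auto simp: disjoint_family_on_def disj meas)
    then show ?thesis using le0 by (simp add: sum_nonpos)
  qed
  ultimately show ?thesis by (metis (no_types, lifting) LIMSEQ_le_const2)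
qed

text \<open>The set where \<open>f\<close> is positive is, up to a null set, the intersection of
  decreasing open sets. The integrals of \<open>f\<close> over these are nonpositive, and so is
  their limit, the integral of \<open>f\<close> over that set. This forces the set to be
  null.\<close>

lemma AE_nonpos_of_intervals:
  fixes f :: "real \<Rightarrow> real"
  assumes f: "\<And>a b. set_integrable lebesgue {a..b} f"
    and le: "\<And>a b. a \<le> b \<Longrightarrow> (LINT x:{a..b}|lebesgue. f x) \<le> 0"
  shows "AE x in lebesgue. f x \<le> 0"
proof -
  have m: "f \<in> borel_measurable lebesgue" using locally_integrable_measurable f by blast
  have null: "{x \<in> {-real n<..<real n}. f x > 0} \<in> null_sets lebesgue" for n
  proof -
    let ?S = "{x \<in> {-real n<..<real n}. f x > 0}"
    have S: "?S \<in> sets lebesgue"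
    proof -
      have 1: "{x \<in> space lebesgue. 0 < f x} \<in> sets lebesgue" using m by measurable
      have 2: "{-real n<..<real n} \<in> sets lebesgue" by simp
      have "?S = {x \<in> space lebesgue. 0 < f x} \<inter> {-real n<..<real n}" by auto
      then show ?thesis using sets.Int[OF 1 2] by (simp only:)
    qed
    obtain C T where CT: "gdelta C" "T \<in> null_sets lebesgue" "?S \<union> T = C" using lebesgue_set_almost_gdelta[OF S] by metis
    obtain F :: "nat \<Rightarrow> real set" where F: "\<And>n. open (F n)" "C = (\<Inter>n. F n)" using CT(1) by (auto elim: gdelta.cases)
    \<comment> \<open>Finite intersections inside a bounded interval are open and decreasing, and
      \<open>f\<close> is integrable over them, as the passage to the limit requires.\<close>
    define U where "U i = {-real n<..<real n} \<inter> (\<Inter>j\<le>i. F j)" for i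
    have Uo: "open (U i)" for i unfolding U_def by (intro open_Int open_INT) (use F in auto)
    have dec: "decseq U" unfolding decseq_def U_def by (auto; meson order_trans)
    have UI: "(\<Inter>i. U i) = {-real n<..<real n} \<inter> C" unfolding U_def F(2) by auto
    have int: "set_integrable lebesgue {-real n<..<real n} f"
      using f[of "-real n" "real n"] by (rule set_integrable_subset) auto
    have intU: "set_integrable lebesgue (U i) f" for i
      using int by (rule set_integrable_subset) (use Uo in \<open>auto simp: U_def\<close>)
    have "(\<lambda>i. LINT x:U i|lebesgue. f x) \<longlonglongrightarrow> (LINT x:(\<Inter>i. U i)|lebesgue. f x)"
      using Uo dec intU by (intro set_integral_cont_down) auto
    moreover have "(LINT x:U i|lebesgue. f x) \<le> 0" for i
      using Uo by (intro set_integral_open_nonpos[OF f le, where R="real n"]) (auto simp: U_def)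
    ultimately have le0: "(LINT x:(\<Inter>i. U i)|lebesgue. f x) \<le> 0"
      by (intro LIMSEQ_le_const2) auto
    have intS: "set_integrable lebesgue ?S f" using int by (rule set_integrable_subset) (use S in auto)
    have "(LINT x:(\<Inter>i. U i)|lebesgue. f x) = (LINT x:?S|lebesgue. f x)"
    proof (rule set_integral_cong_set)
      show "set_borel_measurable lebesgue ?S f" using intS unfolding set_integrable_def set_borel_measurable_def by auto
      have "set_integrable lebesgue (\<Inter>i. U i) f"
      proof (rule set_integrable_subset[OF int])
        have "U i \<in> sets lebesgue" for i using Uo by auto
        then show "(\<Inter>i. U i) \<in> sets lebesgue" by (intro sets.countable_INT) auto
        show "(\<Inter>i. U i) \<subseteq> {-real n<..<real n}" using UI by blast
      qed
      then show "set_borel_measurable lebesgue (\<Inter>i. U i) f" unfolding set_integrable_def set_borel_measurable_def by auto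
      show "AE x in lebesgue. (x \<in> ?S) = (x \<in> (\<Inter>i. U i))"
        using AE_not_in[OF CT(2)] by eventually_elim (use CT(3) UI in auto)
    qed
    then have "(LINT x:?S|lebesgue. f x) \<le> 0" using le0 by simp
    moreover have "(LINT x:?S|lebesgue. f x) \<ge> 0"
      unfolding set_lebesgue_integral_def by (intro integral_nonneg_AE AE_I2) (auto simp: indicator_def)
    ultimately have "(LINT x:?S|lebesgue. f x) = 0" by (rule antisym)
    moreover have "(LINT x:?S|lebesgue. indicator {-real n<..<real n} x *\<^sub>R f x) = (LINT x:?S|lebesgue. f x)"
      unfolding set_lebesgue_integral_def by (rule Bochner_Integration.integral_cong) (auto simp: indicator_def)
    ultimately have eq: "(LINT x:?S|lebesgue. indicator {-real n<..<real n} x *\<^sub>R f x) = 0" by (rule trans[rotated])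
    show ?thesis
      by (rule null_if_pos_func_has_zero_int[OF int[unfolded set_integrable_def] S _ eq]) (auto simp: indicator_def)
  qed
  have "(\<Union>n. {x \<in> {-real n<..<real n}. f x > 0}) \<in> null_sets lebesgue"
    using null by (intro null_sets_UN) auto
  then have "AE x in lebesgue. x \<notin> (\<Union>n. {x \<in> {-real n<..<real n}. f x > 0})" by (rule AE_not_in)
  then show ?thesis
  proof eventually_elim
    case (elim x)
    obtain n :: nat where "\<bar>x\<bar> < real n" using reals_Archimedean2 by blast
    then have "x \<in> {-real n<..<real n}" by auto
    then show ?case using elim by force
  qed
qed

lemma AE_zero_of_intervals:
  fixes f :: "real \<Rightarrow> real"
  assumes f: "\<And>a b. set_integrable lebesgue {a..b} f"
    and le: "\<And>a b. a \<le> b \<Longrightarrow> (LINT x:{a..b}|lebesgue. f x) = 0"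
  shows "AE x in lebesgue. f x = 0"
proof -
  have "AE x in lebesgue. f x \<le> 0" using AE_nonpos_of_intervals[OF f] le by auto
  moreover have "set_integrable lebesgue {a..b} (\<lambda>x. - f x)" for a b
    using f[of a b] by (simp add: set_integrable_def)
  then have "AE x in lebesgue. - f x \<le> 0"
    by (rule AE_nonpos_of_intervals) (use f le in \<open>simp add: set_integral_uminus\<close>)
  ultimately show ?thesis by eventually_elim auto
qed

section \<open>Weak derivatives and continuous representatives\<close>

lemma AC_primitive_exists:
  assumes g: "\<And>a b. set_integrable lebesgue {a..b} (g :: real \<Rightarrow> real)"
  shows "\<exists>U. AC U g"
proof -
  define U where "U x = (if x \<ge> 0 then (LINT t:{0..x}|lebesgue. g t) else - (LINT t:{x..0}|lebesgue. g t))" for x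
  have "U b - U a = (LINT x:{a..b}|lebesgue. g x)" if "a \<le> b" for a b
  proof -
    consider "0 \<le> a" | "a < 0" "0 \<le> b" | "b < 0" by linarith
    then show ?thesis
    proof cases
      case 1 then show ?thesis using set_integral_Icc_combine[OF g, of 0 a b] that by (simp add: U_def)
    next
      case 2 then show ?thesis using set_integral_Icc_combine[OF g, of a 0 b] that by (simp add: U_def)
    next
      case 3 then show ?thesis using set_integral_Icc_combine[OF g, of a b 0] that by (simp add: U_def)
    qed
  qed
  then show ?thesis using g unfolding AC_def by blast
qed

text \<open>The difference of two steps, compressed by the factor \<open>Suc n\<close>, tends
  pointwise to the indicator of \<open>{a<..b}\<close>. Since the factor is at least 1, all supports
  lie in the same interval \<open>{a..b + 1}\<close>.\<close>

lemma smooth_interval_approximation: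
  obtains \<psi> :: "real \<Rightarrow> real \<Rightarrow> nat \<Rightarrow> real \<Rightarrow> real" where "\<And>m a b n. cdiff m (\<psi> a b n)"
    "\<And>a b n x. a \<le> b \<Longrightarrow> x \<le> a \<or> x \<ge> b + 1 \<Longrightarrow> \<psi> a b n x = 0" "\<And>a b n x. \<bar>\<psi> a b n x\<bar> \<le> 1"
    "\<And>a b x. (\<lambda>n. \<psi> a b n x) \<longlonglongrightarrow> (if x \<le> a then 0 else 1) - (if x \<le> b then 0 else 1)"
proof -
  obtain s \<rho> :: "real \<Rightarrow> real" where s: "\<And>x. (s has_real_derivative \<rho> x) (at x)" "\<And>n. cdiff n \<rho>"
    "\<And>x. x \<le> 0 \<Longrightarrow> s x = 0" "\<And>x. x \<ge> 1 \<Longrightarrow> s x = 1" "\<And>x. 0 \<le> s x" "\<And>x. s x \<le> 1"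
    "\<And>x. x \<le> 0 \<Longrightarrow> \<rho> x = 0" "\<And>x. x \<ge> 1 \<Longrightarrow> \<rho> x = 0" using smooth_step_exists by metis
  have sc: "cdiff n s" for n using s(1,2) by (cases n) (auto intro!: exI[of _ "\<rho>"])
  define \<psi> where "\<psi> a b n x = s (real (Suc n) * x + (- real (Suc n) * a)) + (-1) * s (real (Suc n) * x + (- real (Suc n) * b))" for a b n x
  have \<psi>smooth: "cdiff m (\<psi> a b n)" for m a b n
    unfolding \<psi>_def by (intro cdiff_add cdiff_scale cdiff_affine sc)
  have arg: "real (Suc n) * x + (- real (Suc n) * a) = real (Suc n) * (x - a)" for n x a by (simp add: algebra_simps)
  have s_le: "x \<le> a \<Longrightarrow> s (real (Suc n) * (x - a)) = 0" for n x a
    by (rule s(3)) (simp add: mult_nonneg_nonpos)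
  have s_ge: "x \<ge> a + 1 \<Longrightarrow> s (real (Suc n) * (x - a)) = 1" for n x a
  proof (rule s(4))
    assume "x \<ge> a + 1"
    then have "1 * 1 \<le> real (Suc n) * (x - a)" by (intro mult_mono) auto
    then show "1 \<le> real (Suc n) * (x - a)" by simp
  qed
  have \<psi>0: "\<psi> a b n x = 0" if "a \<le> b" "x \<le> a \<or> x \<ge> b + 1" for a b n x
    using that s_le[of x a n] s_le[of x b n] s_ge[of a x n] s_ge[of b x n] unfolding \<psi>_def arg by auto
  have \<psi>1: "\<bar>\<psi> a b n x\<bar> \<le> 1" for a b n x
    unfolding \<psi>_def arg using s(5,6)[of "real (Suc n) * (x - a)"] s(5,6)[of "real (Suc n) * (x - b)"] by (auto simp: abs_le_iff)
  have slim: "(\<lambda>n. s (real (Suc n) * (x - a))) \<longlonglongrightarrow> (if x \<le> a then 0 else 1)" for x a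
  proof (rule tendsto_eventually, cases "x \<le> a")
    case True then show "\<forall>\<^sub>F n in sequentially. s (real (Suc n) * (x - a)) = (if x \<le> a then 0 else 1)"
      using s_le by auto
  next
    case False
    show "\<forall>\<^sub>F n in sequentially. s (real (Suc n) * (x - a)) = (if x \<le> a then 0 else 1)"
      using eventually_ge_at_top[of "nat \<lceil>1/(x - a)\<rceil>"]
    proof eventually_elim
      case (elim n)
      then have "1 / (x - a) \<le> real (Suc n)" by linarith
      then have "1 \<le> real (Suc n) * (x - a)" using False by (simp add: field_simps)
      then show ?case using s(4) False by auto
    qed
  qed
  have \<psi>lim: "(\<lambda>n. \<psi> a b n x) \<longlonglongrightarrow> (if x \<le> a then 0 else 1) - (if x \<le> b then 0 else 1)" for a b x
    using tendsto_diff[OF slim[of x a] slim[of x b]] unfolding \<psi>_def arg by simp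
  show ?thesis using that[of \<psi>] \<psi>smooth \<psi>0 \<psi>1 \<psi>lim by blast
qed

text \<open>The du Bois-Reymond lemma. A smooth \<open>\<psi>\<close> has a compactly supported
  primitive only after its mean value has been removed, which is done by subtracting a multiple of
  \<open>\<rho>\<close>. Testing with that primitive shows that \<open>w - k\<close> is orthogonal
  to every \<open>\<psi>\<close>, where \<open>k\<close> is the integral of
  \<open>\<rho> * w\<close>; approximate indicators then finish the proof.\<close>

lemma weak_constant:
  fixes w :: "real \<Rightarrow> real"
  assumes w: "\<And>a b. set_integrable lebesgue {a..b} w"
    and z: "\<And>\<phi>. test_function \<phi> \<Longrightarrow> (LINT x|lebesgue. deriv \<phi> x * w x) = 0"
  shows "\<exists>k. AE x in lebesgue. w x = k"
proof -
  obtain s \<rho> :: "real \<Rightarrow> real" where s: "\<And>x. (s has_real_derivative \<rho> x) (at x)" "\<And>n. cdiff n \<rho>"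
    "\<And>x. x \<le> 0 \<Longrightarrow> s x = 0" "\<And>x. x \<ge> 1 \<Longrightarrow> s x = 1" "\<And>x. 0 \<le> s x" "\<And>x. s x \<le> 1"
    "\<And>x. x \<le> 0 \<Longrightarrow> \<rho> x = 0" "\<And>x. x \<ge> 1 \<Longrightarrow> \<rho> x = 0" using smooth_step_exists by metis
  have sc: "cdiff n s" for n using s(1,2) by (cases n) (auto intro!: exI[of _ "\<rho>"])
  define k where "k = (LINT x|lebesgue. \<rho> x * w x)"
  have \<rho>c: "continuous_on UNIV \<rho>" using cdiff_continuous s(2) by blast
  obtain \<psi> :: "real \<Rightarrow> real \<Rightarrow> nat \<Rightarrow> real \<Rightarrow> real" where \<psi>smooth: "\<And>m a b n. cdiff m (\<psi> a b n)"
    and \<psi>0: "\<And>a b n x. a \<le> b \<Longrightarrow> x \<le> a \<or> x \<ge> b + 1 \<Longrightarrow> \<psi> a b n x = 0" and \<psi>1: "\<And>a b n x. \<bar>\<psi> a b n x\<bar> \<le> 1"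
    and \<psi>lim: "\<And>a b x. (\<lambda>n. \<psi> a b n x) \<longlonglongrightarrow> (if x \<le> a then 0 else 1) - (if x \<le> b then 0 else 1)"
    using smooth_interval_approximation by metis
  have \<psi>c: "continuous_on UNIV (\<psi> a b n)" for a b n using cdiff_continuous[OF \<psi>smooth] .
  have key: "(LINT x|lebesgue. \<psi> a b n x * (w x - k)) = 0" if ab: "a \<le> b" for a b n
  proof -
    \<comment> \<open>The lower bound 1 ensures that the support of \<open>\<rho>\<close>, the unit
      interval, lies in \<open>{-R..R}\<close> as well.\<close>
    define R where "R = max (max \<bar>a\<bar> \<bar>b + 1\<bar>) 1"
    have R: "-R \<le> a" "b + 1 \<le> R" "1 \<le> R" "0 < R" by (auto simp: R_def)
    have \<psi>R: "\<psi> a b n x = 0" if "\<bar>x\<bar> > R" for x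
      by (intro \<psi>0[OF ab]) (use R that in \<open>auto simp: abs_if split: if_splits\<close>)
    have \<psi>R': "-R \<le> x \<and> x \<le> R" if "\<psi> a b n x \<noteq> 0" for x
      using \<psi>R[of x] that by (metis abs_le_iff linorder_not_le minus_le_iff)
    obtain \<Psi> where \<Psi>: "\<And>x. (\<Psi> has_real_derivative \<psi> a b n x) (at x)"
      using continuous_antiderivative[OF \<psi>c] by blast
    have \<Psi>s: "cdiff m \<Psi>" for m 
      using \<Psi> \<psi>smooth by (cases m) (auto intro!: exI[of _ "\<psi> a b n"])
    have A: "AC \<Psi> (\<psi> a b n)" using AC_of_derivative[OF \<Psi> \<psi>c] .
    define c where "c = \<Psi> R - \<Psi> (-R)"
    have ci: "c = (LINT x|lebesgue. \<psi> a b n x)"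
    proof -
      have "c = (LINT x:{-R..R}|lebesgue. \<psi> a b n x)" unfolding c_def using AC_eq[OF A, of "-R" R] R by simp
      also have "\<dots> = (LINT x|lebesgue. \<psi> a b n x)" unfolding set_lebesgue_integral_def
        by (rule Bochner_Integration.integral_cong) (use \<psi>R' in \<open>auto simp: indicator_def\<close>)
      finally show ?thesis .
    qed
    \<comment> \<open>To the right of the support the primitive of \<open>\<psi>\<close> has the
      constant value \<open>c\<close>; subtracting \<open>c * s\<close> removes it.\<close>
    define \<phi> where "\<phi> x = (\<Psi> x + (- \<Psi> (-R))) + (-c) * s x" for x
    have \<phi>d: "(\<phi> has_real_derivative \<psi> a b n x - c * \<rho> x) (at x)" for x
      unfolding \<phi>_def by (auto intro!: derivative_eq_intros \<Psi> s(1))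
    have "test_function \<phi>"
    proof (rule test_functionI)
      show "cdiff m \<phi>" for m unfolding \<phi>_def by (intro cdiff_add cdiff_scale cdiff_const \<Psi>s sc)
      fix x assume x: "\<bar>x\<bar> > R"
      show "\<phi> x = 0"
      proof (cases "x < 0")
        case True
        then have "\<Psi> (-R) - \<Psi> x = (LINT t:{x..-R}|lebesgue. \<psi> a b n t)" using AC_eq[OF A, of x "-R"] x by simp
        also have "\<dots> = (LINT (t::real)|lebesgue. (0::real))" unfolding set_lebesgue_integral_def
          by (rule Bochner_Integration.integral_cong) (use \<psi>0[OF ab] R in \<open>auto simp: indicator_def\<close>)
        finally show ?thesis using True s(3)[of x] by (simp add: \<phi>_def)
      next
        case False
        then have "\<Psi> x - \<Psi> R = (LINT t:{R..x}|lebesgue. \<psi> a b n t)" using AC_eq[OF A, of R x] x by simp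
        also have "\<dots> = (LINT (t::real)|lebesgue. (0::real))" unfolding set_lebesgue_integral_def
          by (rule Bochner_Integration.integral_cong) (use \<psi>0[OF ab] R in \<open>auto simp: indicator_def\<close>)
        finally show ?thesis using False s(4)[of x] x R by (simp add: \<phi>_def c_def)
      qed
    qed
    from z[OF this] have "(LINT x|lebesgue. (\<psi> a b n x - c * \<rho> x) * w x) = 0"
      using DERIV_imp_deriv[OF \<phi>d] by simp
    moreover have i1: "integrable lebesgue (\<lambda>x. \<psi> a b n x * w x)"
      by (rule continuous_integrable_mult[OF \<psi>c, of R]) (use \<psi>R w in auto)
    moreover have i2: "integrable lebesgue (\<lambda>x. \<rho> x * w x)"
      by (rule continuous_integrable_mult[OF \<rho>c, of R]) (use s(7,8) R w in \<open>auto simp: abs_if split: if_splits\<close>)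
    moreover have i3: "integrable lebesgue (\<psi> a b n)"
      by (rule integrable_of_compact_support[of R]) (use \<psi>R continuous_set_integrable[OF \<psi>c] in auto)
    moreover have "(LINT x|lebesgue. (\<psi> a b n x - c * \<rho> x) * w x) = (LINT x|lebesgue. \<psi> a b n x * w x - c * (\<rho> x * w x))"
      by (simp add: algebra_simps)
    moreover have "(LINT x|lebesgue. \<psi> a b n x * (w x - k)) = (LINT x|lebesgue. \<psi> a b n x * w x - k * \<psi> a b n x)"
      by (simp add: algebra_simps)
    ultimately show ?thesis using ci k_def by simp
  qed
  have wk: "set_integrable lebesgue {a..b} (\<lambda>x. w x - k)" for a b
    by (intro set_integral_diff(1) w continuous_set_integrable) auto
  have "AE x in lebesgue. w x - k = 0"
  proof (rule AE_zero_of_intervals[OF wk])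
    fix a b :: real assume ab: "a \<le> b"
    let ?l = "\<lambda>x. ((if x \<le> a then 0 else 1) - (if x \<le> b then 0 else 1)) * (w x - k)"
    have wm: "(\<lambda>x. w x - k) \<in> borel_measurable lebesgue" using locally_integrable_measurable[OF wk] .
    have "?l = (\<lambda>x. (indicator {a<..} x - indicator {b<..} x) * (w x - k))"
      by (auto simp: indicator_def fun_eq_iff)
    moreover have "(\<lambda>x. (indicator {a<..} x - indicator {b<..} x) * (w x - k)) \<in> borel_measurable lebesgue"
      by (intro borel_measurable_times[OF _ wm] borel_measurable_diff borel_measurable_indicator) auto
    ultimately have lm: "?l \<in> borel_measurable lebesgue" by (simp only:)
    have "(\<lambda>n. LINT x|lebesgue. \<psi> a b n x * (w x - k)) \<longlonglongrightarrow> (LINT x|lebesgue. ?l x)"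
    proof (rule integral_dominated_convergence)
      show "integrable lebesgue (\<lambda>x. norm (indicator {a..b+1} x *\<^sub>R (w x - k)))"
        using wk[of a "b+1"] unfolding set_integrable_def by (rule integrable_norm)
      show "(\<lambda>x. \<psi> a b n x * (w x - k)) \<in> borel_measurable lebesgue" for n
        using continuous_lebesgue_measurable[OF \<psi>c] wm by (rule borel_measurable_times)
      show "?l \<in> borel_measurable lebesgue" by (rule lm)
      show "AE x in lebesgue. norm (\<psi> a b n x * (w x - k)) \<le> norm (indicator {a..b+1} x *\<^sub>R (w x - k))" for n
        using \<psi>0[OF ab] \<psi>1[of a b n] by (intro AE_I2) (auto simp: indicator_def abs_mult mult_left_le_one_le)
      show "AE x in lebesgue. (\<lambda>n. \<psi> a b n x * (w x - k)) \<longlonglongrightarrow> ?l x"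
        by (intro AE_I2 tendsto_mult_right \<psi>lim)
    qed
    then have "(LINT x|lebesgue. ?l x) = 0" using key[OF ab] LIMSEQ_unique[OF tendsto_const] by fastforce
    moreover have "(LINT x:{a..b}|lebesgue. w x - k) = (LINT x|lebesgue. ?l x)"
      unfolding set_lebesgue_integral_def
    proof (rule integral_cong_AE)
      show "(\<lambda>x. indicator {a..b} x *\<^sub>R (w x - k)) \<in> borel_measurable lebesgue"
        using wk[of a b] unfolding set_integrable_def by auto
      show "?l \<in> borel_measurable lebesgue" by (rule lm)
      show "AE x in lebesgue. indicator {a..b} x *\<^sub>R (w x - k) = ?l x"
        using AE_neq_real[of a] by eventually_elim (use ab in \<open>auto simp: indicator_def\<close>)
    qed
    ultimately show "(LINT x:{a..b}|lebesgue. w x - k) = 0" by simp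
  qed
  then show ?thesis by (intro exI[of _ k]) simp
qed


text \<open>After subtraction of a primitive of \<open>g\<close> the weak derivative is zero, so by
  \<open>weak_constant\<close> the difference is constant almost everywhere, and the constant is
  added to the primitive.\<close>

lemma weak_derivative_AC:
  fixes u g :: "real \<Rightarrow> real"
  assumes "has_weak_derivative u g"
  shows "\<exists>U. AC U g \<and> (AE x in lebesgue. u x = U x)"
proof -
  have ui: "set_integrable lebesgue {a..b} u" and gi: "set_integrable lebesgue {a..b} g" for a b
    using assms by (auto simp: has_weak_derivative_def)
  have weak: "(LINT x|lebesgue. deriv \<phi> x * u x) = - (LINT x|lebesgue. \<phi> x * g x)" if "test_function \<phi>" for \<phi>
    using assms that by (auto simp: has_weak_derivative_def)
  obtain U where U: "AC U g" using AC_primitive_exists[OF gi] by blast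
  have Ui: "set_integrable lebesgue {a..b} U" for a b
    using AC_continuous[OF U] by (rule continuous_set_integrable)
  have "\<exists>k. AE x in lebesgue. u x - U x = k"
  proof (rule weak_constant)
    show "set_integrable lebesgue {a..b} (\<lambda>x. u x - U x)" for a b by (intro set_integral_diff(1) ui Ui)
    fix \<phi> assume t: "test_function \<phi>"
    obtain R where R: "AC \<phi> (deriv \<phi>)" "continuous_on UNIV (deriv \<phi>)" "continuous_on UNIV \<phi>"
      "\<And>x. \<bar>x\<bar> > R \<Longrightarrow> \<phi> x = 0" "\<And>x. \<bar>x\<bar> > R \<Longrightarrow> deriv \<phi> x = 0" using test_functionD[OF t] by metis
    have "(LINT x|lebesgue. deriv \<phi> x * (u x - U x)) = (LINT x|lebesgue. deriv \<phi> x * u x) - (LINT x|lebesgue. deriv \<phi> x * U x)"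
      using continuous_integrable_mult[OF R(2,5) Ui] continuous_integrable_mult[OF R(2,5) ui]
      by (simp add: right_diff_distrib)
    then show "(LINT x|lebesgue. deriv \<phi> x * (u x - U x)) = 0"
      using weak[OF t] AC_test_by_parts[OF U t] by simp
  qed
  then obtain k where k: "AE x in lebesgue. u x - U x = k" by blast
  have "AC (\<lambda>x. U x + k) g" using AC_add[OF U AC_const[of k]] by simp
  moreover have "AE x in lebesgue. u x = U x + k" using k by eventually_elim auto
  ultimately show ?thesis by blast
qed

lemma AC_weak_derivative:
  assumes A: "AC U g" and u: "AE x in lebesgue. u x = U x" and h: "AE x in lebesgue. h x = g x"
    and m: "u \<in> borel_measurable lebesgue" "h \<in> borel_measurable lebesgue"
  shows "has_weak_derivative u h"
proof -
  have cong: "(LINT x|lebesgue. f x * v x) = (LINT x|lebesgue. f x * w x)"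
    if "AE x in lebesgue. v x = w x" "v \<in> borel_measurable lebesgue" "w \<in> borel_measurable lebesgue" "f \<in> borel_measurable lebesgue"
    for f v w :: "real \<Rightarrow> real"
    using that by (intro integral_cong_AE) auto
  have si: "set_integrable lebesgue {a..b} v"
    if "AE x in lebesgue. v x = w x" "v \<in> borel_measurable lebesgue" "set_integrable lebesgue {a..b} w"
    for a b and v w :: "real \<Rightarrow> real"
  proof -
    have "(\<lambda>x. indicator {a..b} x *\<^sub>R v x) \<in> borel_measurable lebesgue"
      using that(2) by (intro borel_measurable_scaleR borel_measurable_indicator) auto
    then show ?thesis using that unfolding set_integrable_def
      by (subst integrable_cong_AE[where g="\<lambda>x. indicator {a..b} x *\<^sub>R w x"]) (auto elim!: eventually_mono)
  qed
  have Um: "U \<in> borel_measurable lebesgue" "g \<in> borel_measurable lebesgue" using A AC_measurable AC_deriv_measurable by auto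
  have Ui: "set_integrable lebesgue {a..b} U" for a b
    using AC_continuous[OF A] by (rule continuous_set_integrable)
  show ?thesis unfolding has_weak_derivative_def
  proof (intro conjI allI impI)
    show "set_integrable lebesgue {a..b} u" "set_integrable lebesgue {a..b} h" for a b
      using si[OF u m(1) Ui] si[OF h m(2) AC_integrable[OF A]] by auto
    fix \<phi> assume t: "test_function \<phi>"
    obtain R where R: "continuous_on UNIV (deriv \<phi>)" "continuous_on UNIV \<phi>" using test_functionD[OF t] by metis
    show "(LINT x|lebesgue. deriv \<phi> x *\<^sub>R u x) = - (LINT x|lebesgue. \<phi> x *\<^sub>R h x)"
      using AC_test_by_parts[OF A t] cong[OF u m(1) Um(1) continuous_lebesgue_measurable[OF R(1)]]
        cong[OF h m(2) Um(2) continuous_lebesgue_measurable[OF R(2)]] by simp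
  qed
qed

lemma continuous_AE_eq:
  fixes f g :: "real \<Rightarrow> real"
  assumes "continuous_on UNIV f" "continuous_on UNIV g" "AE x in lebesgue. f x = g x"
  shows "f = g"
proof -
  have "closed {x. f x = g x}" using assms by (intro closed_Collect_eq)
  then show ?thesis using mem_closed_if_AE_lebesgue[of "{x. f x = g x}"] assms(3) by auto
qed

lemma AC_deriv_unique:
  assumes "AC U g" "AC U h" shows "AE x in lebesgue. g x = h x"
proof -
  have "AE x in lebesgue. g x - h x = 0"
  proof (rule AE_zero_of_intervals)
    show "set_integrable lebesgue {a..b} (\<lambda>x. g x - h x)" for a b
      using assms AC_integrable by (intro set_integral_diff(1)) auto
    show "(LINT x:{a..b}|lebesgue. g x - h x) = 0" if "a \<le> b" for a b
      using AC_eq[OF assms(1) that] AC_eq[OF assms(2) that] AC_integrable assms by (subst set_integral_diff(2)) auto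
  qed
  then show ?thesis by simp
qed

lemma weak_derivative_unique:
  fixes u g h :: "real \<Rightarrow> real"
  assumes "has_weak_derivative u g" "has_weak_derivative u h"
  shows "AE x in lebesgue. g x = h x"
proof -
  obtain U W where U: "AC U g" "AE x in lebesgue. u x = U x" and W: "AC W h" "AE x in lebesgue. u x = W x"
    using assms weak_derivative_AC by blast
  have "AE x in lebesgue. U x = W x" using U(2) W(2) by eventually_elim simp
  then have "U = W" using continuous_AE_eq AC_continuous U W by blast
  then show ?thesis using AC_deriv_unique U W by blast
qed

lemma L2_cong_AE:
  fixes f g :: "real \<Rightarrow> real"
  assumes "f \<in> L2" "AE x in lebesgue. f x = g x" "g \<in> borel_measurable lebesgue"
  shows "g \<in> L2"
proof -
  have "integrable lebesgue (\<lambda>x. (g x)\<^sup>2)"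
    using assms by (subst integrable_cong_AE[where g="\<lambda>x. (f x)\<^sup>2"]) (auto simp: L2_D intro!: borel_measurable_power elim!: eventually_mono)
  then show ?thesis using assms by (simp add: L2_real_iff)
qed

text \<open>The bridge from \<open>H1_space\<close>, where \<open>weak_deriv\<close> is an arbitrary
  choice, to pairs in \<open>H1\<close>. The choice agrees with the second component almost
  everywhere because weak derivatives are unique.\<close>

lemma H1_space_weak_deriv:
  fixes u :: "real \<Rightarrow> real"
  assumes "u \<in> H1_space"
  obtains P where "P \<in> H1" "AE x in lebesgue. u x = fst P x" "AE x in lebesgue. weak_deriv u x = snd P x"
    "weak_deriv u \<in> borel_measurable lebesgue"
proof -
  obtain g where g: "g \<in> L2" "has_weak_derivative u g" and u: "u \<in> L2" using assms by (auto simp: H1_space_def)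
  have w: "has_weak_derivative u (weak_deriv u)" unfolding weak_deriv_def by (rule someI[of "has_weak_derivative u", OF g(2)])
  obtain U where U: "AC U g" "AE x in lebesgue. u x = U x" using weak_derivative_AC[OF g(2)] by blast
  have "U \<in> L2" using L2_cong_AE[OF u U(2) AC_measurable[OF U(1)]] .
  then have "(U, g) \<in> H1" using U g by (simp add: H1_def)
  moreover have "AE x in lebesgue. weak_deriv u x = g x" using weak_derivative_unique[OF w g(2)] .
  moreover have "weak_deriv u \<in> borel_measurable lebesgue"
    using w by (intro locally_integrable_measurable) (auto simp: has_weak_derivative_def)
  ultimately show ?thesis using that[of "(U, g)"] U(2) by simp
qed

lemma H1_imp_H1_space:
  assumes "P \<in> H1" shows "fst P \<in> H1_space"
    "AE x in lebesgue. weak_deriv (fst P) x = snd P x" "weak_deriv (fst P) \<in> borel_measurable lebesgue"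
proof -
  have wd: "has_weak_derivative (fst P) (snd P)"
    using assms by (intro AC_weak_derivative[of "fst P" "snd P"]) (auto simp: H1_D L2_D)
  then show *: "fst P \<in> H1_space" using assms by (auto simp: H1_space_def H1_D)
  have w: "has_weak_derivative (fst P) (weak_deriv (fst P))"
    unfolding weak_deriv_def by (rule someI[of "has_weak_derivative (fst P)", OF wd])
  show "AE x in lebesgue. weak_deriv (fst P) x = snd P x"
    using weak_derivative_unique[OF w] \<open>has_weak_derivative (fst P) (snd P)\<close> by blast
  show "weak_deriv (fst P) \<in> borel_measurable lebesgue"
    using w by (intro locally_integrable_measurable) (auto simp: has_weak_derivative_def)
qed

section \<open>The quadratic form and the spectrum\<close>

lemma AC_cong_AE:
  assumes A: "AC u g" and e: "AE x in lebesgue. g x = h x" and m: "h \<in> borel_measurable lebesgue"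
  shows "AC u h"
proof -
  have im: "(\<lambda>x. indicator {a..b} x *\<^sub>R h x) \<in> borel_measurable lebesgue" for a b
    using m by (intro borel_measurable_scaleR borel_measurable_indicator) auto
  have ig: "integrable lebesgue (\<lambda>x. indicator {a..b} x *\<^sub>R g x)" for a b
    using AC_integrable[OF A] by (simp add: set_integrable_def)
  have ae: "AE x in lebesgue. indicator {a..b} x *\<^sub>R g x = indicator {a..b} x *\<^sub>R h x" for a b
    using e by eventually_elim simp
  have "integrable lebesgue (\<lambda>x. indicator {a..b} x *\<^sub>R h x)" for a b
    using integrable_cong_AE[OF borel_measurable_integrable[OF ig] im ae] ig by blast
  moreover have "(LINT x:{a..b}|lebesgue. g x) = (LINT x:{a..b}|lebesgue. h x)" for a b
    unfolding set_lebesgue_integral_def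
    using integral_cong_AE[OF borel_measurable_integrable[OF ig] im ae] .
  ultimately show ?thesis using A unfolding AC_def set_integrable_def by metis
qed

lemma L_infinity_L2:
  assumes q: "q \<in> L_infinity" and u: "u \<in> L2" shows "(\<lambda>x. q x * u x) \<in> L2"
proof -
  have "integrable lebesgue (\<lambda>x. q x * (q x * (u x)\<^sup>2))"
    using L_infinity_mult_integrable[OF q L_infinity_mult_integrable[OF q]] L2_D(2)[OF u] by blast
  then have "integrable lebesgue (\<lambda>x. (q x * u x)\<^sup>2)" by (simp add: power2_eq_square algebra_simps)
  moreover have "(\<lambda>x. q x * u x) \<in> borel_measurable lebesgue"
    using q u by (intro borel_measurable_times) (auto simp: L_infinity_def L2_D)
  ultimately show ?thesis by (simp add: L2_real_iff)
qed

lemma L_infinity_shift: "q \<in> L_infinity \<Longrightarrow> (\<lambda>x. q x - c) \<in> L_infinity"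
proof -
  assume q: "q \<in> L_infinity"
  then obtain C where C: "AE x in lebesgue. \<bar>q x\<bar> \<le> C" and m: "q \<in> borel_measurable lebesgue"
    by (auto simp: L_infinity_def)
  have "AE x in lebesgue. \<bar>q x - c\<bar> \<le> C + \<bar>c\<bar>" using C by eventually_elim auto
  then show ?thesis using m by (auto simp: L_infinity_def)
qed

definition nsq :: "(real \<Rightarrow> real) \<Rightarrow> real" where
  "nsq u = (LINT x|lebesgue. (u x)\<^sup>2)"

lemma nsq_nonneg: "nsq u \<ge> 0"
  by (simp add: nsq_def)

lemma form_shift:
  assumes q: "q \<in> L_infinity" and P: "P \<in> H1"
  shows "form (\<lambda>x. q x - c) P = form q P - c * nsq (fst P)"
proof -
  have "form (\<lambda>x. q x - c) P = (LINT x|lebesgue. (snd P x * snd P x + q x * (fst P x * fst P x)) - c * (fst P x)\<^sup>2)"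
    unfolding bil_def by (intro Bochner_Integration.integral_cong) (auto simp: power2_eq_square algebra_simps)
  also have "\<dots> = form q P - c * nsq (fst P)"
    unfolding bil_def nsq_def using bil_integrable[OF q P P] L2_D[OF H1_D(2)[OF P]]
    by (subst Bochner_Integration.integral_diff) auto
  finally show ?thesis .
qed

lemma form_lower:
  assumes q: "q \<in> L_infinity" and K: "AE x in lebesgue. \<bar>q x\<bar> \<le> K" and P: "P \<in> H1"
  shows "nsq (snd P) - K * nsq (fst P) \<le> form q P"
proof -
  have "nsq (snd P) - K * nsq (fst P) = (LINT x|lebesgue. (snd P x)\<^sup>2 - K * (fst P x)\<^sup>2)"
    unfolding nsq_def using L2_D[OF H1_D(2)[OF P]] L2_D[OF H1_D(3)[OF P]]
    by (subst Bochner_Integration.integral_diff) auto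
  also have "\<dots> \<le> form q P"
    unfolding bil_def
  proof (rule integral_mono_AE)
    show "integrable lebesgue (\<lambda>x. (snd P x)\<^sup>2 - K * (fst P x)\<^sup>2)"
      using L2_D[OF H1_D(2)[OF P]] L2_D[OF H1_D(3)[OF P]] by auto
    show "AE x in lebesgue. (snd P x)\<^sup>2 - K * (fst P x)\<^sup>2 \<le> snd P x * snd P x + q x * (fst P x * fst P x)"
      using K
    proof eventually_elim
      case (elim x)
      then have "(- q x) * (fst P x)\<^sup>2 \<le> K * (fst P x)\<^sup>2" by (intro mult_right_mono) auto
      then show ?case by (simp add: power2_eq_square)
    qed
  qed (rule bil_integrable[OF q P P])
  finally show ?thesis .
qed

lemma form_add_scale:
  assumes q: "q \<in> L_infinity" and P: "P \<in> H1" and Q: "Q \<in> H1"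
  shows "form q (P + t *\<^sub>R Q) = form q P + 2 * t * bil q P Q + t\<^sup>2 * form q Q"
proof -
  have tQ: "t *\<^sub>R Q \<in> H1" using Q H1_scale by blast
  have "form q (P + t *\<^sub>R Q) = bil q P (P + t *\<^sub>R Q) + bil q (t *\<^sub>R Q) (P + t *\<^sub>R Q)"
    using P tQ q H1_add by (intro bil_add_left) auto
  also have "\<dots> = form q P + bil q (t *\<^sub>R Q) P + (bil q P (t *\<^sub>R Q) + form q (t *\<^sub>R Q))"
    using bil_add_left[OF q P tQ P] bil_add_left[OF q P tQ tQ]
      bil_commute[of q P "P + t *\<^sub>R Q"] bil_commute[of q "t *\<^sub>R Q" "P + t *\<^sub>R Q"] bil_commute[of q "t *\<^sub>R Q" P] by simp
  also have "bil q (t *\<^sub>R Q) P = t * bil q P Q" using bil_scale_left[of q t Q P] bil_commute[of q P Q] by simp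
  also have "bil q P (t *\<^sub>R Q) = t * bil q P Q" using bil_scale_left[of q t Q P] bil_commute[of q P Q] bil_commute[of q P "t *\<^sub>R Q"] by simp
  also have "form q (t *\<^sub>R Q) = t\<^sup>2 * form q Q"
    using bil_scale_left[of q t Q "t *\<^sub>R Q"] bil_scale_left[of q t Q Q] bil_commute[of q Q "t *\<^sub>R Q"] by (simp add: power2_eq_square)
  finally have "form q (P + t *\<^sub>R Q) = form q P + t * bil q P Q + (t * bil q P Q + t\<^sup>2 * form q Q)" .
  then show ?thesis by simp
qed

text \<open>Only semidefiniteness is assumed, so the case \<open>form q Q = 0\<close> is separate:
  there the quadratic polynomial in \<open>t\<close> degenerates to an affine function that is
  bounded below, hence has slope zero.\<close>

lemma bil_Cauchy_Schwarz:
  assumes q: "q \<in> L_infinity" and nn: "\<And>P. P \<in> H1 \<Longrightarrow> form q P \<ge> 0" and P: "P \<in> H1" and Q: "Q \<in> H1"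
  shows "(bil q P Q)\<^sup>2 \<le> form q P * form q Q"
proof -
  have *: "form q P + 2 * t * bil q P Q + t\<^sup>2 * form q Q \<ge> 0" for t
    using nn[of "P + t *\<^sub>R Q"] form_add_scale[OF q P Q] P Q H1_add H1_scale by auto
  show ?thesis
  proof (cases "form q Q = 0")
    case True
    have "bil q P Q = 0"
    proof (rule ccontr)
      assume b: "bil q P Q \<noteq> 0"
      \<comment> \<open>At this \<open>t\<close> the affine function takes the value
        \<open>-1\<close>.\<close>
      then show False using *[of "- (form q P + 1) / (2 * bil q P Q)"] True by (simp add: field_simps)
    qed
    then show ?thesis using True by simp
  next
    case False
    then have pos: "form q Q > 0" using nn[OF Q] by simp
    have "0 \<le> (form q P + 2 * (- bil q P Q / form q Q) * bil q P Q + (- bil q P Q / form q Q)\<^sup>2 * form q Q) * form q Q"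
      using *[of "- bil q P Q / form q Q"] pos by (intro mult_nonneg_nonneg) auto
    also have "\<dots> = form q P * form q Q - (bil q P Q)\<^sup>2"
      using pos by (simp add: field_simps power2_eq_square)
    finally show ?thesis by simp
  qed
qed

section \<open>Real parts of complex-valued solutions, and the resolvent\<close>

lemma complex_mult_integrable:
  fixes f :: "real \<Rightarrow> real" and u :: "real \<Rightarrow> complex"
  assumes f: "continuous_on UNIV f" "\<And>x. \<bar>x\<bar> > R \<Longrightarrow> f x = 0" and u: "\<And>a b. set_integrable lebesgue {a..b} u"
  shows "integrable lebesgue (\<lambda>x. f x *\<^sub>R u x)"
proof -
  have re: "set_integrable lebesgue {a..b} (\<lambda>x. Re (u x))" for a b
    using u[of a b] integrable_Re[of lebesgue "\<lambda>x. indicator {a..b} x *\<^sub>R u x"] by (simp add: set_integrable_def)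
  have im: "set_integrable lebesgue {a..b} (\<lambda>x. Im (u x))" for a b
    using u[of a b] integrable_Im[of lebesgue "\<lambda>x. indicator {a..b} x *\<^sub>R u x"] by (simp add: set_integrable_def)
  have "integrable lebesgue (\<lambda>x. complex_of_real (f x * Re (u x)) + \<i> * complex_of_real (f x * Im (u x)))"
    by (intro Bochner_Integration.integrable_add integrable_mult_right integrable_of_real
      continuous_integrable_mult[OF f re] continuous_integrable_mult[OF f im])
  moreover have "complex_of_real (f x * Re (u x)) + \<i> * complex_of_real (f x * Im (u x)) = f x *\<^sub>R u x" for x
    by (simp add: complex_eq_iff)
  ultimately show ?thesis by simp
qed

text \<open>The spectrum is defined with complex-valued functions, the form with real ones. For real
  \<open>V\<close>, real \<mu> and a real right-hand side the real part of a resolvent solution is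
  again a solution.\<close>

lemma weak_derivative_Re:
  fixes u g :: "real \<Rightarrow> complex"
  assumes "has_weak_derivative u g"
  shows "has_weak_derivative (\<lambda>x. Re (u x)) (\<lambda>x. Re (g x))"
  unfolding has_weak_derivative_def
proof (intro conjI allI impI)
  have ui: "set_integrable lebesgue {a..b} u" and gi: "set_integrable lebesgue {a..b} g" for a b
    using assms by (auto simp: has_weak_derivative_def)
  show "set_integrable lebesgue {a..b} (\<lambda>x. Re (u x))" for a b
    using ui[of a b] integrable_Re[of lebesgue "\<lambda>x. indicator {a..b} x *\<^sub>R u x"] by (simp add: set_integrable_def)
  show "set_integrable lebesgue {a..b} (\<lambda>x. Re (g x))" for a b
    using gi[of a b] integrable_Re[of lebesgue "\<lambda>x. indicator {a..b} x *\<^sub>R g x"] by (simp add: set_integrable_def)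
  fix \<phi> assume t: "test_function \<phi>"
  obtain R where R: "continuous_on UNIV (deriv \<phi>)" "continuous_on UNIV \<phi>"
    "\<And>x. \<bar>x\<bar> > R \<Longrightarrow> \<phi> x = 0" "\<And>x. \<bar>x\<bar> > R \<Longrightarrow> deriv \<phi> x = 0" using test_functionD[OF t] by metis
  have i: "integrable lebesgue (\<lambda>x. deriv \<phi> x *\<^sub>R u x)" "integrable lebesgue (\<lambda>x. \<phi> x *\<^sub>R g x)"
    using complex_mult_integrable R ui gi by blast+
  have "(LINT x|lebesgue. deriv \<phi> x *\<^sub>R u x) = - (LINT x|lebesgue. \<phi> x *\<^sub>R g x)"
    using assms t by (auto simp: has_weak_derivative_def)
  then have "Re (LINT x|lebesgue. deriv \<phi> x *\<^sub>R u x) = - Re (LINT x|lebesgue. \<phi> x *\<^sub>R g x)" by simp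
  then show "(LINT x|lebesgue. deriv \<phi> x *\<^sub>R Re (u x)) = - (LINT x|lebesgue. \<phi> x *\<^sub>R Re (g x))"
    using i by (simp flip: integral_Re)
qed

lemma L2_Re:
  fixes u :: "real \<Rightarrow> complex"
  assumes "u \<in> L2"
  shows "(\<lambda>x. Re (u x)) \<in> L2" "nsq (\<lambda>x. Re (u x)) \<le> (L2_norm u)\<^sup>2"
proof -
  have u: "u \<in> borel_measurable lebesgue" "integrable lebesgue (\<lambda>x. (cmod (u x))\<^sup>2)" using assms by (auto simp: L2_def)
  have m: "(\<lambda>x. Re (u x)) \<in> borel_measurable lebesgue" using u(1) by measurable
  have le: "(Re z)\<^sup>2 \<le> (cmod z)\<^sup>2" for z by (simp add: cmod_power2)
  have "integrable lebesgue (\<lambda>x. (Re (u x))\<^sup>2)"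
    by (rule Bochner_Integration.integrable_bound[OF u(2)]) (use m le in \<open>auto intro!: AE_I2 borel_measurable_power\<close>)
  then show "(\<lambda>x. Re (u x)) \<in> L2" using m by (simp add: L2_real_iff)
  have "nsq (\<lambda>x. Re (u x)) \<le> (LINT x|lebesgue. (cmod (u x))\<^sup>2)"
    unfolding nsq_def using u(2) \<open>integrable lebesgue (\<lambda>x. (Re (u x))\<^sup>2)\<close> le by (intro integral_mono) auto
  also have "\<dots> = (L2_norm u)\<^sup>2" by (simp add: L2_norm_def)
  finally show "nsq (\<lambda>x. Re (u x)) \<le> (L2_norm u)\<^sup>2" .
qed

lemma H1_space_has_weak_deriv:
  assumes "u \<in> H1_space" shows "has_weak_derivative u (weak_deriv u)" "u \<in> L2"
proof -
  obtain g where g: "has_weak_derivative u g" and u: "u \<in> L2" using assms by (auto simp: H1_space_def)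
  show "has_weak_derivative u (weak_deriv u)" unfolding weak_deriv_def by (rule someI[of "has_weak_derivative u", OF g])
  show "u \<in> L2" by (rule u)
qed

text \<open>
  At a point \<open>\<mu>\<close> of the resolvent set that lies at the bottom of the form, applying the
  Cauchy-Schwarz inequality to \<open>P\<close> and \<open>(A - \<mu>)\<^sup>-\<^sup>1 P\<close> bounds the Rayleigh quotient away from \<open>\<mu>\<close>.
\<close>

lemma resolvent_gap:
  assumes V: "V \<in> L_infinity" and res: "complex_of_real \<mu> \<in> L2_resolvent_set H2_space (schroedinger V)"
    and nn: "\<And>P. P \<in> H1 \<Longrightarrow> form (\<lambda>x. V x - \<mu>) P \<ge> 0"
  shows "\<exists>e>0. \<forall>P\<in>H1. e * nsq (fst P) \<le> form (\<lambda>x. V x - \<mu>) P"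
proof -
  obtain C where C: "\<And>f. f \<in> L2 \<Longrightarrow> \<exists>u\<in>H2_space. (AE x in lebesgue. schroedinger V u x - complex_of_real \<mu> * u x = f x) \<and>
      L2_norm u \<le> C * L2_norm f"
    using res unfolding L2_resolvent_set_def by blast
  let ?q = "\<lambda>x. V x - \<mu>"
  have q: "?q \<in> L_infinity" using L_infinity_shift[OF V] .
  have main: "nsq (fst P) \<le> form ?q P * (C\<^sup>2 + 1)" if P: "P \<in> H1" for P
  proof -
    define f where "f x = complex_of_real (fst P x)" for x
    have PL: "fst P \<in> L2" using P by (rule H1_D)
    have fL: "f \<in> L2" "(L2_norm f)\<^sup>2 = nsq (fst P)"
      using L2_D[OF PL] unfolding L2_def L2_norm_def nsq_def f_def by auto
    obtain u where u: "u \<in> H2_space" "AE x in lebesgue. schroedinger V u x - complex_of_real \<mu> * u x = f x" "L2_norm u \<le> C * L2_norm f"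
      using C[OF fL(1)] by blast
    define w where "w = weak_deriv u"
    define w2 where "w2 = weak_deriv w"
    have uH: "u \<in> H1_space" "w \<in> H1_space" using u(1) by (auto simp: H2_space_def w_def)
    have uw: "has_weak_derivative u w" "u \<in> L2" "has_weak_derivative w w2" "w \<in> L2"
      using H1_space_has_weak_deriv uH unfolding w_def w2_def by auto
    obtain R where R: "AC R (\<lambda>x. Re (w x))" "AE x in lebesgue. Re (u x) = R x"
      using weak_derivative_AC[OF weak_derivative_Re[OF uw(1)]] by blast
    obtain W where W: "AC W (\<lambda>x. Re (w2 x))" "AE x in lebesgue. Re (w x) = W x"
      using weak_derivative_AC[OF weak_derivative_Re[OF uw(3)]] by blast
    have RW: "AC R W" using AC_cong_AE[OF R(1) W(2) AC_measurable[OF W(1)]] .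
    have RL: "R \<in> L2" using L2_cong_AE[OF L2_Re(1)[OF uw(2)] R(2) AC_measurable[OF R(1)]] .
    have WL: "W \<in> L2" using L2_cong_AE[OF L2_Re(1)[OF uw(4)] W(2) AC_measurable[OF W(1)]] .
    define Q where "Q = (R, W)"
    have Q: "Q \<in> H1" using RW RL WL by (simp add: H1_def Q_def)
    \<comment> \<open>The second derivative of \<open>R\<close> as prescribed by the resolvent
      equation \<open>-R'' + (V - \<mu>) R = fst P\<close>. It shows that \<open>W\<close> has a
      square-integrable derivative.\<close>
    define r2 where "r2 x = ?q x * R x - fst P x" for x
    have r2L: "r2 \<in> L2" unfolding r2_def using L_infinity_L2[OF q RL] PL by (rule L2_diff)
    have "AE x in lebesgue. Re (w2 x) = r2 x"
      using u(2) R(2)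
    proof eventually_elim
      case (elim x)
      have "Re (schroedinger V u x - complex_of_real \<mu> * u x) = fst P x" using elim by (simp add: f_def)
      then have "- Re (w2 x) + V x * Re (u x) - \<mu> * Re (u x) = fst P x"
        by (simp add: schroedinger_def w_def w2_def)
      then show ?case using elim by (simp add: r2_def algebra_simps)
    qed
    then have Wr: "AC W r2" using AC_cong_AE[OF W(1)] r2L L2_D by blast
    \<comment> \<open>In the form, \<open>Q\<close> represents the functional given by the inner
      product with \<open>fst P\<close>. The choice \<open>Z = P\<close> produces
      \<open>nsq (fst P)\<close>; the choice \<open>Z = Q\<close> bounds \<open>form ?q Q\<close> by
      means of the resolvent constant \<open>C\<close>.\<close>
    have byparts: "bil ?q Z Q = (LINT x|lebesgue. fst Z x * fst P x)" if Z: "Z \<in> H1" for Z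
    proof -
      have i: "integrable lebesgue (\<lambda>x. fst Z x * r2 x)" "integrable lebesgue (\<lambda>x. ?q x * (fst Z x * R x))"
        using L2_mult_integrable[OF H1_D(2)[OF Z] r2L] L_infinity_mult_integrable[OF q L2_mult_integrable[OF H1_D(2)[OF Z] RL]] by auto
      have "bil ?q Z Q = - (LINT x|lebesgue. fst Z x * r2 x) + (LINT x|lebesgue. ?q x * (fst Z x * R x))"
        using bil_split[OF q Z Q] H1_by_parts[OF Z Wr WL r2L] by (simp add: Q_def)
      also have "\<dots> = (LINT x|lebesgue. ?q x * (fst Z x * R x) - fst Z x * r2 x)"
        using i by simp
      also have "\<dots> = (LINT x|lebesgue. fst Z x * fst P x)"
        by (intro Bochner_Integration.integral_cong) (auto simp: r2_def algebra_simps)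
      finally show ?thesis .
    qed
    have B1: "bil ?q P Q = nsq (fst P)" using byparts[OF P] by (simp add: nsq_def power2_eq_square)
    have nR: "nsq R \<le> C\<^sup>2 * nsq (fst P)"
    proof -
      have "nsq R = nsq (\<lambda>x. Re (u x))" unfolding nsq_def
        using R(2) L2_D(1)[OF L2_Re(1)[OF uw(2)]] AC_measurable[OF R(1)]
        by (intro integral_cong_AE) (auto intro!: borel_measurable_power)
      also have "\<dots> \<le> (L2_norm u)\<^sup>2" by (rule L2_Re(2)[OF uw(2)])
      also have "\<dots> \<le> (C * L2_norm f)\<^sup>2" using u(3) by (intro power_mono) (auto simp: L2_norm_def)
      finally show ?thesis using fL(2) by (simp add: power_mult_distrib)
    qed
    have "form ?q Q = (LINT x|lebesgue. R x * fst P x)" using byparts[OF Q] by (simp add: Q_def)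
    also have "\<dots> \<le> (LINT x|lebesgue. (R x)\<^sup>2 + (fst P x)\<^sup>2)"
      using L2_mult_integrable[OF RL PL] L2_D(2)[OF RL] L2_D(2)[OF PL] abs_mult_le_sum_squares
      by (intro integral_mono) (auto intro: order_trans[OF abs_ge_self])
    also have "\<dots> = nsq R + nsq (fst P)" using L2_D(2)[OF RL] L2_D(2)[OF PL] by (simp add: nsq_def)
    also have "\<dots> \<le> (C\<^sup>2 + 1) * nsq (fst P)" using nR by (simp add: algebra_simps)
    finally have B2: "form ?q Q \<le> (C\<^sup>2 + 1) * nsq (fst P)" .
    have "(nsq (fst P))\<^sup>2 \<le> form ?q P * form ?q Q"
      using bil_Cauchy_Schwarz[OF q nn P Q] B1 by simp
    also have "\<dots> \<le> form ?q P * ((C\<^sup>2 + 1) * nsq (fst P))" by (intro mult_left_mono B2 nn P)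
    finally have *: "nsq (fst P) * nsq (fst P) \<le> (form ?q P * (C\<^sup>2 + 1)) * nsq (fst P)"
      by (simp add: power2_eq_square algebra_simps)
    show ?thesis
    proof (cases "nsq (fst P) = 0")
      case True then show ?thesis using nn[OF P] by simp
    next
      case False
      then have "nsq (fst P) > 0" using nsq_nonneg[of "fst P"] by simp
      then show ?thesis using * mult_right_le_imp_le by blast
    qed
  qed
  have "C\<^sup>2 + 1 > 0" by (simp add: add_nonneg_pos)
  then show ?thesis using main
    by (intro exI[of _ "1 / (C\<^sup>2 + 1)"]) (auto simp: field_simps)
qed

text \<open>A bounded potential makes the Rayleigh quotients bounded below, so their infimum \<mu>
  exists. If the claim failed, \<mu> would lie below the spectrum, and \<open>resolvent_gap\<close>
  would improve the lower bound \<mu> to \<open>\<mu> + e\<close>.\<close>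

lemma spectral_bound:
  assumes V: "V \<in> L_infinity" and m: "\<And>s. s \<in> schroedinger_spectrum V \<Longrightarrow> m \<le> s" and P: "P \<in> H1"
  shows "m * nsq (fst P) \<le> form V P"
proof (rule ccontr)
  assume neg: "\<not> ?thesis"
  obtain K where K: "AE x in lebesgue. \<bar>V x\<bar> \<le> K" using V by (auto simp: L_infinity_def)
  have lower: "- K * nsq (fst P) \<le> form V P" if "P \<in> H1" for P
    using form_lower[OF V K that] nsq_nonneg[of "snd P"] by simp
  define S where "S = {form V P / nsq (fst P) | P. P \<in> H1 \<and> nsq (fst P) > 0}"
  have P0: "nsq (fst P) > 0"
  proof (rule ccontr)
    assume "\<not> nsq (fst P) > 0"
    then have "nsq (fst P) = 0" using nsq_nonneg[of "fst P"] by simp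
    then show False using neg lower[OF P] by simp
  qed
  then have PS: "form V P / nsq (fst P) \<in> S" using P unfolding S_def by blast
  have bdd: "bdd_below S"
  proof (rule bdd_belowI)
    fix s assume "s \<in> S"
    then obtain P where "P \<in> H1" "nsq (fst P) > 0" "s = form V P / nsq (fst P)" by (auto simp: S_def)
    then show "-K \<le> s" using lower[of P] by (simp add: pos_le_divide_eq)
  qed
  define \<mu> where "\<mu> = Inf S"
  have "\<mu> \<le> form V P / nsq (fst P)" unfolding \<mu>_def using PS bdd by (rule cInf_lower)
  also have "\<dots> < m" using neg P0 by (simp add: field_simps)
  finally have "\<mu> \<notin> schroedinger_spectrum V" using m by force
  then have res: "complex_of_real \<mu> \<in> L2_resolvent_set H2_space (schroedinger V)"
    by (simp add: schroedinger_spectrum_def L2_spectrum_def)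
  have nn: "form (\<lambda>x. V x - \<mu>) P \<ge> 0" if P: "P \<in> H1" for P
  proof (cases "nsq (fst P) = 0")
    case True then show ?thesis using form_shift[OF V P] lower[OF P] by simp
  next
    case False
    then have pos: "nsq (fst P) > 0" using nsq_nonneg[of "fst P"] by simp
    then have "\<mu> \<le> form V P / nsq (fst P)" unfolding \<mu>_def using P bdd unfolding S_def by (intro cInf_lower) blast+
    then show ?thesis using form_shift[OF V P, of \<mu>] pos by (simp add: pos_le_divide_eq)
  qed
  obtain e where e: "e > 0" "\<And>P. P \<in> H1 \<Longrightarrow> e * nsq (fst P) \<le> form (\<lambda>x. V x - \<mu>) P"
    using resolvent_gap[OF V res nn] by blast
  have "\<mu> + e \<le> s" if "s \<in> S" for s
  proof -
    obtain P where P: "P \<in> H1" "nsq (fst P) > 0" "s = form V P / nsq (fst P)" using \<open>s \<in> S\<close> unfolding S_def by blast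
    then show ?thesis using e(2)[OF P(1)] form_shift[OF V P(1), of \<mu>] by (simp add: pos_le_divide_eq algebra_simps)
  qed
  then have "\<mu> + e \<le> \<mu>" unfolding \<mu>_def using PS by (intro cInf_greatest) auto
  then show False using e(1) by simp
qed

section \<open>Weak limits\<close>

text \<open>
  The point of almost minimal norm in the convex hulls of the tails converges; comparing its norm
  with that of a nearby convex combination with the \<open>n\<close>-th term yields the final inequality.
\<close>

lemma near_minimal_hull_points:
  fixes B :: "'a::real_vector \<Rightarrow> 'a \<Rightarrow> real"
  assumes H: "subspace H"
    and add: "\<And>x y z. x \<in> H \<Longrightarrow> y \<in> H \<Longrightarrow> z \<in> H \<Longrightarrow> B (x + y) z = B x z + B y z"
    and scale: "\<And>c x z. B (c *\<^sub>R x) z = c * B x z"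
    and comm: "\<And>x y. B x y = B y x"
    and nn: "\<And>x. x \<in> H \<Longrightarrow> B x x \<ge> 0"
    and X: "\<And>n::nat. X n \<in> H" and bound: "\<And>n. B (X n) (X n) \<le> K"
    and complete: "\<And>Y :: nat \<Rightarrow> 'a. (\<And>n. Y n \<in> H) \<Longrightarrow>
        (\<And>e. e > 0 \<Longrightarrow> \<exists>N. \<forall>m\<ge>N. \<forall>n\<ge>N. B (Y m - Y n) (Y m - Y n) < e) \<Longrightarrow>
        \<exists>y\<in>H. (\<lambda>n. B (Y n - y) (Y n - y)) \<longlonglongrightarrow> 0"
  shows "\<exists>y\<in>H. \<exists>Y. (\<forall>n. Y n \<in> convex hull (X ` {n..})) \<and> (\<lambda>n. B (Y n - y) (Y n - y)) \<longlonglongrightarrow> 0 \<and>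
    (\<forall>e>0. \<forall>\<^sub>F n in sequentially. B y y - e \<le> B y (X n))"
proof -
  define N where "N x = B x x" for x
  note closed = subspace_add[OF H] subspace_diff[OF H] subspace_scale[OF H]
  have addr: "B z (x + y) = B z x + B z y" if "x \<in> H" "y \<in> H" "z \<in> H" for x y z
    using add[of x y z] comm[of z x] comm[of z y] comm[of z "x + y"] that by simp
  have scaler: "B z (c *\<^sub>R x) = c * B z x" for c x z
    using scale[of c x z] comm[of z x] comm[of z "c *\<^sub>R x"] by simp
  have N_add: "N (x + c *\<^sub>R y) = N x + 2 * c * B x y + c\<^sup>2 * N y" if "x \<in> H" "y \<in> H" for x y c
  proof -
    have cy: "c *\<^sub>R y \<in> H" using that closed by auto
    have "N (x + c *\<^sub>R y) = B x x + B x (c *\<^sub>R y) + (B (c *\<^sub>R y) x + B (c *\<^sub>R y) (c *\<^sub>R y))"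
      unfolding N_def using add[of x "c *\<^sub>R y" "x + c *\<^sub>R y"] addr[of x "c *\<^sub>R y" x] addr[of x "c *\<^sub>R y" "c *\<^sub>R y"] that cy closed
      by simp
    then show ?thesis unfolding N_def by (simp add: scale scaler comm[of y x] power2_eq_square)
  qed
  have N_diff: "N (x - y) = N x - 2 * B x y + N y" if "x \<in> H" "y \<in> H" for x y
    using N_add[OF that, of "-1"] by simp
  have N_scale: "N (c *\<^sub>R x) = c\<^sup>2 * N x" for c x by (simp add: N_def scale scaler power2_eq_square)
  have N_nn: "N x \<ge> 0" if "x \<in> H" for x using nn[OF that] by (simp add: N_def)
  have B_diffl: "B (x - y) z = B x z - B y z" if "x \<in> H" "y \<in> H" "z \<in> H" for x y z
    using add[of x "(-1) *\<^sub>R y" z] scale[of "-1" y z] that closed(3)[of y "-1"] by simp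
  have B_diffr: "B z (x - y) = B z x - B z y" if "x \<in> H" "y \<in> H" "z \<in> H" for x y z
    using B_diffl[OF that] by (simp add: comm[of z])
  \<comment> \<open>Young's inequality, read off from \<open>N (x + s *\<^sub>R y) \<ge> 0\<close>.
    The free parameter \<open>s\<close> lets the error \<open>N (Y n - y)\<close> absorb a large
    factor while \<open>N (X n)\<close> gets a small one.\<close>
  have young: "2 * B x y \<ge> - (N x / s + s * N y)" if "x \<in> H" "y \<in> H" "s > 0" for x y s
  proof -
    have "0 \<le> N (x + s *\<^sub>R y)" using that closed by (intro N_nn) auto
    then have "0 \<le> (N x + 2 * s * B x y + s\<^sup>2 * N y) / s" using N_add[OF that(1,2), of s] that(3) by simp
    also have "\<dots> = N x / s + 2 * B x y + s * N y" using that(3) by (simp add: field_simps power2_eq_square)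
    finally show ?thesis by simp
  qed
  define C where "C n = convex hull (X ` {n..})" for n
  have CH: "C n \<subseteq> H" for n unfolding C_def using X subspace_imp_convex[OF H] by (intro hull_minimal) auto
  have Cmono: "C m \<subseteq> C n" if "n \<le> m" for m n unfolding C_def using that by (intro hull_mono) auto
  have XC: "X n \<in> C n" for n unfolding C_def by (intro hull_inc) auto
  have Cconv: "convex (C n)" for n by (simp add: C_def)
  define d where "d n = Inf (N ` C n)" for n
  have bdd: "bdd_below (N ` C n)" for n using CH N_nn by (intro bdd_belowI[of _ 0]) auto
  have d_le: "d n \<le> N x" if "x \<in> C n" for n x unfolding d_def using that bdd by (intro cInf_lower) auto
  have d_mono: "d n \<le> d m" if "n \<le> m" for n m
    unfolding d_def using XC Cmono[OF that] bdd by (intro cInf_superset_mono) auto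
  have dK: "d n \<le> K" for n using d_le[OF XC] bound[of n] by (force simp: N_def intro: order_trans)
  have "\<exists>x\<in>C n. N x < d n + 1 / real (Suc n)" for n
    using cInf_lessD[of "N ` C n" "d n + 1 / real (Suc n)"] XC by (auto simp: d_def)
  then obtain Y where Y: "\<And>n. Y n \<in> C n" "\<And>n. N (Y n) < d n + 1 / real (Suc n)" by metis
  have YH: "Y n \<in> H" for n using Y(1) CH by blast
  \<comment> \<open>The midpoint of \<open>Y n\<close> and \<open>Y m\<close> lies in
    \<open>C n\<close>, so its norm is at least \<open>d n\<close>; the parallelogram identity
    bounds the difference. Since \<open>d\<close> is increasing and bounded by \<open>K\<close>, the
    points \<open>Y n\<close> form a Cauchy sequence.\<close>
  have par: "N (Y m - Y n) \<le> 2 * (d m - d n) + 4 / real (Suc n)" if nm: "n \<le> m" for m n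
  proof -
    have "(1/2) *\<^sub>R Y n + (1/2) *\<^sub>R Y m \<in> C n" using Cconv Y(1)[of n] Y(1)[of m] Cmono[OF nm]
      by (intro convexD) auto
    then have "d n \<le> N ((1/2) *\<^sub>R (Y n + Y m))" using d_le by (simp add: scaleR_add_right)
    also have "\<dots> = (N (Y n) + 2 * B (Y n) (Y m) + N (Y m)) / 4"
      using N_scale[of "1/2" "Y n + Y m"] N_add[OF YH YH, of n 1 m] by (simp add: power2_eq_square)
    finally have "4 * d n \<le> N (Y n) + 2 * B (Y n) (Y m) + N (Y m)" by simp
    moreover have "N (Y m - Y n) = N (Y m) - 2 * B (Y n) (Y m) + N (Y n)"
      using N_diff[OF YH YH] comm[of "Y n" "Y m"] by simp
    moreover have "1 / real (Suc m) \<le> 1 / real (Suc n)" using nm by (simp add: field_simps)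
    ultimately show ?thesis using Y(2)[of n] Y(2)[of m] by simp
  qed
  have "\<exists>y\<in>H. (\<lambda>n. B (Y n - y) (Y n - y)) \<longlonglongrightarrow> 0"
  proof (rule complete[OF YH])
    fix e :: real assume e: "e > 0"
    have "Bseq d"
    proof (rule BseqI')
      show "norm (d n) \<le> \<bar>K\<bar> + \<bar>d 0\<bar>" for n using d_mono[of 0 n] dK[of n] by auto
    qed
    then have "convergent d" using d_mono by (intro Bseq_mono_convergent) auto
    then have "Cauchy d" by (rule convergent_Cauchy)
    then obtain M1 where M1: "\<And>m n. m \<ge> M1 \<Longrightarrow> n \<ge> M1 \<Longrightarrow> \<bar>d m - d n\<bar> < e / 8"
      using e unfolding Cauchy_def dist_real_def by (metis divide_pos_pos zero_less_numeral)
    obtain M2 :: nat where "8 / e < real M2" using reals_Archimedean2 by blast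
    then have M2: "4 / real (Suc n) < e / 2" if "n \<ge> M2" for n
      using e that by (simp add: field_simps) (smt (verit, best) mult_left_mono of_nat_mono)
    have *: "N (Y m - Y n) < e" if "n \<ge> max M1 M2" "n \<le> m" for m n
      using par[OF that(2)] M1[of m n] M2[of n] that by (auto simp: abs_if split: if_splits)
    have "N (Y m - Y n) < e" if "n \<ge> max M1 M2" "m \<ge> max M1 M2" for m n
    proof (cases "n \<le> m")
      case False
      then have "N (Y n - Y m) < e" using that by (intro *) auto
      then show ?thesis using N_diff[OF YH YH, of n m] N_diff[OF YH YH, of m n] comm[of "Y n" "Y m"] by simp
    qed (use * that in auto)
    then show "\<exists>N. \<forall>m\<ge>N. \<forall>n\<ge>N. B (Y m - Y n) (Y m - Y n) < e" unfolding N_def by blast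
  qed
  then obtain y where y: "y \<in> H" "(\<lambda>n. N (Y n - y)) \<longlonglongrightarrow> 0" by (auto simp: N_def)
  have "\<forall>\<^sub>F n in sequentially. N y - e \<le> B y (X n)" if e: "e > 0" for e
  proof -
    \<comment> \<open>A bound for \<open>N (X n - Y n) \<le> 2 * N (X n) + 2 * N (Y n)\<close>, as
      \<open>N (Y n) < d n + 1 \<le> K + 1\<close>.\<close>
    define L where "L = 4 * K + 4"
    have K0: "K \<ge> 0" using bound[of 0] nn[OF X[of 0]] by linarith
    have L0: "L > 0" using K0 by (simp add: L_def)
    define t where "t = min 1 (e / (2 * L))"
    have t: "0 < t" "t \<le> 1" "t * L \<le> e / 2"
    proof -
      show "0 < t" "t \<le> 1" using e L0 by (auto simp: t_def)
      have "t * L \<le> e / (2 * L) * L" using L0 by (intro mult_right_mono) (auto simp: t_def)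
      then show "t * L \<le> e / 2" using L0 by simp
    qed
    define s where "s = e / (4 * (K + 2 * N y + 1))"
    have Ny: "N y \<ge> 0" using N_nn y by blast
    have s: "s > 0" "s * (K + 2 * N y) \<le> e / 4"
    proof -
      show "s > 0" using e K0 Ny by (simp add: s_def)
      have "s * (K + 2 * N y) \<le> s * (K + 2 * N y + 1)" using \<open>s > 0\<close> by simp
      also have "\<dots> = e / 4" using K0 Ny by (simp add: s_def field_simps)
      finally show "s * (K + 2 * N y) \<le> e / 4" .
    qed
    \<comment> \<open>Moving from \<open>Y n\<close> by the fraction \<open>t\<close> towards
      \<open>X n\<close> stays in \<open>C n\<close>, so the norm drops by less than
      \<open>1 / Suc n\<close>. Expanding the square and dividing by \<open>2 * t\<close> bounds
      \<open>B (Y n) (X n)\<close> from below; \<open>t\<close> is fixed first and then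
      \<open>n\<close> is taken large.\<close>
    have step: "B (Y n) (X n) \<ge> N (Y n) - 1 / (2 * t * real (Suc n)) - t * L / 2" for n
    proof -
      have D: "X n - Y n \<in> H" using X YH closed by blast
      have "Y n + t *\<^sub>R (X n - Y n) = (1 - t) *\<^sub>R Y n + t *\<^sub>R X n" by (simp add: algebra_simps)
      also have "\<dots> \<in> C n" using Cconv Y(1) XC t by (intro convexD) auto
      finally have "d n \<le> N (Y n + t *\<^sub>R (X n - Y n))" by (rule d_le)
      also have "\<dots> = N (Y n) + 2 * t * B (Y n) (X n - Y n) + t\<^sup>2 * N (X n - Y n)" by (rule N_add[OF YH D])
      finally have 1: "0 \<le> 1 / real (Suc n) + 2 * t * (B (Y n) (X n) - N (Y n)) + t\<^sup>2 * N (X n - Y n)"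
        using Y(2)[of n] B_diffr[OF X YH YH, of n n n] by (simp add: N_def)
      have "N (X n - Y n) \<le> 2 * N (X n) + 2 * N (Y n)"
        using N_diff[OF X YH, of n n] N_add[OF X YH, of n 1 n] N_nn[of "X n + 1 *\<^sub>R Y n"] X YH closed by auto
      also have "\<dots> \<le> L"
      proof -
        have "1 / real (Suc n) \<le> 1" by simp
        then show ?thesis using bound[of n] Y(2)[of n] dK[of n] unfolding L_def N_def by linarith
      qed
      finally have "t\<^sup>2 * N (X n - Y n) \<le> t\<^sup>2 * L" by (intro mult_left_mono) auto
      with 1 have "0 \<le> 1 / real (Suc n) + 2 * t * (B (Y n) (X n) - N (Y n)) + t\<^sup>2 * L" by linarith
      then have "0 \<le> (1 / real (Suc n) + 2 * t * (B (Y n) (X n) - N (Y n)) + t\<^sup>2 * L) / (2 * t)"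
        using t(1) by (rule_tac divide_nonneg_pos) auto
      also have "\<dots> = 1 / (2 * t * real (Suc n)) + (B (Y n) (X n) - N (Y n)) + t * L / 2"
      proof -
        have "(a + 2 * t * b + t\<^sup>2 * L) / (2 * t) = a / (2 * t) + b + t * L / 2" for a b
          using t(1) by (simp add: field_simps power2_eq_square)
        then show ?thesis by (simp only: divide_divide_eq_left mult.commute[of "real (Suc n)" "2 * t"])
      qed
      finally show ?thesis by simp
    qed
    have "\<forall>\<^sub>F n in sequentially. N (Y n - y) < e * s / 16"
      by (rule order_tendstoD(2)[OF y(2)]) (use e s(1) in simp)
    moreover have "(\<lambda>n. 1 / (2 * t) * (1 / real (Suc n))) \<longlonglongrightarrow> 1 / (2 * t) * 0"
      by (intro tendsto_intros LIMSEQ_Suc[OF lim_1_over_n])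
    then have "\<forall>\<^sub>F n in sequentially. 1 / (2 * t) * (1 / real (Suc n)) < e / 8"
      by (rule order_tendstoD(2)) (use e in simp)
    ultimately show ?thesis
    proof eventually_elim
      case (elim n)
      have Dn: "Y n - y \<in> H" using YH y closed by blast
      have "2 * B (Y n - y) ((-1) *\<^sub>R X n) \<ge> - (N (Y n - y) / s + s * N ((-1) *\<^sub>R X n))"
        by (rule young[OF Dn closed(3)[OF X] s(1)])
      then have a: "2 * B (Y n - y) (X n) \<le> N (Y n - y) / s + s * N (X n)"
        using N_scale[of "-1" "X n"] scaler[of "Y n - y" "-1" "X n"] by simp
      have b: "2 * B (Y n - y) y \<ge> - (N (Y n - y) / s + s * N y)"
        by (rule young[OF Dn y(1) s(1)])
      have c: "N (Y n - y) / s \<le> e / 16" using elim(1) s(1) by (simp add: field_simps)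
      have f: "s * N (X n) \<le> s * K" using bound[of n] s(1) by (simp add: N_def)
      have g: "N (Y n) = N y + 2 * B (Y n - y) y + N (Y n - y)"
        using N_add[OF y(1) Dn, of 1] comm[of "Y n - y" y] by simp
      have h: "B y (X n) = B (Y n) (X n) - B (Y n - y) (X n)" using B_diffl[OF YH y(1) X] by simp
      have i: "N (Y n - y) \<ge> 0" using N_nn Dn by blast
      show ?case using step[of n] a b c f g h i elim(2) t(3) s(2) e by (simp add: algebra_simps)
    qed
  qed
  then show ?thesis using y Y(1) unfolding C_def N_def by blast
qed

section \<open>Completeness of \<open>L2\<close> and \<open>H1\<close>\<close>

lemma L2_Cauchy_AE_limit:
  fixes f :: "nat \<Rightarrow> real \<Rightarrow> real"
  assumes f: "\<And>n. f n \<in> L2"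
    and C: "\<And>e. e > 0 \<Longrightarrow> \<exists>N. \<forall>m\<ge>N. \<forall>n\<ge>N. nsq (\<lambda>x. f m x - f n x) < e"
    and r: "strict_mono r" and lim: "AE x in lebesgue. (\<lambda>k. f (r k) x) \<longlonglongrightarrow> g x"
    and g: "g \<in> borel_measurable lebesgue"
  shows "g \<in> L2" "(\<lambda>n. nsq (\<lambda>x. f n x - g x)) \<longlonglongrightarrow> 0"
proof -
  have fm: "f n \<in> borel_measurable lebesgue" for n using f L2_D by blast
  have dm: "(\<lambda>x. f n x - g x) \<in> borel_measurable lebesgue" for n using fm g by (intro borel_measurable_diff)
  \<comment> \<open>Fatou's lemma along the subsequence: the distance from \<open>f n\<close> to the
    pointwise limit is at most the bound for the Cauchy tail.\<close>
  have main: "(\<lambda>x. f n x - g x) \<in> L2 \<and> nsq (\<lambda>x. f n x - g x) \<le> e"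
    if e: "e > 0" and N: "\<forall>m\<ge>N. \<forall>n\<ge>N. nsq (\<lambda>x. f m x - f n x) < e" and n: "n \<ge> N" for e N n
  proof -
    have sqm: "(\<lambda>x. ennreal ((f n x - f (r k) x)\<^sup>2)) \<in> borel_measurable lebesgue" for k
      using fm[of n] fm[of "r k"] by (intro measurable_compose[OF _ measurable_ennreal] borel_measurable_power borel_measurable_diff)
    have "(\<integral>\<^sup>+ x. ennreal ((f n x - g x)\<^sup>2) \<partial>lebesgue) = (\<integral>\<^sup>+ x. liminf (\<lambda>k. ennreal ((f n x - f (r k) x)\<^sup>2)) \<partial>lebesgue)"
    proof (rule nn_integral_cong_AE)
      show "AE x in lebesgue. ennreal ((f n x - g x)\<^sup>2) = liminf (\<lambda>k. ennreal ((f n x - f (r k) x)\<^sup>2))"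
        using lim
      proof eventually_elim
        case (elim x)
        have "(\<lambda>k. ennreal ((f n x - f (r k) x)\<^sup>2)) \<longlonglongrightarrow> ennreal ((f n x - g x)\<^sup>2)"
          by (intro tendsto_ennrealI tendsto_power tendsto_diff tendsto_const elim)
        then show ?case using lim_imp_Liminf[OF sequentially_bot] by metis
      qed
    qed
    also have "\<dots> \<le> liminf (\<lambda>k. \<integral>\<^sup>+ x. ennreal ((f n x - f (r k) x)\<^sup>2) \<partial>lebesgue)"
      using sqm by (rule nn_integral_liminf)
    also have "\<dots> \<le> limsup (\<lambda>k. \<integral>\<^sup>+ x. ennreal ((f n x - f (r k) x)\<^sup>2) \<partial>lebesgue)"
      by (intro Liminf_le_Limsup) simp
    also have "\<dots> \<le> ennreal e"
    proof (rule Limsup_bounded)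
      show "\<forall>\<^sub>F k in sequentially. (\<integral>\<^sup>+ x. ennreal ((f n x - f (r k) x)\<^sup>2) \<partial>lebesgue) \<le> ennreal e"
        using eventually_ge_at_top[of N]
      proof eventually_elim
        case (elim k)
        then have "r k \<ge> N" using seq_suble[OF r, of k] by linarith
        then have "nsq (\<lambda>x. f n x - f (r k) x) < e" using N n by blast
        moreover have "(\<integral>\<^sup>+ x. ennreal ((f n x - f (r k) x)\<^sup>2) \<partial>lebesgue) = ennreal (nsq (\<lambda>x. f n x - f (r k) x))"
          unfolding nsq_def using L2_D(2)[OF L2_diff[OF f f]] by (intro nn_integral_eq_integral) auto
        ultimately show ?case by (simp add: ennreal_leI)
      qed
    qed
    finally have le: "(\<integral>\<^sup>+ x. ennreal ((f n x - g x)\<^sup>2) \<partial>lebesgue) \<le> ennreal e" .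
    have i: "integrable lebesgue (\<lambda>x. (f n x - g x)\<^sup>2)"
      using le by (intro integrableI_bounded borel_measurable_power dm) (auto simp: less_top[symmetric] top_unique)
    then have "ennreal (nsq (\<lambda>x. f n x - g x)) \<le> ennreal e"
      using le unfolding nsq_def by (subst nn_integral_eq_integral[symmetric]) auto
    then show ?thesis using i dm e by (auto simp: L2_real_iff)
  qed
  obtain N where "\<forall>m\<ge>N. \<forall>n\<ge>N. nsq (\<lambda>x. f m x - f n x) < 1" using C[of 1] by auto
  then have "(\<lambda>x. f N x - g x) \<in> L2" using main[of 1 N N] by auto
  then have "(\<lambda>x. f N x - (f N x - g x)) \<in> L2" using L2_diff f by blast
  then show "g \<in> L2" by simp
  show "(\<lambda>n. nsq (\<lambda>x. f n x - g x)) \<longlonglongrightarrow> 0"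
  proof (rule LIMSEQ_I)
    fix e :: real assume e: "e > 0"
    obtain N where N: "\<forall>m\<ge>N. \<forall>n\<ge>N. nsq (\<lambda>x. f m x - f n x) < e/2" using C[of "e/2"] e by auto
    have "norm (nsq (\<lambda>x. f n x - g x) - 0) < e" if "n \<ge> N" for n
      using main[OF _ N that] e nsq_nonneg[of "\<lambda>x. f n x - g x"] by auto
    then show "\<exists>N. \<forall>n\<ge>N. norm (nsq (\<lambda>x. f n x - g x) - 0) < e" by blast
  qed
qed

lemma mult_le_scaled_squares: "0 < s \<Longrightarrow> \<bar>a * b\<bar> \<le> s * a\<^sup>2 + b\<^sup>2 / (s::real)"
proof -
  assume s: "0 < s"
  have "0 \<le> (s * \<bar>a\<bar> - \<bar>b\<bar>)\<^sup>2 + (s * a)\<^sup>2 + b\<^sup>2" by simp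
  then have "2 * (s * \<bar>a * b\<bar>) \<le> 2 * (s * (s * a\<^sup>2)) + 2 * b\<^sup>2" by (simp add: power2_eq_square abs_mult algebra_simps)
  then show ?thesis using s by (simp add: field_simps power2_eq_square)
qed

lemma L2_integral_abs_mult_le:
  fixes u v :: "real \<Rightarrow> real"
  assumes "u \<in> L2" "v \<in> L2" "s > 0"
  shows "(LINT x|lebesgue. \<bar>u x * v x\<bar>) \<le> s * nsq u + nsq v / s"
proof -
  have "(LINT x|lebesgue. \<bar>u x * v x\<bar>) \<le> (LINT x|lebesgue. s * (u x)\<^sup>2 + (v x)\<^sup>2 / s)"
    using L2_mult_integrable[OF assms(1,2)] L2_D[OF assms(1)] L2_D[OF assms(2)] mult_le_scaled_squares[OF assms(3)]
    by (intro integral_mono) auto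
  then show ?thesis using L2_D[OF assms(1)] L2_D[OF assms(2)] by (simp add: nsq_def)
qed

text \<open>Multiplication with the square root of a Gaussian turns \<open>L\<^sup>2\<close> Cauchy sequences into \<open>L\<^sup>1\<close> ones.\<close>

lemma L2_complete:
  fixes f :: "nat \<Rightarrow> real \<Rightarrow> real"
  assumes f: "\<And>n. f n \<in> L2"
    and C: "\<And>e. e > 0 \<Longrightarrow> \<exists>N. \<forall>m\<ge>N. \<forall>n\<ge>N. nsq (\<lambda>x. f m x - f n x) < e"
  shows "\<exists>g\<in>L2. (\<lambda>n. nsq (\<lambda>x. f n x - g x)) \<longlonglongrightarrow> 0"
proof -
  define \<phi> where "\<phi> x = sqrt (normal_density 0 1 x)" for x
  have \<phi>pos: "\<phi> x > 0" for x by (simp add: \<phi>_def normal_density_pos)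
  have "\<phi> \<in> borel_measurable borel" unfolding \<phi>_def by measurable
  then have \<phi>m: "\<phi> \<in> borel_measurable lebesgue" by (intro measurable_completion) simp
  have "integrable lebesgue (normal_density 0 1)"
    by (subst integrable_completion) auto
  then have \<phi>L: "\<phi> \<in> L2" using \<phi>m by (simp add: L2_real_iff \<phi>_def less_imp_le)
  have i: "integrable lebesgue (\<lambda>x. f n x * \<phi> x)" for n using L2_mult_integrable[OF f \<phi>L] .
  have "\<exists>N. \<forall>m\<ge>N. \<forall>n\<ge>N. (LINT x|lebesgue. norm (f m x * \<phi> x - f n x * \<phi> x)) < e" if e: "e > 0" for e
  proof -
    \<comment> \<open>With this weight both terms of the product estimate are at most
      \<open>e / 2\<close>; the summand 1 keeps \<open>s\<close> positive.\<close>
    define s where "s = 2 * (nsq \<phi> + 1) / e"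
    have s: "s > 0" using e nsq_nonneg[of \<phi>] by (simp add: s_def)
    obtain N where N: "\<forall>m\<ge>N. \<forall>n\<ge>N. nsq (\<lambda>x. f m x - f n x) < e / (2 * s)" using C[of "e / (2 * s)"] e s by auto
    have "(LINT x|lebesgue. norm (f m x * \<phi> x - f n x * \<phi> x)) < e" if "m \<ge> N" "n \<ge> N" for m n
    proof -
      have "(LINT x|lebesgue. norm (f m x * \<phi> x - f n x * \<phi> x)) = (LINT x|lebesgue. \<bar>(f m x - f n x) * \<phi> x\<bar>)"
        by (simp add: left_diff_distrib)
      also have "\<dots> \<le> s * nsq (\<lambda>x. f m x - f n x) + nsq \<phi> / s"
        by (rule L2_integral_abs_mult_le[OF L2_diff[OF f f] \<phi>L s])
      also have "s * nsq (\<lambda>x. f m x - f n x) < s * (e / (2 * s))" using N that s by (intro mult_strict_left_mono) auto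
      also have "s * (e / (2 * s)) = e / 2" using s by simp
      also have "nsq \<phi> / s \<le> e / 2" using e nsq_nonneg[of \<phi>] by (simp add: s_def field_simps)
      finally show ?thesis by simp
    qed
    then show ?thesis by blast
  qed
  then obtain r where r: "strict_mono r" "AE x in lebesgue. Cauchy (\<lambda>i. f (r i) x * \<phi> x)"
    using cauchy_L1_AE_cauchy_subseq[of lebesgue "\<lambda>n x. f n x * \<phi> x"] i by blast
  define g where "g x = lim (\<lambda>k. f (r k) x)" for x
  have gm: "g \<in> borel_measurable lebesgue" unfolding g_def using f L2_D by (intro borel_measurable_lim_metric) blast
  have lim: "AE x in lebesgue. (\<lambda>k. f (r k) x) \<longlonglongrightarrow> g x"
    using r(2)
  proof eventually_elim
    case (elim x)
    then obtain l where "(\<lambda>i. f (r i) x * \<phi> x) \<longlonglongrightarrow> l" by (auto simp: Cauchy_convergent_iff convergent_def)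
    then have "(\<lambda>i. f (r i) x * \<phi> x / \<phi> x) \<longlonglongrightarrow> l / \<phi> x" using \<phi>pos[of x] by (intro tendsto_divide tendsto_const) auto
    then have "(\<lambda>i. f (r i) x) \<longlonglongrightarrow> l / \<phi> x" using \<phi>pos[of x] by simp
    then show ?case unfolding g_def by (simp add: limI)
  qed
  show ?thesis using L2_Cauchy_AE_limit[OF f C r(1) lim gm] by blast
qed

lemma form_upper:
  assumes q: "q \<in> L_infinity" and K: "AE x in lebesgue. \<bar>q x\<bar> \<le> K" and P: "P \<in> H1"
  shows "form q P \<le> nsq (snd P) + K * nsq (fst P)"
proof -
  have "form q P \<le> (LINT x|lebesgue. (snd P x)\<^sup>2 + K * (fst P x)\<^sup>2)"
    unfolding bil_def
  proof (rule integral_mono_AE)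
    show "integrable lebesgue (\<lambda>x. (snd P x)\<^sup>2 + K * (fst P x)\<^sup>2)"
      using L2_D[OF H1_D(2)[OF P]] L2_D[OF H1_D(3)[OF P]] by auto
    show "AE x in lebesgue. snd P x * snd P x + q x * (fst P x * fst P x) \<le> (snd P x)\<^sup>2 + K * (fst P x)\<^sup>2"
      using K
    proof eventually_elim
      case (elim x)
      then have "q x * (fst P x)\<^sup>2 \<le> K * (fst P x)\<^sup>2" by (intro mult_right_mono) auto
      then show ?case by (simp add: power2_eq_square)
    qed
  qed (rule bil_integrable[OF q P P])
  also have "\<dots> = nsq (snd P) + K * nsq (fst P)"
    unfolding nsq_def using L2_D[OF H1_D(2)[OF P]] L2_D[OF H1_D(3)[OF P]]
    by (subst Bochner_Integration.integral_add) auto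
  finally show ?thesis .
qed

text \<open>The lower bound \<delta> controls the L2 norm, and boundedness of \<open>q\<close> then
  recovers the derivative: the left side is at most \<open>form q P + (K + 1) * nsq (fst P)\<close>.
  The form thus dominates the squared H1 norm, with a constant that is the same for all translates
  of \<open>q\<close>.\<close>

lemma coercive:
  assumes q: "q \<in> L_infinity" and K: "AE x in lebesgue. \<bar>q x\<bar> \<le> K" "K \<ge> 0" and d: "\<delta> > 0" "\<delta> * nsq (fst P) \<le> form q P"
    and P: "P \<in> H1"
  shows "nsq (snd P) + nsq (fst P) \<le> (1 + (K + 1) / \<delta>) * form q P"
proof -
  have "nsq (fst P) \<le> form q P / \<delta>" using d by (simp add: field_simps)
  then have "(K + 1) * nsq (fst P) \<le> (K + 1) * (form q P / \<delta>)" using K(2) by (intro mult_left_mono) auto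
  then show ?thesis using form_lower[OF q K(1) P] by (simp add: algebra_simps)
qed

lemma H1_pointwise_nsq: "P \<in> H1 \<Longrightarrow> (fst P x)\<^sup>2 \<le> nsq (snd P) + nsq (fst P)"
  using H1_pointwise[of P x] by (simp add: nsq_def H1_D L2_D)

lemma nsq_indicator: "a \<le> b \<Longrightarrow> nsq (indicator {a..b}) = b - a" "indicat_real {a..b} \<in> L2"
proof -
  have *: "(indicat_real {a..b} x)\<^sup>2 = indicat_real {a..b} x" for x by (simp add: indicator_def)
  show "a \<le> b \<Longrightarrow> nsq (indicator {a..b}) = b - a" unfolding nsq_def * by simp
  have "indicat_real {a..b} \<in> borel_measurable lebesgue" by (rule borel_measurable_indicator) simp
  moreover have "integrable lebesgue (indicat_real {a..b})"
    by (rule integrable_real_indicator) (auto simp: emeasure_lborel_Icc_eq)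
  ultimately show "indicat_real {a..b} \<in> L2" unfolding L2_real_iff * by blast
qed

text \<open>Hoelder continuity of exponent 1/2, with the parameter \<open>s\<close> left free
  instead of optimized. A bounded sequence in \<open>H1\<close> is therefore equicontinuous.\<close>

lemma H1_increment:
  assumes P: "P \<in> H1" and "a \<le> b" "s > 0"
  shows "\<bar>fst P b - fst P a\<bar> \<le> s * (b - a) + nsq (snd P) / s"
proof -
  have "\<bar>fst P b - fst P a\<bar> = \<bar>LINT x:{a..b}|lebesgue. snd P x\<bar>"
    using AC_eq[OF H1_D(1)[OF P] \<open>a \<le> b\<close>] by simp
  also have "\<dots> \<le> (LINT x|lebesgue. \<bar>indicator {a..b} x * snd P x\<bar>)"
    unfolding set_lebesgue_integral_def using integral_norm_bound[of lebesgue "\<lambda>x. indicator {a..b} x *\<^sub>R snd P x"] by simp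
  also have "\<dots> \<le> s * (b - a) + nsq (snd P) / s"
    using L2_integral_abs_mult_le[OF nsq_indicator(2)[of a b] H1_D(3)[OF P] \<open>s > 0\<close>] nsq_indicator(1)[OF \<open>a \<le> b\<close>] by simp
  finally show ?thesis .
qed

lemma L2_mult_tendsto_0:
  assumes f: "\<And>n::nat. f n \<in> L2" "(\<lambda>n. nsq (f n)) \<longlonglongrightarrow> 0" and v: "v \<in> L2"
  shows "(\<lambda>n. LINT x|lebesgue. \<bar>f n x * v x\<bar>) \<longlonglongrightarrow> 0"
proof (rule LIMSEQ_I)
  fix e :: real assume e: "e > 0"
  define s where "s = 2 * (nsq v + 1) / e"
  have s: "s > 0" using e nsq_nonneg[of v] by (simp add: s_def)
  have sv: "nsq v / s \<le> e / 2" using e nsq_nonneg[of v] by (simp add: s_def field_simps)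
  have "\<forall>\<^sub>F n in sequentially. nsq (f n) < e / (2 * s)"
    by (rule order_tendstoD(2)[OF f(2)]) (use e s in simp)
  then obtain N where N: "\<And>n. n \<ge> N \<Longrightarrow> nsq (f n) < e / (2 * s)" by (auto simp: eventually_sequentially)
  have "norm ((LINT x|lebesgue. \<bar>f n x * v x\<bar>) - 0) < e" if "n \<ge> N" for n
  proof -
    have "s * nsq (f n) < s * (e / (2 * s))" using N[OF that] s by (intro mult_strict_left_mono) auto
    then have "s * nsq (f n) < e / 2" using s by simp
    then have "(LINT x|lebesgue. \<bar>f n x * v x\<bar>) < e" using L2_integral_abs_mult_le[OF f(1) v s, of n] sv by linarith
    moreover have "(LINT x|lebesgue. \<bar>f n x * v x\<bar>) \<ge> 0" by simp
    ultimately show ?thesis by simp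
  qed
  then show "\<exists>N. \<forall>n\<ge>N. norm ((LINT x|lebesgue. \<bar>f n x * v x\<bar>) - 0) < e" by blast
qed

lemma L2_set_integrable: "g \<in> L2 \<Longrightarrow> set_integrable lebesgue {a..b} g" for g :: "real \<Rightarrow> real"
  using L2_mult_integrable[OF nsq_indicator(2)[of a b], of g] by (simp add: set_integrable_def)

text \<open>By coercivity a Cauchy sequence for the form is one for the H1 norm. The pointwise bound
  then gives convergence at every point, so the limit \<open>U\<close> is found without passing to a
  representative, and its increments are the limits of the integrals of the derivatives.\<close>

lemma H1_complete:
  assumes c: "c > 0" and q: "q \<in> L_infinity" and co: "\<And>P. P \<in> H1 \<Longrightarrow> nsq (snd P) + nsq (fst P) \<le> c * form q P"
    and Y: "\<And>n::nat. Y n \<in> H1"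
    and C: "\<And>e. e > 0 \<Longrightarrow> \<exists>N. \<forall>m\<ge>N. \<forall>n\<ge>N. form q (Y m - Y n) < e"
  shows "\<exists>y\<in>H1. (\<lambda>n. form q (Y n - y)) \<longlonglongrightarrow> 0"
proof -
  obtain K where K: "AE x in lebesgue. \<bar>q x\<bar> \<le> K" using q by (auto simp: L_infinity_def)
  have D: "Y m - Y n \<in> H1" for m n using Y H1_diff by blast
  have C': "\<exists>N. \<forall>m\<ge>N. \<forall>n\<ge>N. nsq (snd (Y m - Y n)) + nsq (fst (Y m - Y n)) < e" if "e > 0" for e
  proof -
    obtain N where N: "\<forall>m\<ge>N. \<forall>n\<ge>N. form q (Y m - Y n) < e / c" using C[of "e / c"] divide_pos_pos[OF \<open>e > 0\<close> c] by blast
    have "nsq (snd (Y m - Y n)) + nsq (fst (Y m - Y n)) < e" if "m \<ge> N" "n \<ge> N" for m n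
    proof -
      have "form q (Y m - Y n) < e / c" using N that by blast
      then have "c * form q (Y m - Y n) < e" using c by (simp add: field_simps)
      then show ?thesis using co[OF D, of m n] by simp
    qed
    then show ?thesis by blast
  qed
  have Cf: "\<exists>N. \<forall>m\<ge>N. \<forall>n\<ge>N. nsq (\<lambda>x. fst (Y m) x - fst (Y n) x) < e"
    and Cs: "\<exists>N. \<forall>m\<ge>N. \<forall>n\<ge>N. nsq (\<lambda>x. snd (Y m) x - snd (Y n) x) < e" if e: "e > 0" for e
  proof -
    obtain N where N: "\<forall>m\<ge>N. \<forall>n\<ge>N. nsq (snd (Y m - Y n)) + nsq (fst (Y m - Y n)) < e" using C'[OF e] by blast
    have "nsq (\<lambda>x. fst (Y m) x - fst (Y n) x) < e \<and> nsq (\<lambda>x. snd (Y m) x - snd (Y n) x) < e" if "m \<ge> N" "n \<ge> N" for m n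
    proof -
      have "nsq (snd (Y m - Y n)) + nsq (fst (Y m - Y n)) < e" using N that by blast
      then have "nsq (\<lambda>x. snd (Y m) x - snd (Y n) x) + nsq (\<lambda>x. fst (Y m) x - fst (Y n) x) < e"
        by (simp add: nsq_def)
      then show ?thesis using nsq_nonneg[of "\<lambda>x. fst (Y m) x - fst (Y n) x"] nsq_nonneg[of "\<lambda>x. snd (Y m) x - snd (Y n) x"] by linarith
    qed
    then show "\<exists>N. \<forall>m\<ge>N. \<forall>n\<ge>N. nsq (\<lambda>x. fst (Y m) x - fst (Y n) x) < e" "\<exists>N. \<forall>m\<ge>N. \<forall>n\<ge>N. nsq (\<lambda>x. snd (Y m) x - snd (Y n) x) < e" by blast+
  qed
  have fL: "fst (Y n) \<in> L2" and sL: "snd (Y n) \<in> L2" for n using Y H1_D by auto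
  obtain g where g: "g \<in> L2" "(\<lambda>n. nsq (\<lambda>x. snd (Y n) x - g x)) \<longlonglongrightarrow> 0"
    using L2_complete[OF sL Cs] by blast
  have "Cauchy (\<lambda>n. fst (Y n) x)" for x
  proof (rule CauchyI)
    fix e :: real assume e: "e > 0"
    obtain N where N: "\<forall>m\<ge>N. \<forall>n\<ge>N. nsq (snd (Y m - Y n)) + nsq (fst (Y m - Y n)) < e\<^sup>2" using C'[of "e\<^sup>2"] e by auto
    have "norm (fst (Y m) x - fst (Y n) x) < e" if "m \<ge> N" "n \<ge> N" for m n
    proof -
      have "(fst (Y m - Y n) x)\<^sup>2 < e\<^sup>2"
        by (rule le_less_trans[OF H1_pointwise_nsq[OF D]]) (use N that in blast)
      then show ?thesis using e power_less_imp_less_base[of "\<bar>fst (Y m) x - fst (Y n) x\<bar>" 2 e] by simp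
    qed
    then show "\<exists>N. \<forall>m\<ge>N. \<forall>n\<ge>N. norm (fst (Y m) x - fst (Y n) x) < e" by blast
  qed
  then have cv: "convergent (\<lambda>n. fst (Y n) x)" for x by (simp only: Cauchy_convergent_iff)
  define U where "U x = lim (\<lambda>n. fst (Y n) x)" for x
  have U: "(\<lambda>n. fst (Y n) x) \<longlonglongrightarrow> U x" for x
    using cv[of x] unfolding U_def convergent_LIMSEQ_iff .
  have Um: "U \<in> borel_measurable lebesgue"
    by (rule borel_measurable_LIMSEQ_real[where u="\<lambda>n. fst (Y n)", OF U L2_D(1)[OF fL]])
  have UL: "U \<in> L2" "(\<lambda>n. nsq (\<lambda>x. fst (Y n) x - U x)) \<longlonglongrightarrow> 0"
    using L2_Cauchy_AE_limit[OF fL Cf strict_mono_id _ Um] U by (auto simp del: fst_diff)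
  have "U b - U a = (LINT x:{a..b}|lebesgue. g x)" if ab: "a \<le> b" for a b
  proof -
    have "(\<lambda>n. (LINT x:{a..b}|lebesgue. snd (Y n) x) - (LINT x:{a..b}|lebesgue. g x)) \<longlonglongrightarrow> 0"
    proof (rule Lim_null_comparison)
      show "(\<lambda>n. LINT x|lebesgue. \<bar>(snd (Y n) x - g x) * indicator {a..b} x\<bar>) \<longlonglongrightarrow> 0"
        by (rule L2_mult_tendsto_0[OF L2_diff[OF sL g(1)] g(2) nsq_indicator(2)])
      show "\<forall>\<^sub>F n in sequentially. norm ((LINT x:{a..b}|lebesgue. snd (Y n) x) - (LINT x:{a..b}|lebesgue. g x))
          \<le> (LINT x|lebesgue. \<bar>(snd (Y n) x - g x) * indicator {a..b} x\<bar>)"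
      proof (intro always_eventually allI)
        fix n
        have "(LINT x:{a..b}|lebesgue. snd (Y n) x) - (LINT x:{a..b}|lebesgue. g x) = (LINT x:{a..b}|lebesgue. snd (Y n) x - g x)"
          using L2_set_integrable[OF sL] L2_set_integrable[OF g(1)] by simp
        also have "\<dots> = (LINT x|lebesgue. (snd (Y n) x - g x) * indicator {a..b} x)"
          unfolding set_lebesgue_integral_def by (simp add: mult.commute)
        also have "norm \<dots> \<le> (LINT x|lebesgue. \<bar>(snd (Y n) x - g x) * indicator {a..b} x\<bar>)"
          using integral_norm_bound[of lebesgue "\<lambda>x. (snd (Y n) x - g x) * indicator {a..b} x"] by simp
        finally show "norm ((LINT x:{a..b}|lebesgue. snd (Y n) x) - (LINT x:{a..b}|lebesgue. g x))
          \<le> (LINT x|lebesgue. \<bar>(snd (Y n) x - g x) * indicator {a..b} x\<bar>)" .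
      qed
    qed
    then have "(\<lambda>n. LINT x:{a..b}|lebesgue. snd (Y n) x) \<longlonglongrightarrow> (LINT x:{a..b}|lebesgue. g x)"
      by (simp add: LIM_zero_iff)
    moreover have "(LINT x:{a..b}|lebesgue. snd (Y n) x) = fst (Y n) b - fst (Y n) a" for n
      using AC_eq[OF H1_D(1)[OF Y] ab] .
    ultimately have "(\<lambda>n. fst (Y n) b - fst (Y n) a) \<longlonglongrightarrow> (LINT x:{a..b}|lebesgue. g x)" by simp
    then show ?thesis using LIMSEQ_unique tendsto_diff[OF U U] by blast
  qed
  then have y: "(U, g) \<in> H1" using UL g L2_set_integrable[OF g(1)] by (simp add: H1_def AC_def)
  have Dy: "Y n - (U, g) \<in> H1" for n using H1_diff Y y by blast
  have "(\<lambda>n. form q (Y n - (U, g))) \<longlonglongrightarrow> 0"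
  proof (rule tendsto_sandwich)
    show "\<forall>\<^sub>F n in sequentially. 0 \<le> form q (Y n - (U, g))"
    proof (intro always_eventually allI)
      fix n show "0 \<le> form q (Y n - (U, g))"
      proof -
        have "0 \<le> c * form q (Y n - (U, g))"
          using co[OF Dy, of n] nsq_nonneg[of "snd (Y n - (U, g))"] nsq_nonneg[of "fst (Y n - (U, g))"] by linarith
        then show ?thesis using c by (simp add: zero_le_mult_iff)
      qed
    qed
    show "\<forall>\<^sub>F n in sequentially. form q (Y n - (U, g)) \<le> nsq (\<lambda>x. snd (Y n) x - g x) + K * nsq (\<lambda>x. fst (Y n) x - U x)"
      using form_upper[OF q K Dy] by (intro always_eventually allI) (simp add: nsq_def)
    have "(\<lambda>n. nsq (\<lambda>x. snd (Y n) x - g x) + K * nsq (\<lambda>x. fst (Y n) x - U x)) \<longlonglongrightarrow> 0 + K * 0"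
      by (intro tendsto_intros g UL)
    then show "(\<lambda>n. nsq (\<lambda>x. snd (Y n) x - g x) + K * nsq (\<lambda>x. fst (Y n) x - U x)) \<longlonglongrightarrow> 0" by simp
  qed auto
  then show ?thesis using y by blast
qed

text \<open>
  The positive part of \<open>|f v| - s f\<^sup>2\<close> is dominated by \<open>v\<^sup>2 / s\<close>, while \<open>s f\<^sup>2\<close> contributes at most \<open>s M\<close>.
\<close>

lemma bounded_mult_weak_0:
  fixes f :: "nat \<Rightarrow> real \<Rightarrow> real"
  assumes f: "\<And>n. f n \<in> L2" "\<And>n. nsq (f n) \<le> M" "\<And>x. (\<lambda>n. f n x) \<longlonglongrightarrow> 0" and v: "v \<in> L2"
  shows "(\<lambda>n. LINT x|lebesgue. \<bar>f n x * v x\<bar>) \<longlonglongrightarrow> 0"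
proof (rule LIMSEQ_I)
  fix e :: real assume e: "e > 0"
  have M: "M \<ge> 0" using f(2)[of 0] nsq_nonneg[of "f 0"] by linarith
  define s where "s = e / (2 * (M + 1))"
  have s: "s > 0" using e M by (simp add: s_def)
  have sM: "s * M \<le> e / 2" using e M by (simp add: s_def field_simps)
  have fm: "f n \<in> borel_measurable lebesgue" and vm: "v \<in> borel_measurable lebesgue" for n using f v L2_D by auto
  have i: "integrable lebesgue (\<lambda>x. \<bar>f n x * v x\<bar>)" "integrable lebesgue (\<lambda>x. s * (f n x)\<^sup>2)" for n
    using L2_mult_integrable[OF f(1) v] L2_D[OF f(1)] by auto
  have "(\<lambda>n. LINT x|lebesgue. max 0 (\<bar>f n x * v x\<bar> - s * (f n x)\<^sup>2)) \<longlonglongrightarrow> (LINT (x::real)|lebesgue. (0::real))"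
  proof (rule integral_dominated_convergence)
    show "integrable lebesgue (\<lambda>x. (v x)\<^sup>2 / s)" using L2_D[OF v] by simp
    show "(\<lambda>x. max 0 (\<bar>f n x * v x\<bar> - s * (f n x)\<^sup>2)) \<in> borel_measurable lebesgue" for n
      using i[of n] by (intro borel_measurable_max borel_measurable_diff borel_measurable_integrable) auto
    show "AE x in lebesgue. (\<lambda>n. max 0 (\<bar>f n x * v x\<bar> - s * (f n x)\<^sup>2)) \<longlonglongrightarrow> 0"
    proof (rule AE_I2)
      fix x
      have "(\<lambda>n. max 0 (\<bar>f n x * v x\<bar> - s * (f n x)\<^sup>2)) \<longlonglongrightarrow> max 0 (\<bar>0 * v x\<bar> - s * 0\<^sup>2)"
        by (intro tendsto_intros f(3))
      then show "(\<lambda>n. max 0 (\<bar>f n x * v x\<bar> - s * (f n x)\<^sup>2)) \<longlonglongrightarrow> 0" by simp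
    qed
    show "AE x in lebesgue. norm (max 0 (\<bar>f n x * v x\<bar> - s * (f n x)\<^sup>2)) \<le> (v x)\<^sup>2 / s" for n
    proof (rule AE_I2)
      fix x show "norm (max 0 (\<bar>f n x * v x\<bar> - s * (f n x)\<^sup>2)) \<le> (v x)\<^sup>2 / s"
        using mult_le_scaled_squares[OF s, of "f n x" "v x"] s by (auto simp: max_def)
    qed
  qed simp
  then have "\<forall>\<^sub>F n in sequentially. (LINT x|lebesgue. max 0 (\<bar>f n x * v x\<bar> - s * (f n x)\<^sup>2)) < e / 2"
    by (rule order_tendstoD(2)) (use e in simp)
  then obtain N where N: "\<And>n. n \<ge> N \<Longrightarrow> (LINT x|lebesgue. max 0 (\<bar>f n x * v x\<bar> - s * (f n x)\<^sup>2)) < e / 2"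
    by (auto simp: eventually_sequentially)
  have "norm ((LINT x|lebesgue. \<bar>f n x * v x\<bar>) - 0) < e" if "n \<ge> N" for n
  proof -
    have im: "integrable lebesgue (\<lambda>x. max 0 (\<bar>f n x * v x\<bar> - s * (f n x)\<^sup>2))"
      using i[of n] by (intro integrable_max Bochner_Integration.integrable_diff) auto
    have "(LINT x|lebesgue. \<bar>f n x * v x\<bar>) \<le> (LINT x|lebesgue. s * (f n x)\<^sup>2 + max 0 (\<bar>f n x * v x\<bar> - s * (f n x)\<^sup>2))"
      using i[of n] im by (intro integral_mono Bochner_Integration.integrable_add) auto
    also have "\<dots> = s * nsq (f n) + (LINT x|lebesgue. max 0 (\<bar>f n x * v x\<bar> - s * (f n x)\<^sup>2))"
      using i[of n] im by (simp add: nsq_def)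
    also have "\<dots> < s * M + e / 2" using N[OF that] f(2)[of n] s by (intro add_le_less_mono mult_left_mono) auto
    finally have "(LINT x|lebesgue. \<bar>f n x * v x\<bar>) < e" using sM by simp
    moreover have "(LINT x|lebesgue. \<bar>f n x * v x\<bar>) \<ge> 0" by simp
    ultimately show ?thesis by simp
  qed
  then show "\<exists>N. \<forall>n\<ge>N. norm ((LINT x|lebesgue. \<bar>f n x * v x\<bar>) - 0) < e" by blast
qed

text \<open>The argument of Arzela and Ascoli: a diagonal subsequence converges at the rationals,
  and the equicontinuity from \<open>H1_increment\<close> extends the convergence to every real
  point.\<close>

lemma H1_pointwise_subsequence:
  fixes X :: "nat \<Rightarrow> (real \<Rightarrow> real) \<times> (real \<Rightarrow> real)"
  assumes X: "\<And>n. X n \<in> H1" and A: "\<And>n. nsq (snd (X n)) + nsq (fst (X n)) \<le> A"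
  shows "\<exists>r \<phi>. strict_mono r \<and> (\<forall>x. (\<lambda>n. fst (X (r n)) x) \<longlonglongrightarrow> \<phi> x)"
proof -
  have A0: "A \<ge> 0" using A[of 0] nsq_nonneg[of "snd (X 0)"] nsq_nonneg[of "fst (X 0)"] by linarith
  have bd: "norm (fst (X n) x) \<le> sqrt A" for n x
    using real_sqrt_le_mono[OF order_trans[OF H1_pointwise_nsq[OF X] A], of n x] by simp
  obtain r where r: "strict_mono r" "\<And>x. x \<in> \<rat> \<Longrightarrow> \<exists>l. (\<lambda>n. fst (X (r n)) x) \<longlonglongrightarrow> l"
  proof (rule function_convergent_subsequence[OF countable_rat, of "\<lambda>n. fst (X n)" "sqrt A"])
    show "norm (fst (X n) x) \<le> sqrt A" for n x by (rule bd)
  qed (rule that)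
  have "Cauchy (\<lambda>n. fst (X (r n)) x)" for x :: real
  proof (rule CauchyI)
    fix e :: real assume e: "e > 0"
    define s where "s = 8 * (A + 1) / e"
    have s: "s > 0" using e A0 by (simp add: s_def)
    have As: "A / s \<le> e / 8" using e A0 by (simp add: s_def field_simps)
    obtain y :: real where y: "y \<in> \<rat>" "x < y" "y < x + e / (8 * s)"
      using Rats_dense_in_real[of x "x + e / (8 * s)"] e s by auto
    have near: "\<bar>fst (X n) y - fst (X n) x\<bar> \<le> e / 4" for n
    proof -
      have "s * (y - x) \<le> s * (e / (8 * s))" using y s by (intro mult_left_mono) auto
      then have "s * (y - x) \<le> e / 8" using s by simp
      moreover have "nsq (snd (X n)) / s \<le> A / s" using A[of n] nsq_nonneg[of "fst (X n)"] s by (intro divide_right_mono) auto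
      ultimately show ?thesis using H1_increment[OF X, of x y s n] y s As by linarith
    qed
    have "Cauchy (\<lambda>n. fst (X (r n)) y)" using r(2)[OF y(1)] LIMSEQ_imp_Cauchy by blast
    then obtain N where N: "\<forall>m\<ge>N. \<forall>n\<ge>N. norm (fst (X (r m)) y - fst (X (r n)) y) < e / 4"
      using CauchyD[of _ "e / 4"] e by (metis divide_pos_pos zero_less_numeral)
    have "norm (fst (X (r m)) x - fst (X (r n)) x) < e" if "m \<ge> N" "n \<ge> N" for m n
    proof -
      have "norm (fst (X (r m)) y - fst (X (r n)) y) < e / 4" using N that by blast
      then show ?thesis using near[of "r m"] near[of "r n"] by (simp add: abs_if split: if_splits)
    qed
    then show "\<exists>N. \<forall>m\<ge>N. \<forall>n\<ge>N. norm (fst (X (r m)) x - fst (X (r n)) x) < e" by blast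
  qed
  then have cv: "convergent (\<lambda>n. fst (X (r n)) x)" for x by (simp only: Cauchy_convergent_iff)
  define \<phi> where "\<phi> x = lim (\<lambda>n. fst (X (r n)) x)" for x
  have "(\<lambda>n. fst (X (r n)) x) \<longlonglongrightarrow> \<phi> x" for x
    using cv[of x] unfolding \<phi>_def convergent_LIMSEQ_iff .
  then show ?thesis using r(1) by blast
qed

section \<open>Splitting of the power nonlinearity\<close>

lemma abs_powr_has_derivative:
  assumes r: "r > (1::real)"
  shows "((\<lambda>t. \<bar>t\<bar> powr r) has_real_derivative r * (sgn t * \<bar>t\<bar> powr (r - 1))) (at t)"
    and "((\<lambda>t. sgn t * \<bar>t\<bar> powr r) has_real_derivative r * \<bar>t\<bar> powr (r - 1)) (at t)"
proof -
  have pos: "((\<lambda>t. t powr r) has_real_derivative r * t powr (r - 1)) (at t)" if "t > 0" for t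
    using that by (rule has_real_derivative_powr)
  have neg: "((\<lambda>t. (- t) powr r) has_real_derivative - (r * (- t) powr (r - 1))) (at t)" if "t < 0" for t
    using DERIV_chain2[OF pos[of "- t"] DERIV_minus[OF DERIV_ident]] that by simp
  have ev1: "\<forall>\<^sub>F s in nhds t. s > 0" if "t > 0" for t :: real
    using eventually_nhds_in_open[OF open_greaterThan, of t 0] that by simp
  have ev2: "\<forall>\<^sub>F s in nhds t. s < 0" if "t < 0" for t :: real
    using eventually_nhds_in_open[OF open_lessThan, of t 0] that by simp
  have nrm: "\<bar>h\<bar> powr r / \<bar>h\<bar> = \<bar>h\<bar> powr (r - 1)" if "h \<noteq> 0" for h :: real
    using that by (simp add: powr_diff)
  have z: "((\<lambda>h. \<bar>h\<bar> powr (r - 1)) \<longlongrightarrow> 0) (at (0::real))"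
    using r by (intro tendsto_zero_powrI[where b="r - 1"]) (auto intro!: tendsto_eq_intros)
  consider "t > 0" | "t = 0" | "t < 0" by linarith
  then show "((\<lambda>t. \<bar>t\<bar> powr r) has_real_derivative r * (sgn t * \<bar>t\<bar> powr (r - 1))) (at t)"
  proof cases
    case 1
    show ?thesis
      by (rule DERIV_cong_ev[THEN iffD1, rotated -1, OF pos[OF 1]]) (use 1 ev1[OF 1] in \<open>auto elim!: eventually_mono\<close>)
  next
    case 2
    have "((\<lambda>h. (\<bar>0 + h\<bar> powr r - \<bar>0\<bar> powr r) / h) \<longlongrightarrow> 0) (at 0)"
    proof (rule Lim_null_comparison[OF _ z])
      show "\<forall>\<^sub>F h in at 0. norm ((\<bar>0 + h\<bar> powr r - \<bar>0\<bar> powr r) / h) \<le> \<bar>h\<bar> powr (r - 1)"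
        unfolding eventually_at_filter using nrm r by (intro always_eventually allI impI) simp
    qed
    then show ?thesis using 2 by (simp add: DERIV_def)
  next
    case 3
    show ?thesis
      by (rule DERIV_cong_ev[THEN iffD1, rotated -1, OF neg[OF 3]]) (use 3 ev2[OF 3] in \<open>auto elim!: eventually_mono\<close>)
  qed
  consider "t > 0" | "t = 0" | "t < 0" by linarith
  then show "((\<lambda>t. sgn t * \<bar>t\<bar> powr r) has_real_derivative r * \<bar>t\<bar> powr (r - 1)) (at t)"
  proof cases
    case 1
    show ?thesis
      by (rule DERIV_cong_ev[THEN iffD1, rotated -1, OF pos[OF 1]]) (use 1 ev1[OF 1] in \<open>auto elim!: eventually_mono\<close>)
  next
    case 2
    have "((\<lambda>h. (sgn (0 + h) * \<bar>0 + h\<bar> powr r - sgn 0 * \<bar>0\<bar> powr r) / h) \<longlongrightarrow> 0) (at (0::real))"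
    proof (rule Lim_null_comparison[OF _ z])
      show "\<forall>\<^sub>F h::real in at 0. norm ((sgn (0 + h) * \<bar>0 + h\<bar> powr r - sgn 0 * \<bar>0\<bar> powr r) / h) \<le> \<bar>h\<bar> powr (r - 1)"
        unfolding eventually_at_filter using nrm r by (intro always_eventually allI impI) (simp add: abs_mult abs_sgn_eq)
    qed
    then show ?thesis using 2 r by (simp add: DERIV_def)
  next
    case 3
    have "((\<lambda>t. - ((- t) powr r)) has_real_derivative r * (- t) powr (r - 1)) (at t)"
      using DERIV_minus[OF neg[OF 3]] by simp
    then show ?thesis
      by (rule DERIV_cong_ev[THEN iffD1, rotated -1]) (use 3 ev2[OF 3] in \<open>auto elim!: eventually_mono\<close>)
  qed
qed

text \<open>A quantitative form of the Brezis-Lieb splitting for bounded functions. The derivative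
  of \<open>\<bar>f + s\<bar> powr q - \<bar>s\<bar> powr q\<close> in \<open>s\<close> is a
  difference of values of \<open>\<psi>\<close>, hence of order \<open>\<bar>f\<bar>\<close> by the
  Lipschitz bound, and integrating it from 0 to \<open>v\<close> adds the factor
  \<open>\<bar>v\<bar>\<close>. The bound is a multiple of \<open>\<bar>f * v\<bar>\<close>, whose
  integral \<open>bounded_mult_weak_0\<close> sends to zero.\<close>

lemma abs_powr_splitting:
  assumes q: "q > (2::real)" and M: "\<bar>f\<bar> \<le> M" "\<bar>v\<bar> \<le> M"
  shows "\<bar>\<bar>f + v\<bar> powr q - \<bar>f\<bar> powr q - \<bar>v\<bar> powr q\<bar> \<le> q * (q - 1) * (2 * M) powr (q - 2) * \<bar>f * v\<bar>"
proof -
  define L where "L = (q - 1) * (2 * M) powr (q - 2)"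
  define \<psi> where "\<psi> t = sgn t * \<bar>t\<bar> powr (q - 1)" for t :: real
  have d\<psi>: "(\<psi> has_real_derivative (q - 1) * \<bar>t\<bar> powr (q - 2)) (at t)" for t
    using abs_powr_has_derivative(2)[of "q - 1" t] q unfolding \<psi>_def by (simp add: diff_diff_eq)
  have bnd: "norm ((q - 1) * \<bar>t\<bar> powr (q - 2)) \<le> L" if "\<bar>t\<bar> \<le> 2 * M" for t
  proof -
    have "\<bar>t\<bar> powr (q - 2) \<le> (2 * M) powr (q - 2)" using that q by (intro powr_mono2) auto
    then have "(q - 1) * \<bar>t\<bar> powr (q - 2) \<le> L" unfolding L_def using q by (intro mult_left_mono) auto
    moreover have "(q - 1) * \<bar>t\<bar> powr (q - 2) \<ge> 0" using q by simp
    ultimately show ?thesis by simp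
  qed
  have lip: "norm (\<psi> s - \<psi> t) \<le> L * norm (s - t)" if st: "\<bar>s\<bar> \<le> 2 * M" "\<bar>t\<bar> \<le> 2 * M" for s t
  proof (rule field_differentiable_bound[where S="{-(2*M)..2*M}" and f=\<psi> and f'="\<lambda>t. (q - 1) * \<bar>t\<bar> powr (q - 2)"])
    show "(\<psi> has_real_derivative (q - 1) * \<bar>t\<bar> powr (q - 2)) (at t within {-(2*M)..2*M})" for t
      by (rule has_field_derivative_at_within[OF d\<psi>])
    show "norm ((q - 1) * \<bar>t\<bar> powr (q - 2)) \<le> L" if "t \<in> {-(2*M)..2*M}" for t
      by (rule bnd) (use that in \<open>simp add: abs_le_iff\<close>)
    show "s \<in> {-(2*M)..2*M}" "t \<in> {-(2*M)..2*M}" using st by (simp_all add: abs_le_iff)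
  qed simp
  have h: "((\<lambda>s. \<bar>f + s\<bar> powr q - \<bar>s\<bar> powr q) has_real_derivative q * (\<psi> (f + s) - \<psi> s)) (at s)" for s
  proof -
    have "((\<lambda>s. \<bar>f + s\<bar> powr q) has_real_derivative (q * \<psi> (f + s)) * (0 + 1)) (at s)"
      unfolding \<psi>_def using q by (intro DERIV_chain2[OF abs_powr_has_derivative(1)] DERIV_add DERIV_const DERIV_ident) simp
    moreover have "((\<lambda>s. \<bar>s\<bar> powr q) has_real_derivative q * \<psi> s) (at s)"
      unfolding \<psi>_def using q by (intro abs_powr_has_derivative(1)) simp
    ultimately have "((\<lambda>s. \<bar>f + s\<bar> powr q - \<bar>s\<bar> powr q) has_real_derivative (q * \<psi> (f + s)) * (0 + 1) - q * \<psi> s) (at s)"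
      by (rule DERIV_diff)
    then show ?thesis by (simp add: right_diff_distrib)
  qed
  have "norm ((\<bar>f + v\<bar> powr q - \<bar>v\<bar> powr q) - (\<bar>f + 0\<bar> powr q - \<bar>0\<bar> powr q)) \<le> (q * (L * \<bar>f\<bar>)) * norm (v - 0)"
  proof (rule field_differentiable_bound[where S="{-M..M}" and f="\<lambda>s. \<bar>f + s\<bar> powr q - \<bar>s\<bar> powr q" and f'="\<lambda>s. q * (\<psi> (f + s) - \<psi> s)"])
    fix s assume s: "s \<in> {-M..M}"
    show "((\<lambda>s. \<bar>f + s\<bar> powr q - \<bar>s\<bar> powr q) has_real_derivative q * (\<psi> (f + s) - \<psi> s)) (at s within {-M..M})"
      by (rule has_field_derivative_at_within[OF h])
    have sM: "\<bar>s\<bar> \<le> M" using s by (simp add: abs_le_iff)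
    then have "\<bar>f + s\<bar> \<le> 2 * M" "\<bar>s\<bar> \<le> 2 * M" using M abs_triangle_ineq[of f s] abs_ge_zero[of s] by linarith+
    then have "norm (\<psi> (f + s) - \<psi> s) \<le> L * norm (f + s - s)" by (rule lip)
    then have "q * norm (\<psi> (f + s) - \<psi> s) \<le> q * (L * \<bar>f\<bar>)" using q by (intro mult_left_mono) auto
    then show "norm (q * (\<psi> (f + s) - \<psi> s)) \<le> q * (L * \<bar>f\<bar>)" using q by (simp add: abs_mult)
  next
    show "v \<in> {-M..M}" "0 \<in> {-M..M}" using M abs_ge_zero[of f] by (simp_all add: abs_le_iff)
  qed simp
  then have "\<bar>\<bar>f + v\<bar> powr q - \<bar>f\<bar> powr q - \<bar>v\<bar> powr q\<bar> \<le> (q * (L * \<bar>f\<bar>)) * \<bar>v\<bar>" using q by (simp add: diff_diff_eq add.commute)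
  also have "\<dots> = q * (q - 1) * (2 * M) powr (q - 2) * \<bar>f * v\<bar>" by (simp add: L_def abs_mult)
  finally show ?thesis .
qed

section \<open>Translated minimizing sequences\<close>

definition pot :: "(real \<Rightarrow> real) \<Rightarrow> real \<Rightarrow> (real \<Rightarrow> real) \<Rightarrow> real" where
  "pot G p u = (LINT x|lebesgue. G x * \<bar>u x\<bar> powr (p + 1))"

text \<open>This is where \<open>p > 1\<close> counts: on small values the nonlinearity is a
  multiple of the square, with a factor that tends to zero with \<open>M\<close>.\<close>

lemma abs_powr_le_square:
  assumes "p > (1::real)" "\<bar>a\<bar> \<le> M"
  shows "\<bar>a\<bar> powr (p + 1) \<le> M powr (p - 1) * a\<^sup>2"
proof -
  have "\<bar>a\<bar> powr (p + 1) = \<bar>a\<bar> powr (p - 1) * \<bar>a\<bar> powr 2"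
    by (subst powr_add[symmetric]) (simp add: add.commute)
  also have "\<bar>a\<bar> powr 2 = a\<^sup>2" by (cases "a = 0") (simp_all flip: powr_realpow)
  also have "\<bar>a\<bar> powr (p - 1) * a\<^sup>2 \<le> M powr (p - 1) * a\<^sup>2"
    using assms by (intro mult_right_mono powr_mono2) auto
  finally show ?thesis .
qed

lemma powr_integrable:
  fixes u :: "real \<Rightarrow> real"
  assumes p: "p > 1" and u: "u \<in> L2" and M: "\<And>x. \<bar>u x\<bar> \<le> M"
  shows "integrable lebesgue (\<lambda>x. \<bar>u x\<bar> powr (p + 1))"
proof (rule Bochner_Integration.integrable_bound)
  show "integrable lebesgue (\<lambda>x. M powr (p - 1) * (u x)\<^sup>2)" using L2_D[OF u] by simp
  show "(\<lambda>x. \<bar>u x\<bar> powr (p + 1)) \<in> borel_measurable lebesgue"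
    using L2_D(1)[OF u] by measurable
  show "AE x in lebesgue. norm (\<bar>u x\<bar> powr (p + 1)) \<le> norm (M powr (p - 1) * (u x)\<^sup>2)"
    using abs_powr_le_square[OF p M] by (intro AE_I2) simp
qed

lemma H1_abs_bound:
  assumes "P \<in> H1" "nsq (snd P) + nsq (fst P) \<le> A" shows "\<bar>fst P x\<bar> \<le> sqrt A"
  using real_sqrt_le_mono[OF order_trans[OF H1_pointwise_nsq[OF assms(1)] assms(2)], of x] by simp

lemma H1_powr_integrable: "p > 1 \<Longrightarrow> P \<in> H1 \<Longrightarrow> integrable lebesgue (\<lambda>x. \<bar>fst P x\<bar> powr (p + 1))"
  using powr_integrable[of p "fst P"] H1_abs_bound[of P] H1_D by blast

lemma tendsto_mult_weight:
  assumes q: "\<And>n::nat. q n \<in> L_infinity" "\<And>n. AE x in lebesgue. \<bar>q n x\<bar> \<le> K" "\<And>x. (\<lambda>n. q n x) \<longlonglongrightarrow> Q x"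
    and Q: "Q \<in> L_infinity" and w: "integrable lebesgue w"
  shows "(\<lambda>n. LINT x|lebesgue. q n x * w x) \<longlonglongrightarrow> (LINT x|lebesgue. Q x * w x)"
proof (rule integral_dominated_convergence)
  show "integrable lebesgue (\<lambda>x. K * \<bar>w x\<bar>)" using w by simp
  show "(\<lambda>x. Q x * w x) \<in> borel_measurable lebesgue" "(\<lambda>x. q n x * w x) \<in> borel_measurable lebesgue" for n
    using L_infinity_mult_integrable[OF Q w] L_infinity_mult_integrable[OF q(1) w] by auto
  show "AE x in lebesgue. (\<lambda>n. q n x * w x) \<longlonglongrightarrow> Q x * w x" by (intro AE_I2 tendsto_intros q)
  show "AE x in lebesgue. norm (q n x * w x) \<le> K * \<bar>w x\<bar>" for n
    using q(2)[of n] by eventually_elim (auto simp: abs_mult intro: mult_right_mono)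
qed

lemma form_tendsto:
  assumes q: "\<And>n::nat. q n \<in> L_infinity" "\<And>n. AE x in lebesgue. \<bar>q n x\<bar> \<le> K" "\<And>x. (\<lambda>n. q n x) \<longlonglongrightarrow> Q x"
    and Q: "Q \<in> L_infinity" and P: "P \<in> H1"
  shows "(\<lambda>n. form (q n) P) \<longlonglongrightarrow> form Q P"
  unfolding bil_split[OF q(1) P P] bil_split[OF Q P P]
  by (intro tendsto_intros tendsto_mult_weight[OF q Q] L2_mult_integrable H1_D P)

text \<open>Here \<theta> and \<open>N\<close> are the values of \<open>pot\<close> and of the form
  at a nonzero weak limit, while \<open>1 - \<theta>\<close> and \<open>S - N\<close> belong to the
  remainder. As \<open>G\<close> may change sign, \<theta> is a priori any real number. The case
  \<theta> \<le> 0 contradicts \<open>N > 0\<close>. For 0 < \<theta> < 1 both \<theta> and 1 -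
  \<theta> increase strictly under the power \<alpha>, and the sum of the two inequalities fails.
  For \<theta> \<ge> 1 the first inequality gives \<open>N \<le> S\<close> and the second then
  \<theta> \<le> 1.\<close>

lemma subadditivity_trap:
  assumes S: "S > 0" and a: "0 < \<alpha>" "\<alpha> < 1" and N: "N > (0::real)"
    and 1: "S * (max 0 (1 - \<theta>)) powr \<alpha> \<le> S - N" and 2: "S * (max 0 \<theta>) powr \<alpha> \<le> N"
  shows "\<theta> = 1 \<and> N = S"
proof -
  have th: "\<theta> > 0"
  proof (rule ccontr)
    assume "\<not> \<theta> > 0"
    then have "1 powr \<alpha> \<le> (max 0 (1 - \<theta>)) powr \<alpha>" using a by (intro powr_mono2) auto
    then have "S * 1 \<le> S * (max 0 (1 - \<theta>)) powr \<alpha>" using S by (intro mult_left_mono) auto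
    then show False using 1 N by simp
  qed
  have gt: "x < x powr \<alpha>" if "0 < x" "x < 1" for x
    using powr_less_mono'[of x \<alpha> 1] that a by simp
  have "\<not> \<theta> < 1"
  proof
    assume l: "\<theta> < 1"
    have "S * \<theta> + S * (1 - \<theta>) < S * \<theta> powr \<alpha> + S * (1 - \<theta>) powr \<alpha>"
      using S gt[of \<theta>] gt[of "1 - \<theta>"] th l by (intro add_strict_mono mult_strict_left_mono) auto
    also have "\<dots> \<le> S" using 1 2 th l by simp
    finally show False by (simp add: algebra_simps)
  qed
  then have g1: "\<theta> \<ge> 1" by simp
  then have NS: "N \<le> S" using 1 a by (simp add: max_def split: if_splits)
  have t2: "S * \<theta> powr \<alpha> \<le> N" using 2 th by simp
  have "\<theta> powr \<alpha> \<le> 1" using t2 NS S by (metis mult.right_neutral mult_le_cancel_left_pos order_trans)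
  then have "\<theta> \<le> 1" using powr_less_mono2[OF a(1), of 1 \<theta>] a(1) g1 by (metis less_eq_real_def not_less powr_less_mono2 zero_le_one powr_one_eq_one)
  then have "\<theta> = 1" using g1 by simp
  then show ?thesis using t2 NS by simp
qed

text \<open>The coefficients \<open>q n\<close> and \<open>G n\<close> are meant to be translates of
  the interface coefficients, and \<open>Q\<close>, \<open>GG\<close> their limits, which are either
  a fixed translate or one of the two periodic problems. The points \<open>z n\<close>, where
  \<open>X n\<close> stays away from zero in a fixed interval, prevent a zero limit. Form and
  \<open>pot\<close> then split into the parts of the limit and of the remainder, up to vanishing
  errors, and \<open>subadditivity_trap\<close> leaves nothing to the remainder.\<close>

lemma translated_minimizing_sequence:
  fixes q G :: "nat \<Rightarrow> real \<Rightarrow> real" and Q GG :: "real \<Rightarrow> real"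
  assumes p: "p > 1" and K: "K \<ge> 0"
    and q: "\<And>n. q n \<in> L_infinity" "\<And>n. AE x in lebesgue. \<bar>q n x\<bar> \<le> K" "\<And>x. (\<lambda>n. q n x) \<longlonglongrightarrow> Q x"
    and Q: "Q \<in> L_infinity" "AE x in lebesgue. \<bar>Q x\<bar> \<le> K"
    and G: "\<And>n. G n \<in> L_infinity" "\<And>n. AE x in lebesgue. \<bar>G n x\<bar> \<le> K" "\<And>x. (\<lambda>n. G n x) \<longlonglongrightarrow> GG x"
    and GG: "GG \<in> L_infinity"
    and \<delta>: "\<delta> > 0" "\<And>n P. P \<in> H1 \<Longrightarrow> \<delta> * nsq (fst P) \<le> form (q n) P"
    and S: "S > 0" "\<And>n P. P \<in> H1 \<Longrightarrow> S * (max 0 (pot (G n) p (fst P))) powr (2 / (p + 1)) \<le> form (q n) P"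
    and X: "\<And>n. X n \<in> H1" "\<And>n. pot (G n) p (fst (X n)) = 1" "(\<lambda>n. form (q n) (X n)) \<longlonglongrightarrow> S"
    and z: "\<And>n. z n \<in> {0..1}" "\<And>n. \<epsilon> \<le> \<bar>fst (X n) (z n)\<bar>" "\<epsilon> > 0" "z \<longlonglongrightarrow> z0"
    and \<phi>: "\<And>x. (\<lambda>n. fst (X n) x) \<longlonglongrightarrow> \<phi> x"
  shows "\<exists>y\<in>H1. pot GG p (fst y) = 1 \<and> form Q y = S"
proof -
  define \<alpha> where "\<alpha> = 2 / (p + 1)"
  have \<alpha>: "0 < \<alpha>" "\<alpha> < 1" using p by (auto simp: \<alpha>_def)
  have flim: "(\<lambda>n. form (q n) P) \<longlonglongrightarrow> form Q P" if "P \<in> H1" for P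
    using form_tendsto[OF q Q(1) that] .
  have plim: "(\<lambda>n. pot (G n) p (fst P)) \<longlonglongrightarrow> pot GG p (fst P)" if "P \<in> H1" for P
    unfolding pot_def by (intro tendsto_mult_weight[OF G GG] H1_powr_integrable p that)
  have powr_lim: "(\<lambda>n. S * (max 0 (f n)) powr \<alpha>) \<longlonglongrightarrow> S * (max 0 l) powr \<alpha>" if "f \<longlonglongrightarrow> l" for f l
    using \<alpha> by (intro tendsto_mult tendsto_const tendsto_powr' tendsto_max that) auto
  have \<delta>Q: "\<delta> * nsq (fst P) \<le> form Q P" if "P \<in> H1" for P
    using \<delta>(2)[OF that] by (intro LIMSEQ_le_const[OF flim[OF that]]) auto
  have SQ: "S * (max 0 (pot GG p (fst P))) powr \<alpha> \<le> form Q P" if "P \<in> H1" for P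
    using S(2)[OF that] by (intro LIMSEQ_le[OF powr_lim[OF plim[OF that]] flim[OF that]]) (auto simp: \<alpha>_def)
  define c where "c = 1 + (K + 1) / \<delta>"
  have c: "c > 0" using K \<delta>(1) by (simp add: c_def add_pos_nonneg)
  have co: "nsq (snd P) + nsq (fst P) \<le> c * form (q n) P" if "P \<in> H1" for P n
    unfolding c_def by (rule coercive[OF q(1,2) K \<delta>(1) \<delta>(2)[OF that] that])
  have coQ: "nsq (snd P) + nsq (fst P) \<le> c * form Q P" if "P \<in> H1" for P
    unfolding c_def by (rule coercive[OF Q K \<delta>(1) \<delta>Q[OF that] that])
  have formQ_nn: "form Q P \<ge> 0" if "P \<in> H1" for P
    using \<delta>Q[OF that] \<delta>(1) nsq_nonneg[of "fst P"] by (meson less_imp_le mult_nonneg_nonneg order_trans)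
  obtain F where F: "\<And>n. form (q n) (X n) \<le> F"
  proof -
    have "Bseq (\<lambda>n. form (q n) (X n))" using X(3) convergent_imp_Bseq convergentI by blast
    then obtain F where "\<And>n. norm (form (q n) (X n)) \<le> F" by (auto simp: Bseq_def)
    then have "form (q n) (X n) \<le> F" for n by (metis abs_le_D1 real_norm_def)
    then show ?thesis using that by blast
  qed
  define A where "A = c * F"
  have A: "nsq (snd (X n)) + nsq (fst (X n)) \<le> A" for n
    using co[OF X(1), of n n] F[of n] c unfolding A_def by (meson less_imp_le mult_left_mono order_trans)
  have A1: "nsq (snd (X n)) \<le> A" "nsq (fst (X n)) \<le> A" for n
    using A[of n] nsq_nonneg[of "snd (X n)"] nsq_nonneg[of "fst (X n)"] by linarith+
  have A0: "A \<ge> 0" using A1(1)[of 0] nsq_nonneg[of "snd (X 0)"] by linarith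
  \<comment> \<open>The Hilbert space structure is that of the limit form \<open>Q\<close>, whereas
    \<open>X n\<close> is measured by \<open>q n\<close>; the discrepancy is estimated further
    below.\<close>
  have "\<exists>y\<in>H1. \<exists>Y. (\<forall>n. Y n \<in> convex hull (X ` {n..})) \<and> (\<lambda>n. bil Q (Y n - y) (Y n - y)) \<longlonglongrightarrow> 0 \<and>
    (\<forall>e>0. \<forall>\<^sub>F n in sequentially. bil Q y y - e \<le> bil Q y (X n))"
  proof (rule near_minimal_hull_points[OF H1_subspace])
    show "bil Q (x + y) z = bil Q x z + bil Q y z" if "x \<in> H1" "y \<in> H1" "z \<in> H1" for x y z
      by (rule bil_add_left[OF Q(1) that])
    show "form Q (X n) \<le> A + K * A" for n
      using form_upper[OF Q X(1), of n] A1[of n] K by (meson add_mono mult_left_mono order_trans)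
    show "\<exists>y\<in>H1. (\<lambda>n. form Q (Y n - y)) \<longlonglongrightarrow> 0"
      if "\<And>n. Y n \<in> H1" "\<And>e. e > 0 \<Longrightarrow> \<exists>N. \<forall>m\<ge>N. \<forall>n\<ge>N. form Q (Y m - Y n) < e" for Y
      by (rule H1_complete[OF c Q(1) coQ that])
  qed (use bil_scale_left bil_commute formQ_nn X(1) in auto)
  then obtain y Y where y: "y \<in> H1" "\<And>n. Y n \<in> convex hull (X ` {n..})" "(\<lambda>n. form Q (Y n - y)) \<longlonglongrightarrow> 0"
    and ylow: "\<And>e. e > 0 \<Longrightarrow> \<forall>\<^sub>F n in sequentially. form Q y - e \<le> bil Q y (X n)" by blast
  have YH: "Y n \<in> H1" for n
  proof -
    have "convex hull (X ` {n..}) \<subseteq> H1" using X(1) subspace_imp_convex[OF H1_subspace] by (intro hull_minimal) auto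
    then show ?thesis using y(2) by blast
  qed
  \<comment> \<open>Balls are convex, so convex combinations of late terms still converge to \<phi>
    at each point; on the other hand convergence in the form implies pointwise convergence to
    \<open>y\<close>.\<close>
  have y\<phi>: "fst y x = \<phi> x" for x
  proof -
    have "(\<lambda>n. fst (Y n) x) \<longlonglongrightarrow> \<phi> x"
    proof (rule LIMSEQ_I)
      fix e :: real assume e: "e > 0"
      obtain N where N: "\<forall>n\<ge>N. norm (fst (X n) x - \<phi> x) < e" using LIMSEQ_D[OF \<phi> e] by blast
      have "norm (fst (Y n) x - \<phi> x) < e" if "n \<ge> N" for n
      proof -
        have "convex {P :: (real \<Rightarrow> real) \<times> (real \<Rightarrow> real). \<bar>fst P x - \<phi> x\<bar> < e}"
        proof (rule convexI)
          fix P P' :: "(real \<Rightarrow> real) \<times> (real \<Rightarrow> real)" and u v :: real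
          assume a: "P \<in> {P. \<bar>fst P x - \<phi> x\<bar> < e}" "P' \<in> {P. \<bar>fst P x - \<phi> x\<bar> < e}" "0 \<le> u" "0 \<le> v" "u + v = 1"
          have "fst P x \<in> ball (\<phi> x) e" "fst P' x \<in> ball (\<phi> x) e" using a by (auto simp: dist_real_def)
          then have "u *\<^sub>R fst P x + v *\<^sub>R fst P' x \<in> ball (\<phi> x) e" using convexD[OF convex_ball] a by blast
          then show "u *\<^sub>R P + v *\<^sub>R P' \<in> {P. \<bar>fst P x - \<phi> x\<bar> < e}" by (simp add: dist_real_def)
        qed
        moreover have "X ` {n..} \<subseteq> {P. \<bar>fst P x - \<phi> x\<bar> < e}" using N that by auto
        ultimately have "convex hull (X ` {n..}) \<subseteq> {P. \<bar>fst P x - \<phi> x\<bar> < e}" by (intro hull_minimal) auto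
        then show ?thesis using y(2)[of n] by auto
      qed
      then show "\<exists>N. \<forall>n\<ge>N. norm (fst (Y n) x - \<phi> x) < e" by blast
    qed
    moreover have "(\<lambda>n. fst (Y n) x) \<longlonglongrightarrow> fst y x"
    proof -
      have "(\<lambda>n. (fst (Y n) x - fst y x)\<^sup>2) \<longlonglongrightarrow> 0"
      proof (rule tendsto_sandwich[of "\<lambda>n. 0"])
        have "(fst (Y n) x - fst y x)\<^sup>2 \<le> c * form Q (Y n - y)" for n
          using order_trans[OF H1_pointwise_nsq coQ, OF H1_diff H1_diff, OF YH y(1) YH y(1), of n x] by simp
        then show "\<forall>\<^sub>F n in sequentially. (fst (Y n) x - fst y x)\<^sup>2 \<le> c * form Q (Y n - y)" by simp
        show "(\<lambda>n. c * form Q (Y n - y)) \<longlonglongrightarrow> 0" using tendsto_mult_left[OF y(3), of c] by simp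
      qed auto
      then have "(\<lambda>n. fst (Y n) x - fst y x) \<longlonglongrightarrow> 0" by (simp add: power_tendsto_0_iff)
      then show ?thesis by (simp add: LIM_zero_iff)
    qed
    ultimately show ?thesis using LIMSEQ_unique by blast
  qed
  \<comment> \<open>Otherwise \<open>y\<close> vanishes at \<open>z0\<close>, so
    \<open>fst (X n) z0\<close> tends to zero, and by equicontinuity \<open>fst (X n) (z n)\<close>
    becomes smaller than \<epsilon>.\<close>
  have pos: "form Q y > 0"
  proof (rule ccontr)
    assume "\<not> form Q y > 0"
    then have "form Q y = 0" using formQ_nn[OF y(1)] by simp
    then have v0: "fst y z0 = 0" using order_trans[OF H1_pointwise_nsq[OF y(1), of z0] coQ[OF y(1)]] by simp
    define s where "s = 4 * (A + 1) / \<epsilon>"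
    have s: "s > 0" using A0 z(3) by (simp add: s_def)
    have As: "A / s \<le> \<epsilon> / 4" using A0 z(3) by (simp add: s_def field_simps)
    have "\<forall>\<^sub>F n in sequentially. \<bar>z n - z0\<bar> < \<epsilon> / (4 * s)"
      using tendstoD[OF z(4), of "\<epsilon> / (4 * s)"] z(3) s by (simp add: dist_real_def)
    moreover have "\<forall>\<^sub>F n in sequentially. \<bar>fst (X n) z0\<bar> < \<epsilon> / 4"
      using tendstoD[OF \<phi>[of z0], of "\<epsilon> / 4"] z(3) v0 y\<phi>[of z0] by (simp add: dist_real_def)
    ultimately have "\<forall>\<^sub>F n in sequentially. False"
    proof eventually_elim
      case (elim n)
      have inc: "\<bar>fst (X n) (z n) - fst (X n) z0\<bar> \<le> s * \<bar>z n - z0\<bar> + nsq (snd (X n)) / s"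
        using H1_increment[OF X(1) _ s, of "z n" z0 n] H1_increment[OF X(1) _ s, of z0 "z n" n]
        by (cases "z n \<le> z0") (auto simp: abs_minus_commute abs_if split: if_splits)
      have "s * \<bar>z n - z0\<bar> \<le> s * (\<epsilon> / (4 * s))" using elim(1) s by (intro mult_left_mono) auto
      then have "s * \<bar>z n - z0\<bar> \<le> \<epsilon> / 4" using s by simp
      moreover have "nsq (snd (X n)) / s \<le> A / s" using A1[of n] s by (intro divide_right_mono) auto
      ultimately show False using inc As elim(2) z(2)[of n] z(3) by linarith
    qed
    then show False by simp
  qed
  define f where "f n x = fst (X n) x - fst y x" for n x
  have DH: "X n - y \<in> H1" for n using X(1) y(1) H1_diff by blast
  have fD: "f n = fst (X n - y)" for n by (simp add: f_def fun_eq_iff)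
  have fL: "f n \<in> L2" for n unfolding fD using H1_D(2)[OF DH] .
  have yL: "fst y \<in> L2" using H1_D y(1) by blast
  have f0: "(\<lambda>n. f n x) \<longlonglongrightarrow> 0" for x
    unfolding f_def using \<phi>[of x] y\<phi>[of x] by (simp add: LIM_zero)
  have nf: "nsq (f n) \<le> 2 * A + 2 * nsq (fst y)" for n
  proof -
    have XL: "fst (X n) \<in> L2" using H1_D X(1) by blast
    have "nsq (f n) \<le> (LINT x|lebesgue. 2 * (fst (X n) x)\<^sup>2 + 2 * (fst y x)\<^sup>2)"
      unfolding nsq_def
    proof (rule integral_mono)
      show "(f n x)\<^sup>2 \<le> 2 * (fst (X n) x)\<^sup>2 + 2 * (fst y x)\<^sup>2" for x
        using zero_le_power2[of "fst (X n) x + fst y x"] by (simp add: f_def power2_diff power2_sum)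
    qed (use L2_D[OF XL] L2_D[OF yL] L2_D[OF fL] in auto)
    also have "\<dots> = 2 * nsq (fst (X n)) + 2 * nsq (fst y)" using L2_D[OF XL] L2_D[OF yL] by (simp add: nsq_def)
    finally show ?thesis using A1(2)[of n] by linarith
  qed
  define I where "I n = (LINT x|lebesgue. \<bar>f n x * fst y x\<bar>)" for n
  have I0: "I \<longlonglongrightarrow> 0" unfolding I_def using bounded_mult_weak_0[OF fL nf f0 yL] .
  have fyi: "integrable lebesgue (\<lambda>x. \<bar>f n x * fst y x\<bar>)" for n using L2_mult_integrable[OF fL yL] by simp
  define J where "J n = (LINT x|lebesgue. q n x * (fst y x * fst y x)) - (LINT x|lebesgue. Q x * (fst y x * fst y x))" for n
  have J0: "J \<longlonglongrightarrow> 0"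
    unfolding J_def using tendsto_mult_weight[OF q Q(1) L2_mult_integrable[OF yL yL]] by (simp add: LIM_zero)
  \<comment> \<open>Replacing \<open>q n\<close> by \<open>Q\<close> in the product with
    \<open>X n = f n + y\<close> costs at most \<open>K * I n\<close> for each of the two potentials
    on the part \<open>f n\<close>, and \<open>J n\<close> on the part \<open>y\<close>.\<close>
  have bil_low: "bil (q n) (X n) y \<ge> bil Q (X n) y - 2 * (K * I n) - \<bar>J n\<bar>" for n
  proof -
    have i: "integrable lebesgue (\<lambda>x. q n x * (f n x * fst y x))" "integrable lebesgue (\<lambda>x. Q x * (f n x * fst y x))"
      "integrable lebesgue (\<lambda>x. q n x * (fst y x * fst y x))" "integrable lebesgue (\<lambda>x. Q x * (fst y x * fst y x))"
      using L_infinity_mult_integrable q(1) Q(1) L2_mult_integrable fL yL by blast+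
    have e: "(LINT x|lebesgue. r x * (fst (X n) x * fst y x)) = (LINT x|lebesgue. r x * (f n x * fst y x)) + (LINT x|lebesgue. r x * (fst y x * fst y x))"
      if "integrable lebesgue (\<lambda>x. r x * (f n x * fst y x))" "integrable lebesgue (\<lambda>x. r x * (fst y x * fst y x))" for r
      unfolding f_def by (subst Bochner_Integration.integral_add[symmetric]) (use that in \<open>auto simp: f_def algebra_simps\<close>)
    have bnd: "\<bar>LINT x|lebesgue. r x * (f n x * fst y x)\<bar> \<le> K * I n"
      if "integrable lebesgue (\<lambda>x. r x * (f n x * fst y x))" "AE x in lebesgue. \<bar>r x\<bar> \<le> K" for r
    proof -
      have "\<bar>LINT x|lebesgue. r x * (f n x * fst y x)\<bar> \<le> (LINT x|lebesgue. \<bar>r x * (f n x * fst y x)\<bar>)"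
        using integral_norm_bound[of lebesgue "\<lambda>x. r x * (f n x * fst y x)"] by simp
      also have "\<dots> \<le> (LINT x|lebesgue. K * \<bar>f n x * fst y x\<bar>)"
      proof (rule integral_mono_AE)
        show "AE x in lebesgue. \<bar>r x * (f n x * fst y x)\<bar> \<le> K * \<bar>f n x * fst y x\<bar>"
          using that(2) by eventually_elim (subst abs_mult, intro mult_right_mono, auto)
      qed (use that(1) fyi in auto)
      finally show ?thesis by (simp add: I_def)
    qed
    have "bil (q n) (X n) y - bil Q (X n) y = (LINT x|lebesgue. q n x * (f n x * fst y x)) - (LINT x|lebesgue. Q x * (f n x * fst y x)) + J n"
      unfolding bil_split[OF q(1) X(1) y(1)] bil_split[OF Q(1) X(1) y(1)] e[OF i(1,3)] e[OF i(2,4)] J_def by simp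
    then show ?thesis using bnd[OF i(1) q(2)] bnd[OF i(2) Q(2)] by linarith
  qed
  have formD: "form (q n) (X n - y) = form (q n) (X n) - 2 * bil (q n) (X n) y + form (q n) y" for n
    using form_add_scale[OF q(1) X(1) y(1), of n n "-1"] by simp
  have Dlow: "\<forall>\<^sub>F n in sequentially. form (q n) (X n - y) \<le> S - form Q y + e" if e: "e > 0" for e
  proof -
    have "(\<lambda>n. form (q n) (X n) + 4 * (K * I n) + 2 * \<bar>J n\<bar> + form (q n) y) \<longlonglongrightarrow> S + 4 * (K * 0) + 2 * \<bar>0\<bar> + form Q y"
      by (intro tendsto_intros X(3) I0 J0 flim y(1))
    then have "\<forall>\<^sub>F n in sequentially. form (q n) (X n) + 4 * (K * I n) + 2 * \<bar>J n\<bar> + form (q n) y < S + form Q y + e / 2"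
      by (rule order_tendstoD(2)) (use e in simp)
    moreover have "\<forall>\<^sub>F n in sequentially. form Q y - e / 4 \<le> bil Q y (X n)" using ylow[of "e / 4"] e by simp
    ultimately show ?thesis
    proof eventually_elim
      case (elim n)
      then show ?case using formD[of n] bil_low[of n] bil_commute[of Q y "X n"] by linarith
    qed
  qed
  \<comment> \<open>All functions involved are bounded by the same \<open>M\<close>, so the
    splitting constant \<open>C\<close> does not depend on \<open>n\<close> and the defect is at
    most \<open>K * C * I n\<close>.\<close>
  have potD: "(\<lambda>n. pot (G n) p (f n)) \<longlonglongrightarrow> 1 - pot GG p (fst y)"
  proof -
    define M where "M = sqrt A + sqrt (nsq (snd y) + nsq (fst y))"
    have yM: "\<bar>fst y x\<bar> \<le> M" for x using H1_abs_bound[OF y(1) order_refl, of x] A0 by (simp add: M_def add_increasing)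
    have fM: "\<bar>f n x\<bar> \<le> M" for n x
      using H1_abs_bound[OF X(1) A, of n x] H1_abs_bound[OF y(1) order_refl, of x] unfolding f_def M_def by linarith
    define C where "C = (p + 1) * (p + 1 - 1) * (2 * M) powr (p + 1 - 2)"
    have split: "\<bar>\<bar>fst (X n) x\<bar> powr (p + 1) - \<bar>f n x\<bar> powr (p + 1) - \<bar>fst y x\<bar> powr (p + 1)\<bar> \<le> C * \<bar>f n x * fst y x\<bar>" for n x
      using abs_powr_splitting[of "p + 1" "f n x" M "fst y x"] p fM[of n x] yM[of x] unfolding C_def f_def by simp
    have "\<bar>1 - pot (G n) p (f n) - pot (G n) p (fst y)\<bar> \<le> K * C * I n" for n
    proof -
      have i: "integrable lebesgue (\<lambda>x. \<bar>fst (X n) x\<bar> powr (p + 1))" "integrable lebesgue (\<lambda>x. \<bar>f n x\<bar> powr (p + 1))" "integrable lebesgue (\<lambda>x. \<bar>fst y x\<bar> powr (p + 1))"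
        unfolding fD by (intro H1_powr_integrable p X(1) y(1) DH)+
      note ig = i[THEN L_infinity_mult_integrable[OF G(1)[of n]]]
      define h where "h x = \<bar>fst (X n) x\<bar> powr (p + 1) - \<bar>f n x\<bar> powr (p + 1) - \<bar>fst y x\<bar> powr (p + 1)" for x
      have hi: "integrable lebesgue (\<lambda>x. G n x * h x)"
        unfolding h_def right_diff_distrib using ig by (intro Bochner_Integration.integrable_diff)
      have "pot (G n) p (fst (X n)) - pot (G n) p (f n) - pot (G n) p (fst y) = (LINT x|lebesgue. G n x * h x)"
        unfolding pot_def h_def right_diff_distrib using ig by simp
      also have "\<bar>\<dots>\<bar> \<le> (LINT x|lebesgue. norm (G n x * h x))"
        using integral_norm_bound[of lebesgue "\<lambda>x. G n x * h x"] by (simp only: real_norm_def)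
      also have "\<dots> \<le> (LINT x|lebesgue. K * C * \<bar>f n x * fst y x\<bar>)"
      proof (rule integral_mono_AE)
        show "integrable lebesgue (\<lambda>x. norm (G n x * h x))" using hi by (rule integrable_norm)
        show "integrable lebesgue (\<lambda>x. K * C * \<bar>f n x * fst y x\<bar>)" using fyi by (intro integrable_mult_right)
        show "AE x in lebesgue. norm (G n x * h x) \<le> K * C * \<bar>f n x * fst y x\<bar>"
          using G(2)[of n]
        proof eventually_elim
          case (elim x)
          have "\<bar>h x\<bar> \<le> C * \<bar>f n x * fst y x\<bar>" using split[of n x] unfolding h_def .
          then have "\<bar>G n x\<bar> * \<bar>h x\<bar> \<le> K * (C * \<bar>f n x * fst y x\<bar>)"
            by (intro mult_mono elim K abs_ge_zero)
          then show ?case by (simp only: real_norm_def abs_mult mult.assoc)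
        qed
      qed
      also have "\<dots> = K * C * I n" unfolding I_def by (rule integral_mult_right_zero)
      finally show ?thesis unfolding X(2) .
    qed
    then have le: "norm (1 - pot (G n) p (f n) - pot (G n) p (fst y)) \<le> K * C * I n" for n
      unfolding real_norm_def .
    have "(\<lambda>n. K * C * I n) \<longlonglongrightarrow> K * C * 0" by (rule tendsto_mult_left[OF I0])
    then have "(\<lambda>n. K * C * I n) \<longlonglongrightarrow> 0" by (simp only: mult_zero_right)
    then have "(\<lambda>n. 1 - pot (G n) p (f n) - pot (G n) p (fst y)) \<longlonglongrightarrow> 0"
      by (rule Lim_null_comparison[OF always_eventually[OF allI[OF le]]])
    from tendsto_diff[OF tendsto_diff[OF tendsto_const[of 1] this] plim[OF y(1)]]
    show ?thesis by simp
  qed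
  have "S * (max 0 (1 - pot GG p (fst y))) powr \<alpha> \<le> S - form Q y + e" if "e > 0" for e
  proof (rule tendsto_le[OF sequentially_bot tendsto_const powr_lim[OF potD]])
    show "\<forall>\<^sub>F n in sequentially. S * (max 0 (pot (G n) p (f n))) powr \<alpha> \<le> S - form Q y + e"
      using Dlow[OF that]
    proof eventually_elim
      case (elim n) then show ?case using S(2)[OF DH, of n n] by (simp add: \<alpha>_def fD)
    qed
  qed
  then have "S * (max 0 (1 - pot GG p (fst y))) powr \<alpha> \<le> S - form Q y" by (rule field_le_epsilon)
  then have "pot GG p (fst y) = 1 \<and> form Q y = S"
    using subadditivity_trap[OF S(1) \<alpha> pos _ SQ[OF y(1)]] by blast
  then show ?thesis using y(1) by blast
qed

section \<open>The competitor with a Bloch tail\<close>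

lemma periodic_int:
  fixes g :: "real \<Rightarrow> 'a"
  assumes "\<And>x. g (x + 1) = g x" shows "g (x + of_int k) = g x"
proof -
  have nat: "g (x + real n) = g x" for n x
  proof (induction n)
    case (Suc n)
    have "g (x + real (Suc n)) = g (x + real n + 1)" by (simp add: algebra_simps)
    then show ?case using Suc assms by simp
  qed simp
  show ?thesis
  proof (cases "k \<ge> 0")
    case True then show ?thesis using nat[of x "nat k"] by simp
  next
    case False then show ?thesis using nat[of "x + of_int k" "nat (- k)"] by simp
  qed
qed

text \<open>After division by the exponential \<open>f\<close> is periodic and continuous, hence
  bounded. Stated for any \<open>f\<close> with this multiplier, it serves the Bloch mode and its
  derivative alike.\<close>

lemma exponential_quasi_periodic_bound:
  fixes f :: "real \<Rightarrow> real"
  assumes c: "continuous_on UNIV f" and f: "\<And>x. f (x + 1) = exp \<kappa> * f x"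
  obtains C where "C \<ge> 0" "\<And>x. \<bar>f x\<bar> \<le> C * exp (\<kappa> * x)"
proof -
  define g where "g x = f x * exp (- \<kappa> * x)" for x
  have g1: "g (x + 1) = g x" for x
  proof -
    have e: "- \<kappa> * (x + 1) = - \<kappa> + - \<kappa> * x" by (simp add: algebra_simps)
    show ?thesis unfolding g_def f e exp_add by (simp add: exp_minus)
  qed
  have "continuous_on {0..1} g" unfolding g_def
    by (intro continuous_intros continuous_on_subset[OF c]) auto
  then have "compact (g ` {0..1})" by (intro compact_continuous_image) auto
  then obtain C where C: "\<forall>y\<in>g ` {0..1}. norm y \<le> C" using compact_imp_bounded bounded_iff by metis
  have gC: "\<bar>g x\<bar> \<le> C" for x
  proof -
    have "g x = g (x - of_int \<lfloor>x\<rfloor>)" using periodic_int[of g x "- \<lfloor>x\<rfloor>", OF g1] by simp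
    moreover have "x - of_int \<lfloor>x\<rfloor> \<in> {0..1}" by (simp; linarith)
    ultimately show ?thesis using C by simp
  qed
  have fx: "f x = g x * exp (\<kappa> * x)" for x by (simp add: g_def exp_minus)
  show ?thesis
  proof (rule that[of C])
    show "C \<ge> 0" using gC[of 0] by linarith
    show "\<bar>f x\<bar> \<le> C * exp (\<kappa> * x)" for x using gC[of x] by (simp add: fx abs_mult)
  qed
qed

lemma cutneg_indicator: "cutneg f = (\<lambda>x. indicator {..<0} x * f x)"
  by (auto simp: cutneg_def fun_eq_iff)

lemma cutneg_measurable: "f \<in> borel_measurable lebesgue \<Longrightarrow> cutneg f \<in> borel_measurable lebesgue"
  unfolding cutneg_indicator by (intro borel_measurable_times borel_measurable_indicator) auto

lemma cutneg_L2: "f \<in> L2 \<Longrightarrow> cutneg f \<in> L2"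
proof -
  assume f: "f \<in> L2"
  have "(\<lambda>x. indicat_real {..<0} x) \<in> L_infinity"
    unfolding L_infinity_def
  proof (intro CollectI conjI exI[of _ 1])
    show "indicat_real {..<0::real} \<in> borel_measurable lebesgue" by (rule borel_measurable_indicator) auto
  qed (simp add: indicator_def)
  then show ?thesis unfolding cutneg_indicator using L_infinity_L2 f by blast
qed

lemma exponential_decay_cutneg_L2:
  assumes k: "\<kappa> > 0" and m: "f \<in> borel_measurable lebesgue" and C: "\<And>x. \<bar>f x\<bar> \<le> C * exp (\<kappa> * x)"
  shows "cutneg f \<in> L2"
proof -
  have "set_integrable lebesgue {0..} (\<lambda>x. exp (- (2 * \<kappa>) * x))"
    using k by (intro nonnegative_absolutely_integrable_1 integrable_on_exp_minus_to_infinity) auto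
  then have "integrable lebesgue (\<lambda>x. indicator {0..} (0 + (-1) * x) *\<^sub>R exp (- (2 * \<kappa>) * (0 + (-1) * x)))"
    unfolding set_integrable_def by (rule lebesgue_integrable_real_affine) simp
  then have i: "integrable lebesgue (\<lambda>x. C\<^sup>2 * (indicator {0..} (- x) * exp (2 * \<kappa> * x)))" by simp
  have "integrable lebesgue (\<lambda>x. (cutneg f x)\<^sup>2)"
  proof (rule Bochner_Integration.integrable_bound[OF i])
    show "(\<lambda>x. (cutneg f x)\<^sup>2) \<in> borel_measurable lebesgue" using cutneg_measurable[OF m] by (rule borel_measurable_power)
    show "AE x in lebesgue. norm ((cutneg f x)\<^sup>2) \<le> norm (C\<^sup>2 * (indicator {0..} (- x) * exp (2 * \<kappa> * x)))"
    proof (rule AE_I2)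
      fix x
      have "(f x)\<^sup>2 \<le> (C * exp (\<kappa> * x))\<^sup>2" using C[of x] by (metis abs_ge_zero power2_abs power_mono)
      also have "\<dots> = C\<^sup>2 * exp (2 * \<kappa> * x)" by (simp add: power_mult_distrib exp_double[symmetric] mult.assoc)
      finally show "norm ((cutneg f x)\<^sup>2) \<le> norm (C\<^sup>2 * (indicator {0..} (- x) * exp (2 * \<kappa> * x)))"
        by (simp add: cutneg_def)
    qed
  qed
  then show ?thesis using cutneg_measurable[OF m] by (simp add: L2_real_iff)
qed

text \<open>Summation of a geometric series without the series. If \<open>L\<close> is the integral
  over the part left of \<open>-1\<close>, a shift by one period gives \<open>J = exp a * L\<close>,
  and the given integral over one period is \<open>J - L\<close>; so \<open>L\<close>, and with it
  \<open>J\<close>, has the sign of the latter.\<close>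

lemma periodic_exponential_tail_integral:
  assumes i: "integrable lebesgue (cutneg F)" and F: "\<And>x. F (x + 1) = exp a * F x" and a: "a > 0"
    and neg: "(LINT x:{-1..0}|lebesgue. F x) < 0"
  shows "(LINT x|lebesgue. cutneg F x) < 0"
proof -
  define J where "J = (LINT x|lebesgue. cutneg F x)"
  have s: "cutneg F (1 + 1 * x) = exp a * (indicator {..<-1} x * F x)" for x
    using F[of x] by (auto simp: cutneg_def indicator_def add.commute)
  have i1: "integrable lebesgue (\<lambda>x. exp a * (indicator {..<-1} x * F x))"
    using lebesgue_integrable_real_affine[OF i, of 1 1] unfolding s by simp
  then have i2: "integrable lebesgue (\<lambda>x. indicator {..<-1} x * F x)" by simp
  have J1: "J = exp a * (LINT x|lebesgue. indicator {..<-1} x * F x)"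
    using lebesgue_integral_real_affine[of 1 "cutneg F" 1] unfolding s J_def by simp
  have e: "indicator {-1..<0} x * F x = cutneg F x - indicator {..<-1} x * F x" for x
    by (auto simp: cutneg_def indicator_def)
  have "(LINT x:{-1..0}|lebesgue. F x) = (LINT x|lebesgue. indicator {-1..<0} x * F x)"
    unfolding set_lebesgue_integral_def
  proof (rule integral_cong_AE)
    have "integrable lebesgue (\<lambda>x. indicator {-1..<0} x * F x)" unfolding e using i i2 by (intro Bochner_Integration.integrable_diff)
    then show m: "(\<lambda>x. indicator {-1..<0} x * F x) \<in> borel_measurable lebesgue" by auto
    have "(\<lambda>x. indicator {-1..0} x *\<^sub>R F x) = (\<lambda>x. indicator {-1..<0} x * F x + indicator {0} x * F 0)"
      by (auto simp: indicator_def fun_eq_iff)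
    moreover have "(\<lambda>x. indicator {-1..<0} x * F x + indicator {0} x * F 0) \<in> borel_measurable lebesgue"
      by (intro borel_measurable_add m borel_measurable_times borel_measurable_indicator) auto
    ultimately show "(\<lambda>x. indicator {-1..0} x *\<^sub>R F x) \<in> borel_measurable lebesgue" by (simp only:)
    show "AE x in lebesgue. indicator {-1..0} x *\<^sub>R F x = indicator {-1..<0} x * F x"
      using AE_neq_real[of 0] by eventually_elim (auto simp: indicator_def)
  qed
  also have "\<dots> = J - (LINT x|lebesgue. indicator {..<-1} x * F x)"
    unfolding e J_def using i i2 by simp
  finally have n: "J - (LINT x|lebesgue. indicator {..<-1} x * F x) < 0" using neg by simp
  define L where "L = (LINT x|lebesgue. indicator {..<-1} x * F x)"
  have "(exp a - 1) * L < 0" using n J1 unfolding L_def by (simp add: left_diff_distrib)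
  then have "L < 0" using a by (simp add: mult_less_0_iff)
  then show ?thesis using J1 unfolding L_def[symmetric] J_def by (simp add: mult_pos_neg)
qed

section \<open>Interface coefficients and the replaced tail\<close>

lemma L_infinity_interface:
  assumes "f \<in> L_infinity" "g \<in> L_infinity" shows "interface f g \<in> L_infinity"
proof -
  obtain C1 C2 where C: "AE x in lebesgue. \<bar>f x\<bar> \<le> C1" "AE x in lebesgue. \<bar>g x\<bar> \<le> C2"
    and m: "f \<in> borel_measurable lebesgue" "g \<in> borel_measurable lebesgue"
    using assms by (auto simp: L_infinity_def)
  have "interface f g = (\<lambda>x. indicator {0..} x * f x + indicator {..<0} x * g x)"
    by (auto simp: interface_def fun_eq_iff indicator_def)
  moreover have "(\<lambda>x. indicator {0..} x * f x + indicator {..<0} x * g x) \<in> borel_measurable lebesgue"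
    by (intro borel_measurable_add borel_measurable_times borel_measurable_indicator m) auto
  moreover have "AE x in lebesgue. \<bar>interface f g x\<bar> \<le> max C1 C2"
    using C by eventually_elim (auto simp: interface_def)
  ultimately show ?thesis by (auto simp: L_infinity_def)
qed

lemma bounded_common:
  assumes "f \<in> L_infinity" "g \<in> L_infinity"
  obtains K where "K \<ge> 0" "AE x in lebesgue. \<bar>f x\<bar> \<le> K" "AE x in lebesgue. \<bar>g x\<bar> \<le> K"
proof -
  obtain A B where A: "AE x in lebesgue. \<bar>f x\<bar> \<le> A" "AE x in lebesgue. \<bar>g x\<bar> \<le> B" using assms by (auto simp: L_infinity_def)
  have "AE x in lebesgue. \<bar>f x\<bar> \<le> \<bar>A\<bar> + \<bar>B\<bar>" using A(1) by eventually_elim auto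
  moreover have "AE x in lebesgue. \<bar>g x\<bar> \<le> \<bar>A\<bar> + \<bar>B\<bar>" using A(2) by eventually_elim auto
  ultimately show ?thesis using that[of "\<bar>A\<bar> + \<bar>B\<bar>"] by simp
qed

text \<open>Below 1 the power \<alpha> < 1 increases the value. Consequently a loss \<eta> in
  \<open>pot\<close> costs at most the share \<eta> of the level \<open>S\<close>.\<close>

lemma powr_ge_linear:
  assumes "0 < \<alpha>" "\<alpha> < 1" "0 \<le> \<eta>" "\<eta> < 1" "1 - \<eta> \<le> (P::real)" shows "1 - \<eta> \<le> P powr \<alpha>"
proof (cases "P \<ge> 1")
  case True
  then have "1 powr \<alpha> \<le> P powr \<alpha>" using assms by (intro powr_mono2) auto
  then show ?thesis using assms by simp
next
  case False
  then have "P powr 1 \<le> P powr \<alpha>" using assms by (intro powr_mono') auto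
  then show ?thesis using assms by simp
qed

text \<open>
  A minimizer \<open>W\<close> of the periodic problem is shifted far to the right and its tail on the negative
  half-line is replaced by a multiple of the Bloch mode. The Bloch mode minimizes the quadratic form
  on the half-line for given boundary value, so the linear energy decreases by a definite multiple of
  \<open>c\<^sup>2 + \<parallel>h\<parallel>\<^sup>2\<close>, where \<open>c\<close> is the amplitude of the mode and \<open>h\<close> the replaced difference, while the
  nonlinear term changes by \<open>o(c\<^sup>2 + \<parallel>h\<parallel>\<^sup>2)\<close>. No decay rate of \<open>W\<close> is needed.
\<close>

lemma tail_competitor:
  fixes q1 q2 G1 G2 b :: "real \<Rightarrow> real"
  assumes p: "p > 1" and q: "q1 \<in> L_infinity" "q2 \<in> L_infinity" and G: "G1 \<in> L_infinity" "G2 \<in> L_infinity"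
    and per: "\<And>x. q1 (x + 1) = q1 x" "\<And>x. q2 (x + 1) = q2 x" "\<And>x. G1 (x + 1) = G1 x"
    and \<delta>: "\<delta> > 0" "\<And>P. P \<in> H1 \<Longrightarrow> \<delta> * nsq (fst P) \<le> form q1 P"
    and S: "S > 0" and W: "W \<in> H1" "form q1 W = S" "pot G1 p (fst W) = 1"
    and b: "ode_solution q1 b" "\<exists>x. b x \<noteq> 0" and \<kappa>: "\<kappa> > 0" "\<And>x. b (x + 1) = exp \<kappa> * b x"
    and I: "(LINT x:{-1..0}|lebesgue. (q2 x - q1 x) * (b x)\<^sup>2) < 0"
  shows "\<exists>Z\<in>H1. 0 < pot (interface G1 G2) p (fst Z) \<and>
    form (interface q1 q2) Z \<le> S * pot (interface G1 G2) p (fst Z) powr (2 / (p + 1))"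
proof -
  obtain b' where b': "\<And>x. (b has_real_derivative b' x) (at x)"
    "\<And>x y. x \<le> y \<Longrightarrow> set_integrable lebesgue {x..y} (\<lambda>x. q1 x * b x)"
    "\<And>x y. x \<le> y \<Longrightarrow> b' y - b' x = (LINT t:{x..y}|lebesgue. q1 t * b t)"
    using b(1) unfolding ode_solution_def by metis
  have "set_integrable lebesgue {x..y} (\<lambda>x. q1 x * b x)" for x y
    using b'(2)[of x y] by (cases "x \<le> y") (auto simp: set_integrable_def)
  then have Ab': "AC b' (\<lambda>x. q1 x * b x)" using b'(3) by (simp add: AC_def)
  have cb': "continuous_on UNIV b'" using AC_continuous[OF Ab'] .
  have Ab: "AC b b'" using AC_of_derivative[OF b'(1) cb'] .
  have cb: "continuous_on UNIV b" using AC_continuous[OF Ab] .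
  have b'per: "b' (x + 1) = exp \<kappa> * b' x" for x
  proof -
    have "((\<lambda>x. b (x + 1)) has_real_derivative b' (x + 1)) (at x)" using b'(1)[of "x + 1"] by (simp add: DERIV_shift)
    moreover have "((\<lambda>x. b (x + 1)) has_real_derivative exp \<kappa> * b' x) (at x)"
      unfolding \<kappa>(2) using b'(1) by (rule DERIV_cmult)
    ultimately show ?thesis by (rule DERIV_unique)
  qed
  obtain C where C: "C \<ge> 0" "\<And>x. \<bar>b x\<bar> \<le> C * exp (\<kappa> * x)"
    using exponential_quasi_periodic_bound[OF cb \<kappa>(2)] by blast
  obtain C' where C': "\<And>x. \<bar>b' x\<bar> \<le> C' * exp (\<kappa> * x)"
    using exponential_quasi_periodic_bound[OF cb' b'per] by blast
  have bL: "cutneg b \<in> L2" using exponential_decay_cutneg_L2[OF \<kappa>(1) AC_measurable[OF Ab] C(2)] .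
  have b'L: "cutneg b' \<in> L2" using exponential_decay_cutneg_L2[OF \<kappa>(1) AC_measurable[OF Ab'] C'] .
  \<comment> \<open>The mode solves the equation, so in the form it is orthogonal to every element
    that vanishes on the right half-line: there is no boundary term at 0, and the product decays on
    the left.\<close>
  have orth: "integrable lebesgue (\<lambda>x. b' x * snd R x + q1 x * (b x * fst R x))"
      "(LINT x|lebesgue. b' x * snd R x + q1 x * (b x * fst R x)) = 0"
    if R: "R \<in> H1" "\<And>x. x \<ge> 0 \<Longrightarrow> fst R x = 0" "\<And>x. x \<ge> 0 \<Longrightarrow> snd R x = 0" for R
  proof -
    have e: "b' x * snd R x = cutneg b' x * snd R x" "b x * fst R x = cutneg b x * fst R x" "b' x * fst R x = cutneg b' x * fst R x" for x
      using R(2,3)[of x] by (auto simp: cutneg_def)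
    have i: "integrable lebesgue (\<lambda>x. b' x * snd R x)" "integrable lebesgue (\<lambda>x. q1 x * (b x * fst R x))" "integrable lebesgue (\<lambda>x. b' x * fst R x)"
      unfolding e by (intro L_infinity_mult_integrable[OF q(1)] L2_mult_integrable bL b'L H1_D R(1))+
    show i': "integrable lebesgue (\<lambda>x. b' x * snd R x + q1 x * (b x * fst R x))" using i by simp
    have "AC (\<lambda>x. b' x * fst R x) (\<lambda>x. b' x * snd R x + q1 x * (b x * fst R x))"
      using AC_mult[OF Ab' H1_D(1)[OF R(1)]] by (simp add: algebra_simps)
    then show "(LINT x|lebesgue. b' x * snd R x + q1 x * (b x * fst R x)) = 0"
      using AC_integral_eq_0 i(3) i' by blast
  qed
  obtain K1 where K1: "AE x in lebesgue. \<bar>q1 x\<bar> \<le> K1" using q(1) by (auto simp: L_infinity_def)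
  have K1': "AE x in lebesgue. \<bar>q1 x\<bar> \<le> \<bar>K1\<bar>" using K1 by eventually_elim auto
  \<comment> \<open>If \<open>b 0\<close> were zero, the left half of the mode would be an element
    of \<open>H1\<close> with zero form, hence zero by coercivity. A shift by integers carries every
    point to the negative half-line, so the whole mode would vanish.\<close>
  have b0: "b 0 \<noteq> 0"
  proof
    assume z: "b 0 = 0"
    define R where "R = (cutneg b, cutneg b')"
    have R: "R \<in> H1" unfolding R_def H1_def using AC_cutneg[OF Ab z] bL b'L by simp
    have "form q1 R = (LINT x|lebesgue. b' x * snd R x + q1 x * (b x * fst R x))"
      unfolding bil_def by (intro Bochner_Integration.integral_cong) (auto simp: R_def cutneg_def)
    also have "\<dots> = 0" by (rule orth(2)[OF R]) (auto simp: R_def cutneg_def)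
    finally have f0: "form q1 R = 0" .
    have "nsq (snd R) + nsq (fst R) \<le> 0"
      using coercive[OF q(1) K1' abs_ge_zero \<delta>(1) \<delta>(2)[OF R] R] f0 by simp
    then have "(fst R x)\<^sup>2 \<le> 0" for x by (rule order_trans[OF H1_pointwise_nsq[OF R]])
    then have "fst R x = 0" for x by simp
    then have bneg: "b x = 0" if "x < 0" for x using that by (metis R_def cutneg_def fst_conv)
    have "b x = 0" for x
    proof -
      define g where "g x = b x * exp (- \<kappa> * x)" for x
      have g1: "g (x + 1) = g x" for x
      proof -
        have e: "- \<kappa> * (x + 1) = - \<kappa> + - \<kappa> * x" by (simp add: algebra_simps)
        show ?thesis unfolding g_def \<kappa>(2) e exp_add by (simp add: exp_minus)
      qed
      have "g x = g (x - of_int (\<lfloor>x\<rfloor> + 1))" using periodic_int[of g x "- (\<lfloor>x\<rfloor> + 1)", OF g1] by (simp add: algebra_simps)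
      also have "x - of_int (\<lfloor>x\<rfloor> + 1) < 0" by (simp; linarith)
      then have "g (x - of_int (\<lfloor>x\<rfloor> + 1)) = 0" using bneg by (simp add: g_def)
      finally show ?thesis by (simp add: g_def)
    qed
    then show False using b(2) by blast
  qed
  define J where "J = (LINT x|lebesgue. (q2 x - q1 x) * (cutneg b x)\<^sup>2)"
  have dq: "(\<lambda>x. q2 x - q1 x) \<in> L_infinity"
  proof -
    obtain K2 where K2: "AE x in lebesgue. \<bar>q2 x\<bar> \<le> K2" using q(2) by (auto simp: L_infinity_def)
    have "AE x in lebesgue. \<bar>q2 x - q1 x\<bar> \<le> K2 + K1" using K1 K2 by eventually_elim auto
    then show ?thesis using q by (auto simp: L_infinity_def intro: borel_measurable_diff)
  qed
  have Ji: "integrable lebesgue (\<lambda>x. (q2 x - q1 x) * (cutneg b x)\<^sup>2)"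
    by (rule L_infinity_mult_integrable[OF dq L2_D(2)[OF bL]])
  have J: "J < 0"
  proof -
    define F where "F x = (q2 x - q1 x) * (b x)\<^sup>2" for x
    have cF: "cutneg F = (\<lambda>x. (q2 x - q1 x) * (cutneg b x)\<^sup>2)" by (auto simp: F_def cutneg_def fun_eq_iff)
    have "(LINT x|lebesgue. cutneg F x) < 0"
    proof (rule periodic_exponential_tail_integral)
      show "integrable lebesgue (cutneg F)" unfolding cF by (rule Ji)
      show "F (x + 1) = exp (2 * \<kappa>) * F x" for x
        unfolding F_def per \<kappa>(2) by (simp add: power_mult_distrib exp_double)
      show "(LINT x:{-1..0}|lebesgue. F x) < 0" using I by (simp add: F_def)
    qed (use \<kappa> in simp)
    then show ?thesis by (simp add: cF J_def)
  qed
  obtain KG where KG: "KG \<ge> 0" "AE x in lebesgue. \<bar>G1 x\<bar> \<le> KG" "AE x in lebesgue. \<bar>G2 x\<bar> \<le> KG"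
    using bounded_common[OF G] by blast
  define T where "T n = (LINT t:{..- real n}|lebesgue. (snd W t)\<^sup>2 + (fst W t)\<^sup>2)" for n :: nat
  define A where "A = nsq (snd W) + nsq (fst W)"
  have T0: "T \<longlonglongrightarrow> 0"
  proof -
    have i: "integrable lebesgue (\<lambda>t. (snd W t)\<^sup>2 + (fst W t)\<^sup>2)" by (rule H1_square_integrable[OF W(1)])
    have "T \<longlonglongrightarrow> (LINT (t::real)|lebesgue. (0::real))"
      unfolding T_def set_lebesgue_integral_def
    proof (rule integral_dominated_convergence[OF _ _ i])
      show "(\<lambda>t. indicator {..- real n} t *\<^sub>R ((snd W t)\<^sup>2 + (fst W t)\<^sup>2)) \<in> borel_measurable lebesgue" for n
        using set_integrable_of_integrable[OF i, of "{..- real n}"] unfolding set_integrable_def by auto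
      show "AE t in lebesgue. (\<lambda>n. indicator {..- real n} t *\<^sub>R ((snd W t)\<^sup>2 + (fst W t)\<^sup>2)) \<longlonglongrightarrow> 0"
      proof (intro AE_I2 tendsto_eventually)
        fix t
        show "\<forall>\<^sub>F n in sequentially. indicator {..- real n} t *\<^sub>R ((snd W t)\<^sup>2 + (fst W t)\<^sup>2) = 0"
          using eventually_gt_at_top[of "nat \<lceil>- t\<rceil>"]
        proof eventually_elim
          case (elim n)
          then have "- t < real n" by linarith
          then show ?case by (auto simp: indicator_def)
        qed
      qed
      show "AE t in lebesgue. norm (indicator {..- real n} t *\<^sub>R ((snd W t)\<^sup>2 + (fst W t)\<^sup>2)) \<le> (snd W t)\<^sup>2 + (fst W t)\<^sup>2" for n
        by (intro AE_I2) (auto simp: indicator_def)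
    qed simp
    then show ?thesis by simp
  qed
  have Tnn: "T n \<ge> 0" for n unfolding T_def set_lebesgue_integral_def by (intro integral_nonneg_AE AE_I2) auto
  define m where "m n = sqrt (T n)" for n
  have m0: "m \<longlonglongrightarrow> 0" unfolding m_def using tendsto_real_sqrt[OF T0] by simp
  have mnn: "m n \<ge> 0" for n by (simp add: m_def Tnn)
  define nb where "nb = nsq (cutneg b)"
  have nb0: "nb \<ge> 0" by (simp add: nb_def nsq_nonneg)
  define B where "B = C / \<bar>b 0\<bar>"
  have B0: "B \<ge> 0" using C(1) by (simp add: B_def)
  \<comment> \<open>The factor in the loss of \<open>pot\<close>. Its first term pays for the
    removal of \<open>w\<close> on the negative half-line, where
    \<open>\<bar>w\<bar> \<le> m n\<close>, the second one for the new tail, which is at most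
    \<open>m n * B\<close> there.\<close>
  define \<epsilon> where "\<epsilon> n = KG * (m n powr (p - 1) * (2 + 2 * nb) + (m n * B) powr (p - 1) * nb)" for n
  have \<epsilon>0: "\<epsilon> \<longlonglongrightarrow> 0"
  proof -
    have 1: "(\<lambda>n. m n powr (p - 1)) \<longlonglongrightarrow> 0"
      by (rule tendsto_zero_powrI[OF m0 tendsto_const]) (use p mnn in auto)
    have "(\<lambda>n. m n * B) \<longlonglongrightarrow> 0" using tendsto_mult_right[OF m0, of B] by simp
    then have 2: "(\<lambda>n. (m n * B) powr (p - 1)) \<longlonglongrightarrow> 0"
      by (rule tendsto_zero_powrI[OF _ tendsto_const]) (use p mnn B0 in auto)
    have "\<epsilon> \<longlonglongrightarrow> KG * (0 * (2 + 2 * nb) + 0 * nb)" unfolding \<epsilon>_def by (intro tendsto_intros 1 2)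
    then show ?thesis by simp
  qed
  have \<epsilon>nn: "\<epsilon> n \<ge> 0" for n unfolding \<epsilon>_def using KG(1) nb0 by (intro mult_nonneg_nonneg add_nonneg_nonneg) auto
  \<comment> \<open>A bound, independent of the shift, for the quantity \<open>D\<close> that
    multiplies \<open>\<epsilon> n\<close>; it uses that \<open>A\<close> bounds the square of
    \<open>W\<close> everywhere.\<close>
  define D0 where "D0 = A / (b 0)\<^sup>2 + 2 * nsq (fst W) + 2 * (A / (b 0)\<^sup>2) * nb"
  have A0: "A \<ge> 0" unfolding A_def using nsq_nonneg by (intro add_nonneg_nonneg)
  have D00: "D0 \<ge> 0" unfolding D0_def using A0 nb0 nsq_nonneg[of "fst W"] by (intro add_nonneg_nonneg mult_nonneg_nonneg divide_nonneg_nonneg) auto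
  \<comment> \<open>The first condition keeps the loss below 1, so that \<open>pot\<close> remains
    positive. The second one lets both gains, \<open>- J\<close> for \<open>c\<^sup>2\<close> and
    \<delta> for \<open>nsq (fst R)\<close>, exceed \<open>S\<close> times the loss factor.\<close>
  obtain n where n: "\<epsilon> n * (D0 + 1) < 1" "\<epsilon> n * S < min (- J) \<delta>"
  proof -
    have l: "(\<lambda>n. \<epsilon> n * (D0 + 1)) \<longlonglongrightarrow> 0" "(\<lambda>n. \<epsilon> n * S) \<longlonglongrightarrow> 0"
      using tendsto_mult_right[OF \<epsilon>0, of "D0 + 1"] tendsto_mult_right[OF \<epsilon>0, of S] by simp_all
    have "\<forall>\<^sub>F n in sequentially. \<epsilon> n * (D0 + 1) < 1" by (rule order_tendstoD(2)[OF l(1)]) simp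
    moreover have "\<forall>\<^sub>F n in sequentially. \<epsilon> n * S < min (- J) \<delta>"
      by (rule order_tendstoD(2)[OF l(2)]) (use J \<delta>(1) in simp)
    ultimately have "\<forall>\<^sub>F n in sequentially. \<epsilon> n * (D0 + 1) < 1 \<and> \<epsilon> n * S < min (- J) \<delta>" by (rule eventually_conj)
    then show ?thesis using that eventually_happens sequentially_bot by blast
  qed
  define w where "w = aff 1 (- real n) W"
  have wH: "w \<in> H1" unfolding w_def using W(1) by (intro aff_H1) auto
  have q1s: "q1 (- real n + 1 * x) = q1 x" and G1s: "G1 (- real n + 1 * x) = G1 x" for x
    using periodic_int[of q1 x "- int n"] periodic_int[of G1 x "- int n"] per by (simp_all add: add.commute)
  have wS: "form q1 w = S" unfolding w_def using bil_aff[of 1 q1 "- real n" W W] W(2) unfolding q1s by simp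
  have wG: "pot G1 p (fst w) = 1"
    unfolding pot_def w_def aff_def
    using lebesgue_integral_real_affine[of 1 "\<lambda>x. G1 x * \<bar>fst W x\<bar> powr (p + 1)" "- real n"] W(3) unfolding pot_def G1s by simp
  have wnsq: "nsq (fst w) = nsq (fst W)"
    using lebesgue_integral_real_affine[of 1 "\<lambda>x. (fst W x)\<^sup>2" "- real n"] by (simp add: nsq_def w_def aff_def)
  have wm2: "(fst w x)\<^sup>2 \<le> T n" if "x \<le> 0" for x
  proof -
    have i: "integrable lebesgue (\<lambda>t. (snd W t)\<^sup>2 + (fst W t)\<^sup>2)" by (rule H1_square_integrable[OF W(1)])
    have "(fst w x)\<^sup>2 = (fst W (x - real n))\<^sup>2" by (simp add: w_def aff_def)
    also have "\<dots> \<le> (LINT t:{..x - real n}|lebesgue. (snd W t)\<^sup>2 + (fst W t)\<^sup>2)" by (rule H1_pointwise_atMost[OF W(1)])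
    also have "\<dots> \<le> T n" unfolding T_def set_lebesgue_integral_def
    proof (rule integral_mono)
      show "integrable lebesgue (\<lambda>t. indicator {..a} t *\<^sub>R ((snd W t)\<^sup>2 + (fst W t)\<^sup>2))" for a
        using set_integrable_of_integrable[OF i, of "{..a}"] unfolding set_integrable_def by auto
      then show "integrable lebesgue (\<lambda>t. indicator {..a} t *\<^sub>R ((snd W t)\<^sup>2 + (fst W t)\<^sup>2))" for a .
    qed (use that in \<open>auto simp: indicator_def\<close>)
    finally show ?thesis .
  qed
  have wm: "\<bar>fst w x\<bar> \<le> m n" if "x \<le> 0" for x
    unfolding m_def using real_sqrt_le_mono[OF wm2[OF that]] by simp
  have wA: "(fst w x)\<^sup>2 \<le> A" for x using H1_pointwise_nsq[OF W(1), of "x - real n"] by (simp add: w_def aff_def A_def)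
  \<comment> \<open>The multiple of the mode that fits \<open>w\<close> continuously at the
    interface.\<close>
  define c where "c = fst w 0 / b 0"
  have c2: "c\<^sup>2 \<le> A / (b 0)\<^sup>2" unfolding c_def power_divide using wA[of 0] by (intro divide_right_mono) auto
  have c2nn: "c\<^sup>2 \<ge> 0" by simp
  define h where "h x = fst w x + (- c) * b x" for x
  define h' where "h' x = snd w x + (- c) * b' x" for x
  have Ah: "AC h h'" unfolding h_def h'_def by (intro AC_add AC_scale H1_D wH Ab)
  have h0: "h 0 = 0" using b0 by (simp add: h_def c_def)
  define R where "R = (cutneg h, cutneg h')"
  have "cutneg h = (\<lambda>x. cutneg (fst w) x + (- c) * cutneg b x)" "cutneg h' = (\<lambda>x. cutneg (snd w) x + (- c) * cutneg b' x)"
    by (auto simp: cutneg_def h_def h'_def fun_eq_iff)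
  moreover have "(\<lambda>x. cutneg (fst w) x + (- c) * cutneg b x) \<in> L2" "(\<lambda>x. cutneg (snd w) x + (- c) * cutneg b' x) \<in> L2"
    by (intro L2_add L2_scale cutneg_L2 H1_D wH bL b'L)+
  ultimately have hL: "cutneg h \<in> L2" "cutneg h' \<in> L2" by auto
  then have R: "R \<in> H1" unfolding R_def H1_def using AC_cutneg[OF Ah h0] by simp
  define Z where "Z = w - R"
  have Z: "Z \<in> H1" unfolding Z_def using wH R by (rule H1_diff)
  have fZ: "fst Z x = (if x < 0 then c * b x else fst w x)" and sZ: "snd Z x = (if x < 0 then c * b' x else snd w x)" for x
    by (auto simp: Z_def R_def cutneg_def h_def h'_def)
  have qi: "interface q1 q2 \<in> L_infinity" and Gi: "interface G1 G2 \<in> L_infinity"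
    using L_infinity_interface q G by auto
  \<comment> \<open>On the left \<open>w\<close> equals \<open>R + c * b\<close>, and orthogonality
    removes the mixed terms. What remains is an exact identity: passing from \<open>q1\<close> to
    \<open>q2\<close> under the new tail contributes \<open>c\<^sup>2 * J < 0\<close>, and the form
    of \<open>R\<close> is saved.\<close>
  have formZ: "form (interface q1 q2) Z = S + c\<^sup>2 * J - form q1 R"
  proof -
    define o1 where "o1 x = b' x * snd R x + q1 x * (b x * fst R x)" for x
    have o1: "integrable lebesgue o1" "(LINT x|lebesgue. o1 x) = 0"
      unfolding o1_def using orth[OF R] by (auto simp: R_def cutneg_def)
    have iw: "integrable lebesgue (\<lambda>x. snd w x * snd w x + q1 x * (fst w x * fst w x))" by (rule bil_integrable[OF q(1) wH wH])
    have iR: "integrable lebesgue (\<lambda>x. snd R x * snd R x + q1 x * (fst R x * fst R x))" by (rule bil_integrable[OF q(1) R R])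
    have pw: "snd Z x * snd Z x + interface q1 q2 x * (fst Z x * fst Z x) =
       (snd w x * snd w x + q1 x * (fst w x * fst w x)) + c\<^sup>2 * ((q2 x - q1 x) * (cutneg b x)\<^sup>2)
         - 2 * c * o1 x - (snd R x * snd R x + q1 x * (fst R x * fst R x))" for x
    proof (cases "x < 0")
      case True
      have e: "fst w x = fst R x + c * b x" "snd w x = snd R x + c * b' x" using True by (simp_all add: R_def cutneg_def h_def h'_def)
      show ?thesis using True unfolding fZ sZ o1_def e by (simp add: interface_def cutneg_def power2_eq_square algebra_simps)
    next
      case False
      then show ?thesis unfolding fZ sZ o1_def by (simp add: interface_def cutneg_def R_def)
    qed
    have "form (interface q1 q2) Z = form q1 w + c\<^sup>2 * J - 2 * c * 0 - form q1 R"
      unfolding bil_def pw J_def o1(2)[symmetric] using iw iR Ji o1(1) by simp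
    then show ?thesis using wS by simp
  qed
  define D where "D = c\<^sup>2 + nsq (fst R)"
  have D0le: "0 \<le> D" "D \<le> D0"
  proof -
    show "0 \<le> D" using nsq_nonneg[of "fst R"] by (simp add: D_def)
    have "nsq (fst R) \<le> (LINT x|lebesgue. 2 * (fst w x)\<^sup>2 + 2 * c\<^sup>2 * (cutneg b x)\<^sup>2)"
      unfolding nsq_def
    proof (rule integral_mono)
      show "(fst R x)\<^sup>2 \<le> 2 * (fst w x)\<^sup>2 + 2 * c\<^sup>2 * (cutneg b x)\<^sup>2" for x
        using zero_le_power2[of "fst w x + c * b x"]
        by (auto simp: R_def cutneg_def h_def power2_diff power2_sum power_mult_distrib)
    qed (use L2_D[OF H1_D(2)[OF wH]] L2_D[OF bL] L2_D[OF H1_D(2)[OF R]] in auto)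
    also have "\<dots> = 2 * nsq (fst W) + 2 * c\<^sup>2 * nb"
      using wnsq L2_D[OF H1_D(2)[OF wH]] L2_D[OF bL] by (simp add: nsq_def nb_def)
    also have "\<dots> \<le> 2 * nsq (fst W) + 2 * (A / (b 0)\<^sup>2) * nb" using c2 nb0 by (intro add_left_mono mult_right_mono) auto
    finally show "D \<le> D0" using c2 unfolding D_def D0_def by linarith
  qed
  define \<eta> where "\<eta> = \<epsilon> n * D"
  have \<eta>: "0 \<le> \<eta>" "\<eta> < 1"
  proof -
    show "0 \<le> \<eta>" using \<epsilon>nn D0le by (simp add: \<eta>_def)
    have "\<eta> \<le> \<epsilon> n * (D0 + 1)" unfolding \<eta>_def using \<epsilon>nn D0le by (intro mult_left_mono) auto
    then show "\<eta> < 1" using n(1) by simp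
  qed
  have potZ: "pot (interface G1 G2) p (fst Z) \<ge> 1 - \<eta>"
  proof -
    define a1 where "a1 = m n powr (p - 1)"
    define a2 where "a2 = (m n * B) powr (p - 1)"
    have a12: "a1 \<ge> 0" "a2 \<ge> 0" by (auto simp: a1_def a2_def)
    define loss where "loss x = KG * (a1 * (2 * (fst R x)\<^sup>2 + 2 * c\<^sup>2 * (cutneg b x)\<^sup>2) + a2 * (c\<^sup>2 * (cutneg b x)\<^sup>2))" for x
    have lossi: "integrable lebesgue loss" unfolding loss_def using L2_D[OF bL] L2_D[OF H1_D(2)[OF R]] by auto
    have "(LINT x|lebesgue. loss x) = KG * (a1 * (2 * nsq (fst R) + 2 * c\<^sup>2 * nb) + a2 * (c\<^sup>2 * nb))"
      unfolding loss_def nsq_def nb_def using L2_D[OF bL] L2_D[OF H1_D(2)[OF R]] by simp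
    also have "\<dots> \<le> KG * (a1 * ((2 + 2 * nb) * D) + a2 * (nb * D))"
    proof (intro mult_left_mono add_mono)
      have "nb * nsq (fst R) \<ge> 0" using nb0 nsq_nonneg[of "fst R"] by simp
      moreover have "(2 + 2 * nb) * D = 2 * c\<^sup>2 + 2 * nsq (fst R) + 2 * c\<^sup>2 * nb + 2 * (nb * nsq (fst R))"
        by (simp add: D_def algebra_simps)
      ultimately show "2 * nsq (fst R) + 2 * c\<^sup>2 * nb \<le> (2 + 2 * nb) * D" using c2nn by linarith
      have "nb * D = c\<^sup>2 * nb + nb * nsq (fst R)" by (simp add: D_def algebra_simps)
      then show "c\<^sup>2 * nb \<le> nb * D" using \<open>nb * nsq (fst R) \<ge> 0\<close> by linarith
    qed (use a12 KG(1) in auto)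
    also have "\<dots> = \<eta>" unfolding \<eta>_def \<epsilon>_def a1_def a2_def by (simp add: algebra_simps)
    finally have loss\<eta>: "(LINT x|lebesgue. loss x) \<le> \<eta>" .
    have iw: "integrable lebesgue (\<lambda>x. G1 x * \<bar>fst w x\<bar> powr (p + 1))"
      by (intro L_infinity_mult_integrable G H1_powr_integrable p wH)
    have iZ: "integrable lebesgue (\<lambda>x. interface G1 G2 x * \<bar>fst Z x\<bar> powr (p + 1))"
      by (intro L_infinity_mult_integrable Gi H1_powr_integrable p Z)
    have "1 - \<eta> \<le> (LINT x|lebesgue. G1 x * \<bar>fst w x\<bar> powr (p + 1)) - (LINT x|lebesgue. loss x)"
      using wG loss\<eta> by (simp add: pot_def)
    also have "\<dots> = (LINT x|lebesgue. G1 x * \<bar>fst w x\<bar> powr (p + 1) - loss x)" using iw lossi by simp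
    also have "\<dots> \<le> (LINT x|lebesgue. interface G1 G2 x * \<bar>fst Z x\<bar> powr (p + 1))"
    proof (rule integral_mono_AE)
      show "AE x in lebesgue. G1 x * \<bar>fst w x\<bar> powr (p + 1) - loss x \<le> interface G1 G2 x * \<bar>fst Z x\<bar> powr (p + 1)"
        using KG(2,3)
      proof eventually_elim
        case (elim x)
        show ?case
        proof (cases "x < 0")
          case False
          then have "loss x = 0" by (simp add: loss_def R_def cutneg_def)
          then show ?thesis using False by (simp add: fZ interface_def)
        next
          case True
          have 1: "\<bar>fst w x\<bar> powr (p + 1) \<le> a1 * (fst w x)\<^sup>2"
            unfolding a1_def using True by (intro abs_powr_le_square p wm) auto
          have "\<bar>c * b x\<bar> \<le> m n * B"
          proof -
            have "\<bar>b x\<bar> \<le> C * exp (\<kappa> * x)" by (rule C)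
            also have "\<dots> \<le> C * 1" using True \<kappa>(1) C(1) by (intro mult_left_mono) (auto simp: mult_nonneg_nonpos)
            finally have "\<bar>c\<bar> * \<bar>b x\<bar> \<le> (m n / \<bar>b 0\<bar>) * C"
              unfolding c_def abs_divide using wm[of 0] mnn by (intro mult_mono divide_right_mono) auto
            then show ?thesis by (simp add: abs_mult B_def)
          qed
          then have 2: "\<bar>c * b x\<bar> powr (p + 1) \<le> a2 * (c * b x)\<^sup>2" unfolding a2_def by (rule abs_powr_le_square[OF p])
          have hx: "fst R x = fst w x - c * b x" using True by (simp add: R_def cutneg_def h_def)
          have "(fst w x)\<^sup>2 \<le> 2 * (fst R x)\<^sup>2 + 2 * (c * b x)\<^sup>2"
            using zero_le_power2[of "fst R x - c * b x"] unfolding hx by (simp add: power2_diff power2_sum algebra_simps)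
          then have "a1 * (fst w x)\<^sup>2 \<le> a1 * (2 * (fst R x)\<^sup>2 + 2 * (c * b x)\<^sup>2)" using a12 by (intro mult_left_mono)
          with 1 have 3: "\<bar>fst w x\<bar> powr (p + 1) \<le> a1 * (2 * (fst R x)\<^sup>2 + 2 * (c * b x)\<^sup>2)" by linarith
          have "G1 x * \<bar>fst w x\<bar> powr (p + 1) \<le> KG * (a1 * (2 * (fst R x)\<^sup>2 + 2 * (c * b x)\<^sup>2))"
            using elim(1) 3 KG(1) by (intro order_trans[OF mult_right_mono mult_left_mono]) auto
          moreover have "- G2 x * \<bar>c * b x\<bar> powr (p + 1) \<le> KG * (a2 * (c * b x)\<^sup>2)"
            using elim(2) 2 KG(1) by (intro order_trans[OF mult_right_mono mult_left_mono]) auto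
          moreover have "loss x = KG * (a1 * (2 * (fst R x)\<^sup>2 + 2 * (c * b x)\<^sup>2)) + KG * (a2 * (c * b x)\<^sup>2)"
            using True by (simp add: loss_def cutneg_def power_mult_distrib algebra_simps)
          ultimately show ?thesis using True by (simp add: fZ interface_def)
        qed
      qed
    qed (use iw lossi iZ in auto)
    finally show ?thesis by (simp add: pot_def)
  qed
  \<comment> \<open>The loss \<open>S * \<eta>\<close> consists of the same two quantities
    \<open>c\<^sup>2\<close> and \<open>nsq (fst R)\<close> as the gain, so the choice of
    \<open>n\<close> allows a comparison term by term. Both may be zero; a weak inequality
    suffices.\<close>
  have "form (interface q1 q2) Z \<le> S * (1 - \<eta>)"
  proof -
    have "\<delta> * nsq (fst R) \<le> form q1 R" by (rule \<delta>(2)[OF R])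
    moreover have "(\<epsilon> n * S) * c\<^sup>2 \<le> (- J) * c\<^sup>2" using n(2) by (intro mult_right_mono) auto
    moreover have "(\<epsilon> n * S) * nsq (fst R) \<le> \<delta> * nsq (fst R)" using n(2) nsq_nonneg by (intro mult_right_mono) auto
    moreover have "S * \<eta> = (\<epsilon> n * S) * c\<^sup>2 + (\<epsilon> n * S) * nsq (fst R)" by (simp add: \<eta>_def D_def algebra_simps)
    moreover have "S * (1 - \<eta>) = S - S * \<eta>" by (simp add: algebra_simps)
    moreover have "c\<^sup>2 * J = - ((- J) * c\<^sup>2)" by (simp add: algebra_simps)
    ultimately show ?thesis using formZ by linarith
  qed
  also have "\<dots> \<le> S * pot (interface G1 G2) p (fst Z) powr (2 / (p + 1))"
    using S p potZ \<eta> by (intro mult_left_mono powr_ge_linear) auto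
  finally show ?thesis using Z potZ \<eta> by (intro bexI[OF _ Z]) auto
qed

section \<open>Existence of ground states\<close>

lemma H1_of_derivative:
  assumes d: "\<And>x. (f has_real_derivative f' x) (at x)" and c: "continuous_on UNIV f'"
    and z: "\<And>x. \<bar>x\<bar> > R \<Longrightarrow> f x = 0" "\<And>x. \<bar>x\<bar> > R \<Longrightarrow> f' x = 0"
  shows "(f, f') \<in> H1"
proof -
  have A: "AC f f'" using AC_of_derivative[OF d c] .
  have L: "g \<in> L2" if "continuous_on UNIV g" "\<And>x. \<bar>x\<bar> > R \<Longrightarrow> g x = 0" for g :: "real \<Rightarrow> real"
  proof -
    have "integrable lebesgue (\<lambda>x. g x * g x)"
      using continuous_integrable_mult[OF that continuous_set_integrable[OF that(1)]] .
    then show ?thesis using continuous_lebesgue_measurable[OF that(1)] by (simp add: L2_real_iff power2_eq_square)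
  qed
  show ?thesis unfolding H1_def using A L[OF c z(2)] L[OF AC_continuous[OF A] z(1)] by simp
qed

text \<open>If \<open>pot\<close> were never positive, testing with smooth approximations of
  indicators would make the integral of \<open>G\<close> over every interval nonpositive, and thus
  \<open>G \<le> 0\<close> almost everywhere.\<close>

lemma pot_positive_exists:
  assumes p: "p > 1" and G: "G \<in> L_infinity" and npos: "\<not> (AE x in lebesgue. G x \<le> 0)"
  shows "\<exists>P\<in>H1. 0 < pot G p (fst P)"
proof (rule ccontr)
  assume "\<not> ?thesis"
  then have le: "pot G p (fst P) \<le> 0" if "P \<in> H1" for P using that by force
  obtain K where K: "AE x in lebesgue. \<bar>G x\<bar> \<le> K" and Gm: "G \<in> borel_measurable lebesgue" using G by (auto simp: L_infinity_def)
  have Gi: "set_integrable lebesgue {a..b} G" for a b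
  proof -
    have "integrable lebesgue (indicat_real {a..b})"
      by (rule integrable_real_indicator) (auto simp: emeasure_lborel_Icc_eq)
    from L_infinity_mult_integrable[OF G this] show ?thesis by (simp add: set_integrable_def mult.commute)
  qed
  obtain \<psi> :: "real \<Rightarrow> real \<Rightarrow> nat \<Rightarrow> real \<Rightarrow> real" where \<psi>smooth: "\<And>m a b n. cdiff m (\<psi> a b n)"
    and \<psi>0: "\<And>a b n x. a \<le> b \<Longrightarrow> x \<le> a \<or> x \<ge> b + 1 \<Longrightarrow> \<psi> a b n x = 0" and \<psi>1: "\<And>a b n x. \<bar>\<psi> a b n x\<bar> \<le> 1"
    and \<psi>lim: "\<And>a b x. (\<lambda>n. \<psi> a b n x) \<longlonglongrightarrow> (if x \<le> a then 0 else 1) - (if x \<le> b then 0 else 1)"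
    using smooth_interval_approximation by metis
  have "(LINT x:{a..b}|lebesgue. G x) \<le> 0" if ab: "a \<le> b" for a b
  proof -
    define l where "l x = (if x \<le> a then 0 else 1) - (if x \<le> b then 0 else (1::real))" for x
    have "l = (\<lambda>x. indicator {a<..} x - indicator {b<..} x)" by (auto simp: l_def indicator_def fun_eq_iff)
    moreover have "(\<lambda>x. indicat_real {a<..} x - indicator {b<..} x) \<in> borel_measurable lebesgue"
      by (intro borel_measurable_diff borel_measurable_indicator) auto
    ultimately have "l \<in> borel_measurable lebesgue" by simp
    then have lm: "(\<lambda>x. G x * \<bar>l x\<bar> powr (p + 1)) \<in> borel_measurable lebesgue" using Gm by measurable
    have H: "\<exists>f'. (\<psi> a b n, f') \<in> H1" for n
    proof -
      have "test_function (\<psi> a b n)"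
      proof (rule test_functionI[OF \<psi>smooth])
        show "\<bar>x\<bar> > max \<bar>a\<bar> \<bar>b + 1\<bar> \<Longrightarrow> \<psi> a b n x = 0" for x by (rule \<psi>0[OF ab]) linarith
      qed
      from test_functionD[OF this] obtain R where R: "AC (\<psi> a b n) (deriv (\<psi> a b n))" "continuous_on UNIV (deriv (\<psi> a b n))"
        "\<And>x. \<bar>x\<bar> > R \<Longrightarrow> \<psi> a b n x = 0" "\<And>x. \<bar>x\<bar> > R \<Longrightarrow> deriv (\<psi> a b n) x = 0" by metis
      obtain f' where "\<And>x. (\<psi> a b n has_real_derivative f' x) (at x)" using \<psi>smooth[of 1 a b n] by auto
      then have "(\<psi> a b n has_real_derivative deriv (\<psi> a b n) x) (at x)" for x using DERIV_imp_deriv by metis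
      from H1_of_derivative[OF this R(2,3,4)] show ?thesis by blast
    qed
    have "(\<lambda>n. LINT x|lebesgue. G x * \<bar>\<psi> a b n x\<bar> powr (p + 1)) \<longlonglongrightarrow> (LINT x|lebesgue. G x * \<bar>l x\<bar> powr (p + 1))"
    proof (rule integral_dominated_convergence)
      show "integrable lebesgue (\<lambda>x. norm (indicator {a..b+1} x *\<^sub>R G x))"
        using Gi[of a "b + 1"] unfolding set_integrable_def by (rule integrable_norm)
      show "(\<lambda>x. G x * \<bar>\<psi> a b n x\<bar> powr (p + 1)) \<in> borel_measurable lebesgue" for n
        using Gm continuous_lebesgue_measurable[OF cdiff_continuous[OF \<psi>smooth]] by measurable
      show "(\<lambda>x. G x * \<bar>l x\<bar> powr (p + 1)) \<in> borel_measurable lebesgue" by (rule lm)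
      show "AE x in lebesgue. norm (G x * \<bar>\<psi> a b n x\<bar> powr (p + 1)) \<le> norm (indicator {a..b+1} x *\<^sub>R G x)" for n
      proof (rule AE_I2)
        fix x
        have "\<bar>\<psi> a b n x\<bar> powr (p + 1) \<le> 1 powr (p + 1)" using p \<psi>1[of a b n x] by (intro powr_mono2) auto
        then show "norm (G x * \<bar>\<psi> a b n x\<bar> powr (p + 1)) \<le> norm (indicator {a..b+1} x *\<^sub>R G x)"
          using \<psi>0[OF ab, of x n] by (auto simp: indicator_def abs_mult mult_left_le)
      qed
      show "AE x in lebesgue. (\<lambda>n. G x * \<bar>\<psi> a b n x\<bar> powr (p + 1)) \<longlonglongrightarrow> G x * \<bar>l x\<bar> powr (p + 1)"
      proof (rule AE_I2)
        fix x
        have "(\<lambda>n. \<bar>\<psi> a b n x\<bar>) \<longlonglongrightarrow> \<bar>l x\<bar>" unfolding l_def by (intro tendsto_rabs \<psi>lim)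
        then have "(\<lambda>n. \<bar>\<psi> a b n x\<bar> powr (p + 1)) \<longlonglongrightarrow> \<bar>l x\<bar> powr (p + 1)"
          using p by (intro tendsto_powr' tendsto_const) auto
        then show "(\<lambda>n. G x * \<bar>\<psi> a b n x\<bar> powr (p + 1)) \<longlonglongrightarrow> G x * \<bar>l x\<bar> powr (p + 1)" by (rule tendsto_mult_left)
      qed
    qed
    moreover have "(LINT x|lebesgue. G x * \<bar>\<psi> a b n x\<bar> powr (p + 1)) \<le> 0" for n
      using H[of n] le by (force simp: pot_def)
    ultimately have "(LINT x|lebesgue. G x * \<bar>l x\<bar> powr (p + 1)) \<le> 0" by (intro LIMSEQ_le_const2) auto
    moreover have "(LINT x:{a..b}|lebesgue. G x) = (LINT x|lebesgue. G x * \<bar>l x\<bar> powr (p + 1))"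
      unfolding set_lebesgue_integral_def
    proof (rule integral_cong_AE)
      show "(\<lambda>x. indicator {a..b} x *\<^sub>R G x) \<in> borel_measurable lebesgue"
        using Gi[of a b] unfolding set_integrable_def by auto
      show "(\<lambda>x. G x * \<bar>l x\<bar> powr (p + 1)) \<in> borel_measurable lebesgue" by (rule lm)
      show "AE x in lebesgue. indicator {a..b} x *\<^sub>R G x = G x * \<bar>l x\<bar> powr (p + 1)"
        using AE_neq_real[of a] by eventually_elim (use ab in \<open>auto simp: indicator_def l_def\<close>)
    qed
    ultimately show ?thesis by simp
  qed
  then show False using AE_nonpos_of_intervals[OF Gi] npos by blast
qed

section \<open>Scaling, translation and the trichotomy for minimizing sequences\<close>

lemma form_scale: "form q (t *\<^sub>R P) = t\<^sup>2 * form q P"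
  using bil_scale_left[of q t P "t *\<^sub>R P"] bil_scale_left[of q t P P] bil_commute[of q P "t *\<^sub>R P"]
  by (simp add: power2_eq_square)

lemma pot_scale: "t \<ge> 0 \<Longrightarrow> pot G p (fst (t *\<^sub>R P)) = t powr (p + 1) * pot G p (fst P)"
  unfolding pot_def by (subst integral_mult_right_zero[symmetric])
    (auto intro!: Bochner_Integration.integral_cong simp: abs_mult powr_mult algebra_simps)

lemma pot_upper:
  assumes p: "p > 1" and G: "G \<in> L_infinity" and K: "AE x in lebesgue. \<bar>G x\<bar> \<le> K" "K \<ge> 0"
    and P: "P \<in> H1" and M: "\<And>x. \<bar>fst P x\<bar> \<le> M"
  shows "pot G p (fst P) \<le> K * M powr (p - 1) * nsq (fst P)"
proof -
  have "pot G p (fst P) \<le> (LINT x|lebesgue. K * M powr (p - 1) * (fst P x)\<^sup>2)"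
    unfolding pot_def
  proof (rule integral_mono_AE)
    show "integrable lebesgue (\<lambda>x. G x * \<bar>fst P x\<bar> powr (p + 1))"
      by (intro L_infinity_mult_integrable G H1_powr_integrable p P)
    show "integrable lebesgue (\<lambda>x. K * M powr (p - 1) * (fst P x)\<^sup>2)" using L2_D[OF H1_D(2)[OF P]] by simp
    show "AE x in lebesgue. G x * \<bar>fst P x\<bar> powr (p + 1) \<le> K * M powr (p - 1) * (fst P x)\<^sup>2"
      using K(1)
    proof eventually_elim
      case (elim x)
      have "G x * \<bar>fst P x\<bar> powr (p + 1) \<le> K * \<bar>fst P x\<bar> powr (p + 1)" using elim by (intro mult_right_mono) auto
      also have "\<dots> \<le> K * (M powr (p - 1) * (fst P x)\<^sup>2)" by (intro mult_left_mono abs_powr_le_square p M K)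
      finally show ?case by simp
    qed
  qed
  then show ?thesis by (simp add: nsq_def)
qed

text \<open>The extended reals are compact, and a sequence of integers with a finite limit is
  eventually constant.\<close>

lemma int_sequence_subsequence:
  fixes k :: "nat \<Rightarrow> int"
  obtains r where "strict_mono r" "(\<exists>c. \<forall>n. k (r n) = c) \<or> filterlim (\<lambda>n. real_of_int (k (r n))) at_top sequentially
    \<or> filterlim (\<lambda>n. real_of_int (k (r n))) at_bot sequentially"
proof -
  obtain l r where r: "strict_mono r" "((\<lambda>n. ereal (real_of_int (k n))) \<circ> r) \<longlonglongrightarrow> l"
    using compact_complete_linorder by metis
  then have lim: "(\<lambda>n. ereal (real_of_int (k (r n)))) \<longlonglongrightarrow> l" by (simp add: o_def)
  show ?thesis
  proof (cases l)
    case PInf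
    then have "filterlim (\<lambda>n. real_of_int (k (r n))) at_top sequentially" using lim by (simp add: tendsto_PInfty_eq_at_top)
    then show ?thesis using that r(1) by blast
  next
    case MInf
    have "filterlim (\<lambda>n. real_of_int (k (r n))) at_bot sequentially"
      unfolding filterlim_at_bot using lim MInf by (auto simp: tendsto_MInfty less_imp_le elim!: eventually_mono)
        (metis (mono_tags, lifting) eventually_mono less_imp_le)
    then show ?thesis using that r(1) by blast
  next
    case (real x)
    then have "(\<lambda>n. real_of_int (k (r n))) \<longlonglongrightarrow> x" using lim by simp
    then have "Cauchy (\<lambda>n. real_of_int (k (r n)))" by (rule LIMSEQ_imp_Cauchy)
    then obtain N where N: "\<forall>m\<ge>N. \<forall>n\<ge>N. norm (real_of_int (k (r m)) - real_of_int (k (r n))) < 1"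
      using CauchyD[of _ 1] by (metis zero_less_one)
    have "k (r (n + N)) = k (r N)" for n
    proof -
      have "norm (real_of_int (k (r (n + N))) - real_of_int (k (r N))) < 1" using N by simp
      then have "\<bar>k (r (n + N)) - k (r N)\<bar> < 1" by (simp flip: of_int_diff of_int_abs)
      then show ?thesis by simp
    qed
    moreover have "strict_mono (\<lambda>n. r (n + N))" using r(1) by (simp add: strict_mono_def)
    ultimately show ?thesis using that[of "\<lambda>n. r (n + N)"] by blast
  qed
qed

lemma pot_aff: "c = 1 \<or> c = -1 \<Longrightarrow> pot (\<lambda>x. G (t + c * x)) p (fst (aff c t P)) = pot G p (fst P)"
  unfolding pot_def aff_def
  by (subst lebesgue_integral_real_affine[of c "\<lambda>x. G x * \<bar>fst P x\<bar> powr (p + 1)" t]) auto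

lemma nsq_aff: "c = 1 \<or> c = -1 \<Longrightarrow> nsq (fst (aff c t P)) = nsq (fst P)"
  unfolding nsq_def aff_def
  by (subst lebesgue_integral_real_affine[of c "\<lambda>x. (fst P x)\<^sup>2" t]) auto

lemma aff_inverse: "aff 1 (- t) (aff 1 t P) = P" "aff 1 t (aff 1 (- t) P) = P" "aff (-1) 0 (aff (-1) 0 P) = P"
  by (simp_all add: aff_def)

lemma interface_shift_limit:
  assumes per: "\<And>x. f (x + 1) = f x" "\<And>x. g (x + 1) = g x"
  shows "filterlim (\<lambda>n. real_of_int (k n)) at_top sequentially \<Longrightarrow> (\<lambda>n. interface f g (real_of_int (k n) + 1 * x)) \<longlonglongrightarrow> (f x :: real)"
    and "filterlim (\<lambda>n. real_of_int (k n)) at_bot sequentially \<Longrightarrow> (\<lambda>n. interface f g (real_of_int (k n) + 1 * x)) \<longlonglongrightarrow> (g x :: real)"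
proof -
  have pf: "f (real_of_int (k n) + 1 * x) = f x" and pg: "g (real_of_int (k n) + 1 * x) = g x" for n
    using periodic_int[of f x "k n"] periodic_int[of g x "k n"] per by (simp_all add: add.commute)
  show "(\<lambda>n. interface f g (real_of_int (k n) + 1 * x)) \<longlonglongrightarrow> f x" if "filterlim (\<lambda>n. real_of_int (k n)) at_top sequentially"
  proof (rule tendsto_eventually)
    have "\<forall>\<^sub>F n in sequentially. - x \<le> real_of_int (k n)" using that by (simp add: filterlim_at_top)
    then show "\<forall>\<^sub>F n in sequentially. interface f g (real_of_int (k n) + 1 * x) = f x"
      by eventually_elim (use pf in \<open>auto simp: interface_def\<close>)
  qed
  show "(\<lambda>n. interface f g (real_of_int (k n) + 1 * x)) \<longlonglongrightarrow> g x" if "filterlim (\<lambda>n. real_of_int (k n)) at_bot sequentially"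
  proof (rule tendsto_eventually)
    have "\<forall>\<^sub>F n in sequentially. real_of_int (k n) \<le> - x - 1" using that by (simp add: filterlim_at_bot)
    then show "\<forall>\<^sub>F n in sequentially. interface f g (real_of_int (k n) + 1 * x) = g x"
      by eventually_elim (use pg in \<open>auto simp: interface_def\<close>)
  qed
qed

lemma form_shift_arg: "form (\<lambda>x. q (t + 1 * x)) P = form q (aff 1 (- t) P)"
  using bil_aff[of 1 q t "aff 1 (- t) P" "aff 1 (- t) P"] by (simp only: aff_inverse simp_thms)

lemma pot_shift_arg: "pot (\<lambda>x. G (t + 1 * x)) p (fst P) = pot G p (fst (aff 1 (- t) P))"
  using pot_aff[of 1 G t p "aff 1 (- t) P"] by (simp only: aff_inverse simp_thms)

lemma pot_normalize:
  assumes p: "p > 1" and P: "P \<in> H1" "0 < pot G p (fst P)"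
  obtains t where "t > 0" "pot G p (fst (t *\<^sub>R P)) = 1" "t\<^sup>2 * pot G p (fst P) powr (2 / (p + 1)) = 1"
proof -
  define c where "c = pot G p (fst P)"
  define t where "t = c powr (- (1 / (p + 1)))"
  have c: "c > 0" using P by (simp add: c_def)
  have t: "t > 0" using c by (simp add: t_def)
  have "t powr (p + 1) = c powr (- 1)" unfolding t_def using p by (simp add: powr_powr)
  then have 1: "pot G p (fst (t *\<^sub>R P)) = 1"
    using pot_scale[of t G p P] t c by (simp add: c_def[symmetric] powr_minus)
  have "t\<^sup>2 = t powr 2" using t by simp
  also have "\<dots> = c powr (- (2 / (p + 1)))" unfolding t_def by (simp add: powr_powr)
  finally have "t\<^sup>2 * c powr (2 / (p + 1)) = 1" using c by (simp add: powr_minus)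
  then show ?thesis using that[OF t 1] by (simp add: c_def)
qed

text \<open>A minimizing sequence is followed at points where it is not small. If their integer
  parts can be taken constant, the interface problem itself has a minimizer; if they tend to plus or
  minus infinity, the limit coefficients are those of the periodic problem on that side, and the
  level \<open>S\<close> is attained there.\<close>

lemma minimizing_sequence_alternative:
  fixes q1 q2 G1 G2 :: "real \<Rightarrow> real"
  assumes p: "p > 1" and q: "q1 \<in> L_infinity" "q2 \<in> L_infinity" and G: "G1 \<in> L_infinity" "G2 \<in> L_infinity"
    and per: "\<And>x. q1 (x + 1) = q1 x" "\<And>x. q2 (x + 1) = q2 x" "\<And>x. G1 (x + 1) = G1 x" "\<And>x. G2 (x + 1) = G2 x"
    and \<delta>: "\<delta> > 0" "\<And>P. P \<in> H1 \<Longrightarrow> \<delta> * nsq (fst P) \<le> form (interface q1 q2) P"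
    and pos: "\<exists>P\<in>H1. 0 < pot (interface G1 G2) p (fst P)"
  shows "\<exists>S>0. (\<forall>P\<in>H1. S * (max 0 (pot (interface G1 G2) p (fst P))) powr (2 / (p + 1)) \<le> form (interface q1 q2) P) \<and>
    ((\<exists>Z\<in>H1. pot (interface G1 G2) p (fst Z) = 1 \<and> form (interface q1 q2) Z = S) \<or>
     (\<exists>W\<in>H1. pot G1 p (fst W) = 1 \<and> form q1 W = S) \<or> (\<exists>W\<in>H1. pot G2 p (fst W) = 1 \<and> form q2 W = S))"
proof -
  define q where "q = interface q1 q2"
  define GI where "GI = interface G1 G2"
  have qL: "q \<in> L_infinity" and GL: "GI \<in> L_infinity" unfolding q_def GI_def using L_infinity_interface q G by auto
  obtain Ka where Ka: "Ka \<ge> 0" "AE x in lebesgue. \<bar>q1 x\<bar> \<le> Ka" "AE x in lebesgue. \<bar>q2 x\<bar> \<le> Ka" using bounded_common[OF q] by blast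
  obtain Kb where Kb: "Kb \<ge> 0" "AE x in lebesgue. \<bar>G1 x\<bar> \<le> Kb" "AE x in lebesgue. \<bar>G2 x\<bar> \<le> Kb" using bounded_common[OF G] by blast
  define K where "K = Ka + Kb"
  have K0: "K \<ge> 0" using Ka Kb by (simp add: K_def)
  have K1: "AE x in lebesgue. \<bar>q1 x\<bar> \<le> K" using Ka(2) by eventually_elim (use Kb in \<open>simp add: K_def\<close>)
  have K2: "AE x in lebesgue. \<bar>q2 x\<bar> \<le> K" using Ka(3) by eventually_elim (use Kb in \<open>simp add: K_def\<close>)
  have Kq: "AE x in lebesgue. \<bar>q x\<bar> \<le> K" using K1 K2 by eventually_elim (auto simp: q_def interface_def)
  have KG: "AE x in lebesgue. \<bar>GI x\<bar> \<le> K" using Kb(2,3) by eventually_elim (use Ka in \<open>auto simp: GI_def K_def interface_def\<close>)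
  note \<delta>q = \<delta>(2)[folded q_def]
  define cc where "cc = 1 + (K + 1) / \<delta>"
  have cc: "cc > 0" using K0 \<delta>(1) by (simp add: cc_def add_pos_nonneg)
  have co: "nsq (snd P) + nsq (fst P) \<le> cc * form q P" if "P \<in> H1" for P
    unfolding cc_def by (rule coercive[OF qL Kq K0 \<delta>(1) \<delta>q[OF that] that])
  have form_nn: "form q P \<ge> 0" if "P \<in> H1" for P
    using \<delta>q[OF that] \<delta>(1) nsq_nonneg[of "fst P"] by (meson less_imp_le mult_nonneg_nonneg order_trans)
  define M where "M = {form q P | P. P \<in> H1 \<and> pot GI p (fst P) = 1}"
  have mem: "form q P \<in> M" if "P \<in> H1" "pot GI p (fst P) = 1" for P unfolding M_def using that by blast
  have Mne: "M \<noteq> {}"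
  proof -
    obtain P where P: "P \<in> H1" "0 < pot GI p (fst P)" using pos unfolding GI_def by blast
    obtain t where "t > 0" "pot GI p (fst (t *\<^sub>R P)) = 1" using pot_normalize[OF p P] by metis
    moreover have "t *\<^sub>R P \<in> H1" using P H1_scale by blast
    ultimately show ?thesis unfolding M_def by blast
  qed
  \<comment> \<open>This bound makes \<open>S\<close> positive. Either the squared H1 norm is at
    most 1, so that \<open>\<bar>fst P\<bar> \<le> 1\<close> and the constraint bounds the L2 norm
    from below, or coercivity gives the bound directly.\<close>
  have low: "form q P \<ge> 1 / (cc * (K + 1))" if P: "P \<in> H1" "pot GI p (fst P) = 1" for P
  proof -
    have "1 \<le> (K + 1) * (cc * form q P)"
    proof (cases "cc * form q P \<le> 1")
      case True
      then have "nsq (snd P) + nsq (fst P) \<le> 1" using co[OF P(1)] by simp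
      then have "\<bar>fst P x\<bar> \<le> 1" for x using H1_abs_bound[OF P(1)] by fastforce
      then have "1 \<le> K * 1 powr (p - 1) * nsq (fst P)" using pot_upper[OF p GL KG K0 P(1)] P(2) by metis
      then have "1 \<le> K * nsq (fst P)" by simp
      also have "\<dots> \<le> (K + 1) * (cc * form q P)"
        using co[OF P(1)] nsq_nonneg[of "snd P"] nsq_nonneg[of "fst P"] K0 by (intro mult_mono) auto
      finally show ?thesis .
    next
      case False
      then have "1 * 1 \<le> (K + 1) * (cc * form q P)" using K0 by (intro mult_mono) auto
      then show ?thesis by simp
    qed
    then have "1 \<le> form q P * (cc * (K + 1))" by (simp only: mult_ac)
    moreover have "cc * (K + 1) > 0" using cc K0 by simp
    ultimately show ?thesis by (simp only: pos_divide_le_eq)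
  qed
  have bdd: "bdd_below M" unfolding M_def using form_nn by (intro bdd_belowI[of _ 0]) auto
  define S where "S = Inf M"
  have S0: "S > 0"
  proof -
    have "1 / (cc * (K + 1)) \<le> S" unfolding S_def using Mne low by (intro cInf_greatest) (auto simp: M_def simp del: fst_scaleR)
    moreover have "1 / (cc * (K + 1)) > 0" using cc K0 by simp
    ultimately show ?thesis by linarith
  qed
  have Sle: "S * (max 0 (pot GI p (fst P))) powr (2 / (p + 1)) \<le> form q P" if P: "P \<in> H1" for P
  proof (cases "0 < pot GI p (fst P)")
    case False
    then show ?thesis using form_nn[OF P] by simp
  next
    case True
    obtain t where t: "t > 0" "pot GI p (fst (t *\<^sub>R P)) = 1" "t\<^sup>2 * pot GI p (fst P) powr (2 / (p + 1)) = 1"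
      using pot_normalize[OF p P True] by metis
    have "t *\<^sub>R P \<in> H1" using P H1_scale by blast
    then have "S \<le> form q (t *\<^sub>R P)" unfolding S_def by (intro cInf_lower mem t(2) bdd)
    then have "S * pot GI p (fst P) powr (2 / (p + 1)) \<le> t\<^sup>2 * form q P * pot GI p (fst P) powr (2 / (p + 1))"
      unfolding form_scale by (rule mult_right_mono) simp
    also have "\<dots> = form q P * (t\<^sup>2 * pot GI p (fst P) powr (2 / (p + 1)))" by (simp only: mult_ac)
    finally show ?thesis using t(3) True by simp
  qed
  have "\<exists>P. P \<in> H1 \<and> pot GI p (fst P) = 1 \<and> form q P < S + 1 / real (Suc n)" for n
  proof -
    have "Inf M < S + 1 / real (Suc n)" by (simp add: S_def)
    then obtain s where "s \<in> M" "s < S + 1 / real (Suc n)" using cInf_lessD[OF Mne] by blast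
    then show ?thesis unfolding M_def by blast
  qed
  then obtain X where X: "\<And>n. X n \<in> H1" "\<And>n. pot GI p (fst (X n)) = 1" "\<And>n. form q (X n) < S + 1 / real (Suc n)" by metis
  have Xlow: "S \<le> form q (X n)" for n
    unfolding S_def by (intro cInf_lower mem X bdd)
  have Xlim: "(\<lambda>n. form q (X n)) \<longlonglongrightarrow> S"
  proof (rule tendsto_sandwich)
    show "\<forall>\<^sub>F n in sequentially. S \<le> form q (X n)" using Xlow by simp
    show "\<forall>\<^sub>F n in sequentially. form q (X n) \<le> S + 1 / real (Suc n)" using X(3) less_imp_le by (intro always_eventually) blast
    show "(\<lambda>n. S + 1 / real (Suc n)) \<longlonglongrightarrow> S" using tendsto_add[OF tendsto_const LIMSEQ_Suc[OF lim_1_over_n], of S] by simp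
  qed simp
  define A where "A = cc * (S + 1)"
  have A0: "A \<ge> 0" using cc S0 by (simp add: A_def)
  have A: "nsq (snd (X n)) + nsq (fst (X n)) \<le> A" for n
  proof -
    have "1 / real (Suc n) \<le> 1" by simp
    then have "form q (X n) \<le> S + 1" using X(3)[of n] by linarith
    then have "cc * form q (X n) \<le> A" unfolding A_def using cc by (intro mult_left_mono) auto
    then show ?thesis using co[OF X(1), of n] by linarith
  qed
  \<comment> \<open>Chosen so that a function of squared norm at most \<open>A\<close> that stays
    below \<epsilon> has \<open>pot \<le> K * A / ((K + 1) * (A + 1)) < 1\<close>, against the
    constraint.\<close>
  define \<epsilon> where "\<epsilon> = (1 / ((K + 1) * (A + 1))) powr (1 / (p - 1))"
  have \<epsilon>: "\<epsilon> > 0" "\<epsilon> powr (p - 1) = 1 / ((K + 1) * (A + 1))"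
    using K0 A0 p by (auto simp: \<epsilon>_def powr_powr)
  have "\<exists>x. \<epsilon> \<le> \<bar>fst (X n) x\<bar>" for n
  proof (rule ccontr)
    assume "\<not> ?thesis"
    then have le: "\<bar>fst (X n) x\<bar> \<le> \<epsilon>" for x by (metis linear)
    have "1 \<le> K * \<epsilon> powr (p - 1) * nsq (fst (X n))" using pot_upper[OF p GL KG K0 X(1) le] X(2) by metis
    also have "\<dots> \<le> K * \<epsilon> powr (p - 1) * A" using A[of n] nsq_nonneg[of "snd (X n)"] K0 by (intro mult_left_mono) auto
    also have "\<dots> = (K * A) / ((K + 1) * (A + 1))" by (simp add: \<epsilon>(2))
    also have "\<dots> < 1"
    proof -
      have "K * A < (K + 1) * (A + 1)" using K0 A0 by (simp add: algebra_simps add_nonneg_pos)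
      moreover have "(K + 1) * (A + 1) > 0" using K0 A0 by simp
      ultimately show ?thesis by simp
    qed
    finally show False by simp
  qed
  then obtain x where x: "\<And>n. \<epsilon> \<le> \<bar>fst (X n) (x n)\<bar>" by metis
  \<comment> \<open>Translation by integers leaves the periodic coefficients unchanged, and the
    fractional parts stay in a compact interval.\<close>
  define k where "k n = \<lfloor>x n\<rfloor>" for n
  obtain r1 where r1: "strict_mono r1" "(\<exists>c. \<forall>n. k (r1 n) = c) \<or> filterlim (\<lambda>n. real_of_int (k (r1 n))) at_top sequentially
    \<or> filterlim (\<lambda>n. real_of_int (k (r1 n))) at_bot sequentially" using int_sequence_subsequence[of k] by blast
  define z where "z n = x (r1 n) - of_int (k (r1 n))" for n
  have z01: "z n \<in> {0..1}" for n unfolding z_def k_def by (simp; linarith)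
  obtain z0 r2 where r2: "strict_mono r2" "(z \<circ> r2) \<longlonglongrightarrow> z0"
    using compact_Icc[of 0 "1::real"] z01 unfolding compact_def by blast
  define X' where "X' n = aff 1 (of_int (k (r1 (r2 n)))) (X (r1 (r2 n)))" for n
  have X'H: "X' n \<in> H1" for n unfolding X'_def by (intro aff_H1 X(1)) simp
  have sndaff: "nsq (snd (aff 1 t P)) = nsq (snd P)" for t P
    unfolding nsq_def aff_def by (subst lebesgue_integral_real_affine[of 1 "\<lambda>x. (snd P x)\<^sup>2" t]) auto
  have X'A: "nsq (snd (X' n)) + nsq (fst (X' n)) \<le> A" for n
    unfolding X'_def using A by (simp add: sndaff nsq_aff)
  obtain r3 \<phi> where r3: "strict_mono r3" "\<And>x. (\<lambda>n. fst (X' (r3 n)) x) \<longlonglongrightarrow> \<phi> x"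
    using H1_pointwise_subsequence[of X' A, OF X'H X'A] by blast
  define r where "r n = r1 (r2 (r3 n))" for n
  have mono: "strict_mono r" "strict_mono (\<lambda>n. r2 (r3 n))" using r1 r2 r3 by (auto simp: strict_mono_def r_def)
  have main: "\<exists>y\<in>H1. pot GG p (fst y) = 1 \<and> form Q y = S"
    if Q: "Q \<in> L_infinity" "AE x in lebesgue. \<bar>Q x\<bar> \<le> K" "GG \<in> L_infinity"
      and lq: "\<And>x. (\<lambda>n. q (of_int (k (r1 n)) + 1 * x)) \<longlonglongrightarrow> Q x" and lG: "\<And>x. (\<lambda>n. GI (of_int (k (r1 n)) + 1 * x)) \<longlonglongrightarrow> GG x" for Q GG
  proof (rule translated_minimizing_sequence[where q="\<lambda>n x. q (of_int (k (r n)) + 1 * x)" and G="\<lambda>n x. GI (of_int (k (r n)) + 1 * x)"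
        and X="\<lambda>n. X' (r3 n)" and z="\<lambda>n. z (r2 (r3 n))" and K=K and \<delta>=\<delta> and S=S and \<epsilon>=\<epsilon> and ?z0.0=z0 and \<phi>=\<phi>, OF p K0])
    show "(\<lambda>x. q (of_int (k (r n)) + 1 * x)) \<in> L_infinity" "(\<lambda>x. GI (of_int (k (r n)) + 1 * x)) \<in> L_infinity" for n
      using L_infinity_affine[OF qL] L_infinity_affine[OF GL] by blast+
    show "AE x in lebesgue. \<bar>q (of_int (k (r n)) + 1 * x)\<bar> \<le> K" "AE x in lebesgue. \<bar>GI (of_int (k (r n)) + 1 * x)\<bar> \<le> K" for n
      using AE_lebesgue_affine[OF Kq, of 1] AE_lebesgue_affine[OF KG, of 1] by blast+
    show "(\<lambda>n. q (of_int (k (r n)) + 1 * x)) \<longlonglongrightarrow> Q x" "(\<lambda>n. GI (of_int (k (r n)) + 1 * x)) \<longlonglongrightarrow> GG x" for x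
      using LIMSEQ_subseq_LIMSEQ[OF lq mono(2)] LIMSEQ_subseq_LIMSEQ[OF lG mono(2)] by (simp_all add: o_def r_def)
    fix P :: "(real \<Rightarrow> real) \<times> (real \<Rightarrow> real)" and n assume P: "P \<in> H1"
    let ?t = "of_int (k (r n)) :: real"
    have aP: "aff 1 (- ?t) P \<in> H1" using P by (intro aff_H1) auto
    show "\<delta> * nsq (fst P) \<le> form (\<lambda>x. q (?t + 1 * x)) P"
      using \<delta>q[OF aP] nsq_aff[of 1 "- ?t" P] unfolding form_shift_arg by simp
    show "S * (max 0 (pot (\<lambda>x. GI (?t + 1 * x)) p (fst P))) powr (2 / (p + 1)) \<le> form (\<lambda>x. q (?t + 1 * x)) P"
      using Sle[OF aP] unfolding form_shift_arg pot_shift_arg .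
  next
    have X'r: "X' (r3 n) = aff 1 (of_int (k (r n))) (X (r n))" for n by (simp add: X'_def r_def)
    show "pot (\<lambda>x. GI (of_int (k (r n)) + 1 * x)) p (fst (X' (r3 n))) = 1" for n
      unfolding X'r pot_shift_arg aff_inverse by (rule X(2))
    show "(\<lambda>n. form (\<lambda>x. q (of_int (k (r n)) + 1 * x)) (X' (r3 n))) \<longlonglongrightarrow> S"
      unfolding X'r form_shift_arg aff_inverse using LIMSEQ_subseq_LIMSEQ[OF Xlim mono(1)] by (simp add: o_def)
    show "\<epsilon> \<le> \<bar>fst (X' (r3 n)) (z (r2 (r3 n)))\<bar>" for n
      unfolding X'r using x[of "r n"] by (simp add: aff_def z_def r_def)
    show "(\<lambda>n. z (r2 (r3 n))) \<longlonglongrightarrow> z0" using LIMSEQ_subseq_LIMSEQ[OF r2(2) r3(1)] by (simp add: o_def)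
  qed (use Q \<delta>(1) S0 X'H z01 \<epsilon>(1) r3(2) in auto)
  have "(\<exists>Z\<in>H1. pot GI p (fst Z) = 1 \<and> form q Z = S) \<or>
     (\<exists>W\<in>H1. pot G1 p (fst W) = 1 \<and> form q1 W = S) \<or> (\<exists>W\<in>H1. pot G2 p (fst W) = 1 \<and> form q2 W = S)"
    using r1(2)
  proof (elim disjE exE)
    \<comment> \<open>Here the limit problem is the interface problem translated by
      \<open>c\<close>; its minimizer is translated back.\<close>
    fix c assume c: "\<forall>n. k (r1 n) = c"
    let ?t = "of_int c :: real"
    have "\<exists>y\<in>H1. pot (\<lambda>x. GI (?t + 1 * x)) p (fst y) = 1 \<and> form (\<lambda>x. q (?t + 1 * x)) y = S"
    proof (rule main)
      show "(\<lambda>x. q (?t + 1 * x)) \<in> L_infinity" "(\<lambda>x. GI (?t + 1 * x)) \<in> L_infinity"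
        using L_infinity_affine[OF qL] L_infinity_affine[OF GL] by blast+
      show "AE x in lebesgue. \<bar>q (?t + 1 * x)\<bar> \<le> K" using AE_lebesgue_affine[OF Kq, of 1] by blast
    qed (use c in auto)
    then obtain y where y: "y \<in> H1" "pot GI p (fst (aff 1 (- ?t) y)) = 1" "form q (aff 1 (- ?t) y) = S"
      unfolding form_shift_arg pot_shift_arg by blast
    moreover have "aff 1 (- ?t) y \<in> H1" using y by (intro aff_H1) auto
    ultimately show ?thesis by blast
  next
    assume "filterlim (\<lambda>n. real_of_int (k (r1 n))) at_top sequentially"
    then have "\<exists>y\<in>H1. pot G1 p (fst y) = 1 \<and> form q1 y = S"
      by (intro main q G K1) (auto simp: q_def GI_def intro!: interface_shift_limit(1)[simplified] per)
    then show ?thesis by blast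
  next
    assume "filterlim (\<lambda>n. real_of_int (k (r1 n))) at_bot sequentially"
    then have "\<exists>y\<in>H1. pot G2 p (fst y) = 1 \<and> form q2 y = S"
      by (intro main q G K2) (auto simp: q_def GI_def intro!: interface_shift_limit(2)[simplified] per)
    then show ?thesis by blast
  qed
  then show ?thesis using S0 Sle unfolding q_def GI_def by blast
qed

section \<open>From the constrained problem to the Nehari manifold\<close>

lemma nehari_energy_integrals:
  assumes p: "p > 1" and V: "V \<in> L_infinity" and G: "G \<in> L_infinity" and P: "P \<in> H1"
    and u: "AE x in lebesgue. u x = fst P x" "AE x in lebesgue. weak_deriv u x = snd P x"
    and m: "u \<in> borel_measurable lebesgue" "weak_deriv u \<in> borel_measurable lebesgue"
  shows "(LINT x|lebesgue. \<bar>weak_deriv u x\<bar>\<^sup>2 + (V x - lam) * (u x)\<^sup>2 - G x * \<bar>u x\<bar> powr (p + 1))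
      = form (\<lambda>x. V x - lam) P - pot G p (fst P)" (is ?a)
    and "energy V lam G p u = 1/2 * form (\<lambda>x. V x - lam) P - 1/(p + 1) * pot G p (fst P)" (is ?b)
proof -
  have Vl: "(\<lambda>x. V x - lam) \<in> L_infinity" using L_infinity_shift[OF V] .
  have Vm: "V \<in> borel_measurable lebesgue" "G \<in> borel_measurable lebesgue" using V G by (auto simp: L_infinity_def)
  have Pm: "fst P \<in> borel_measurable lebesgue" "snd P \<in> borel_measurable lebesgue" using P H1_D L2_D by blast+
  have i: "integrable lebesgue (\<lambda>x. snd P x * snd P x + (V x - lam) * (fst P x * fst P x))" by (rule bil_integrable[OF Vl P P])
  have j: "integrable lebesgue (\<lambda>x. G x * \<bar>fst P x\<bar> powr (p + 1))" by (intro L_infinity_mult_integrable G H1_powr_integrable p P)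
  have "(LINT x|lebesgue. \<bar>weak_deriv u x\<bar>\<^sup>2 + (V x - lam) * (u x)\<^sup>2 - G x * \<bar>u x\<bar> powr (p + 1))
    = (LINT x|lebesgue. (snd P x * snd P x + (V x - lam) * (fst P x * fst P x)) - G x * \<bar>fst P x\<bar> powr (p + 1))"
  proof (rule integral_cong_AE)
    show "AE x in lebesgue. \<bar>weak_deriv u x\<bar>\<^sup>2 + (V x - lam) * (u x)\<^sup>2 - G x * \<bar>u x\<bar> powr (p + 1)
      = (snd P x * snd P x + (V x - lam) * (fst P x * fst P x)) - G x * \<bar>fst P x\<bar> powr (p + 1)"
      using u by eventually_elim (simp add: power2_eq_square)
  qed (use m Pm Vm i j in measurable)
  then show ?a using i j by (simp add: bil_def pot_def)
  have "energy V lam G p u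
    = (LINT x|lebesgue. 1/2 * (snd P x * snd P x + (V x - lam) * (fst P x * fst P x)) - 1/(p + 1) * (G x * \<bar>fst P x\<bar> powr (p + 1)))"
    unfolding energy_def
  proof (rule integral_cong_AE)
    show "AE x in lebesgue. 1/2 * (\<bar>weak_deriv u x\<bar>\<^sup>2 + (V x - lam) * (u x)\<^sup>2) - 1/(p + 1) * G x * \<bar>u x\<bar> powr (p + 1)
      = 1/2 * (snd P x * snd P x + (V x - lam) * (fst P x * fst P x)) - 1/(p + 1) * (G x * \<bar>fst P x\<bar> powr (p + 1))"
      using u by eventually_elim (simp add: power2_eq_square)
  qed (use m Pm Vm i j in measurable)
  also have "\<dots> = 1/2 * form (\<lambda>x. V x - lam) P - 1/(p + 1) * pot G p (fst P)"
    unfolding bil_def pot_def using i j by (subst Bochner_Integration.integral_diff) auto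
  finally show ?b .
qed

text \<open>On the Nehari manifold form and \<open>pot\<close> have a common value
  \<open>N'\<close>, and the energy is the positive multiple \<open>1/2 - 1/(p + 1)\<close> of it.
  The inequality for \<open>S\<close> then says \<open>N' powr (1 - \<alpha>) \<ge> S\<close>, with
  equality for the rescaled \<open>Z\<close>.\<close>

lemma strong_ground_state_of_minimizer:
  assumes p: "p > 1" and V: "V \<in> L_infinity" and G: "G \<in> L_infinity"
    and \<delta>: "\<delta> > 0" "\<And>P. P \<in> H1 \<Longrightarrow> \<delta> * nsq (fst P) \<le> form (\<lambda>x. V x - lam) P"
    and S: "S > 0" "\<And>P. P \<in> H1 \<Longrightarrow> S * (max 0 (pot G p (fst P))) powr (2 / (p + 1)) \<le> form (\<lambda>x. V x - lam) P"
    and Z: "Z \<in> H1" "0 < pot G p (fst Z)" "form (\<lambda>x. V x - lam) Z \<le> S * pot G p (fst Z) powr (2 / (p + 1))"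
  shows "\<exists>u. strong_ground_state V lam G p u"
proof -
  let ?q = "\<lambda>x. V x - lam"
  define \<alpha> where "\<alpha> = 2 / (p + 1)"
  have \<alpha>: "0 < \<alpha>" "\<alpha> < 1" using p by (auto simp: \<alpha>_def)
  define f where "f = form ?q Z"
  define g where "g = pot G p (fst Z)"
  have g: "g > 0" using Z by (simp add: g_def)
  have fS: "f = S * g powr \<alpha>" using S(2)[OF Z(1)] Z(2,3) by (simp add: f_def g_def \<alpha>_def)
  have f: "f > 0" unfolding fS using S(1) g by simp
  \<comment> \<open>The solution of \<open>t\<^sup>2 * f = t powr (p + 1) * g\<close>, which puts
    \<open>t *\<^sub>R Z\<close> on the Nehari manifold.\<close>
  define t where "t = (f / g) powr (1 / (p - 1))"
  have t: "t > 0" using f g by (simp add: t_def)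
  have tp: "t powr (p - 1) = f / g" using p f g by (simp add: t_def powr_powr)
  have tsplit: "t powr (p + 1) = t powr (p - 1) * t\<^sup>2"
  proof -
    have "t powr (p + 1) = t powr (p - 1) * t powr 2" by (subst powr_add[symmetric]) (simp add: add.commute)
    then show ?thesis using t by simp
  qed
  define P where "P = t *\<^sub>R Z"
  have P: "P \<in> H1" unfolding P_def using Z H1_scale by blast
  define N where "N = t\<^sup>2 * f"
  have N: "N > 0" using t f by (simp add: N_def)
  have PN: "form ?q P = N" "pot G p (fst P) = N"
  proof -
    show "form ?q P = N" unfolding P_def form_scale by (simp add: N_def f_def)
    have "pot G p (fst P) = t powr (p + 1) * g" unfolding P_def g_def using t by (intro pot_scale) simp
    then show "pot G p (fst P) = N" using g by (simp add: tsplit tp N_def)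
  qed
  have NS: "N = S * N powr \<alpha>"
  proof -
    have "N powr \<alpha> = (t powr (p + 1)) powr \<alpha> * g powr \<alpha>"
    proof -
      have "N = t powr (p + 1) * g" using g by (simp add: N_def tsplit tp)
      then show ?thesis using t g by (simp add: powr_mult)
    qed
    also have "(t powr (p + 1)) powr \<alpha> = t\<^sup>2" 
    proof -
      have "(p + 1) * \<alpha> = 2" using p unfolding \<alpha>_def by (simp only: times_divide_eq_right nonzero_mult_div_cancel_left)
      then show ?thesis using t by (simp add: powr_powr)
    qed
    finally show ?thesis unfolding N_def fS by simp
  qed
  define u where "u = fst P"
  note uP = H1_imp_H1_space[OF P, folded u_def]
  have um: "u \<in> borel_measurable lebesgue" unfolding u_def using P H1_D L2_D by blast
  have uI: "(LINT x|lebesgue. \<bar>weak_deriv u x\<bar>\<^sup>2 + (V x - lam) * (u x)\<^sup>2 - G x * \<bar>u x\<bar> powr (p + 1)) = N - N"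
    and uE: "energy V lam G p u = 1/2 * N - 1/(p + 1) * N"
    using nehari_energy_integrals[OF p V G P _ uP(2) um uP(3), of lam] PN by (auto simp: u_def)
  have "\<not> (AE x in lebesgue. u x = 0)"
  proof
    assume ae: "AE x in lebesgue. u x = 0"
    have "pot G p (fst P) = (LINT (x::real)|lebesgue. (0::real))" unfolding pot_def
    proof (rule integral_cong_AE)
      show "(\<lambda>x. G x * \<bar>fst P x\<bar> powr (p + 1)) \<in> borel_measurable lebesgue"
        by (intro borel_measurable_integrable L_infinity_mult_integrable G H1_powr_integrable p P)
      show "AE x in lebesgue. G x * \<bar>fst P x\<bar> powr (p + 1) = 0" using ae by eventually_elim (use p in \<open>simp add: u_def\<close>)
    qed simp
    then show False using PN(2) N by simp
  qed
  then have "u \<in> nehari_manifold V lam G p" using uP(1) uI by (simp add: nehari_manifold_def)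
  moreover have "energy V lam G p u \<le> energy V lam G p v" if v: "v \<in> nehari_manifold V lam G p" for v
  proof -
    have vH: "v \<in> H1_space" and v0: "\<not> (AE x in lebesgue. v x = 0)"
      and vI: "(LINT x|lebesgue. \<bar>weak_deriv v x\<bar>\<^sup>2 + (V x - lam) * (v x)\<^sup>2 - G x * \<bar>v x\<bar> powr (p + 1)) = 0"
      using v by (auto simp: nehari_manifold_def)
    obtain P' where P': "P' \<in> H1" "AE x in lebesgue. v x = fst P' x" "AE x in lebesgue. weak_deriv v x = snd P' x"
      "weak_deriv v \<in> borel_measurable lebesgue" using H1_space_weak_deriv[OF vH] by blast
    have vm: "v \<in> borel_measurable lebesgue" using vH by (auto simp: H1_space_def L2_def)
    define N' where "N' = form ?q P'"
    have pN': "pot G p (fst P') = N'" and vE: "energy V lam G p v = 1/2 * N' - 1/(p + 1) * N'"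
      using nehari_energy_integrals[OF p V G P'(1-3) vm P'(4), of lam] vI by (auto simp: N'_def)
    have "nsq (fst P') \<noteq> 0"
    proof
      assume "nsq (fst P') = 0"
      then have "AE x in lebesgue. (fst P' x)\<^sup>2 = 0"
        unfolding nsq_def using L2_D[OF H1_D(2)[OF P'(1)]] by (subst (asm) integral_nonneg_eq_0_iff_AE) auto
      then have "AE x in lebesgue. v x = 0" using P'(2) by eventually_elim simp
      then show False using v0 by blast
    qed
    then have "\<delta> * nsq (fst P') > 0" using \<delta>(1) nsq_nonneg[of "fst P'"] by simp
    then have N'0: "N' > 0" using \<delta>(2)[OF P'(1)] by (simp add: N'_def)
    have N'S: "S * N' powr \<alpha> \<le> N'" using S(2)[OF P'(1)] pN' N'0 by (simp add: N'_def \<alpha>_def)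
    have split: "x = x powr \<alpha> * x powr (1 - \<alpha>)" if "x > 0" for x :: real
      using that by (simp flip: powr_add)
    have "N powr (1 - \<alpha>) = S"
      using NS split[OF N] N by (metis mult.commute mult_cancel_left powr_gt_zero less_irrefl)
    moreover have "S \<le> N' powr (1 - \<alpha>)"
    proof -
      have "N' powr \<alpha> * S \<le> N' powr \<alpha> * N' powr (1 - \<alpha>)" using N'S split[OF N'0] by (simp add: mult.commute)
      then show ?thesis using N'0 by (simp add: mult_le_cancel_left_pos)
    qed
    ultimately have "N powr (1 - \<alpha>) \<le> N' powr (1 - \<alpha>)" by simp
    then have le: "N \<le> N'" using powr_less_mono2[of "1 - \<alpha>" N' N] \<alpha> N'0 by (metis diff_gt_0_iff_gt less_imp_le not_le)
    then have "(1/2 - 1/(p + 1)) * N \<le> (1/2 - 1/(p + 1)) * N'"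
      using p by (intro mult_left_mono) (auto simp: field_simps)
    then show ?thesis unfolding uE vE by (simp only: left_diff_distrib)
  qed
  ultimately show ?thesis unfolding strong_ground_state_def by blast
qed

section \<open>Reflection, and bounds inherited by the periodic problems\<close>

lemma form_cong_AE:
  assumes "AE x in lebesgue. q x = r x" "q \<in> L_infinity" "r \<in> L_infinity" "P \<in> H1"
  shows "form q P = form r P"
  unfolding bil_def
proof (rule integral_cong_AE)
  show "AE x in lebesgue. snd P x * snd P x + q x * (fst P x * fst P x) = snd P x * snd P x + r x * (fst P x * fst P x)"
    using assms(1) by eventually_elim simp
qed (use bil_integrable[OF assms(2,4,4)] bil_integrable[OF assms(3,4,4)] in auto)

lemma pot_cong_AE:
  assumes "AE x in lebesgue. G x = H x" "G \<in> L_infinity" "H \<in> L_infinity" "P \<in> H1" "p > 1"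
  shows "pot G p (fst P) = pot H p (fst P)"
  unfolding pot_def
proof (rule integral_cong_AE)
  show "AE x in lebesgue. G x * \<bar>fst P x\<bar> powr (p + 1) = H x * \<bar>fst P x\<bar> powr (p + 1)"
    using assms(1) by eventually_elim simp
qed (intro borel_measurable_integrable L_infinity_mult_integrable H1_powr_integrable assms)+

lemma form_reflect: "form (\<lambda>x. q (- x)) P = form q (aff (-1) 0 P)"
  using bil_aff[of "-1" q 0 "aff (-1) 0 P" "aff (-1) 0 P"] by (simp add: aff_inverse)

lemma pot_reflect: "pot (\<lambda>x. G (- x)) p (fst P) = pot G p (fst (aff (-1) 0 P))"
  using pot_aff[of "-1" G 0 p "aff (-1) 0 P"] by (simp add: aff_inverse)

lemma L_infinity_reflect: "q \<in> L_infinity \<Longrightarrow> (\<lambda>x. q (- x)) \<in> L_infinity"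
  using L_infinity_affine[of q "-1" 0] by simp

lemma ode_solution_reflect:
  assumes "ode_solution q u" shows "ode_solution (\<lambda>x. q (- x)) (\<lambda>x. u (- x))"
proof -
  obtain u' where u': "\<And>x. (u has_real_derivative u' x) (at x)"
    "\<And>x y. x \<le> y \<Longrightarrow> set_integrable lebesgue {x..y} (\<lambda>x. q x * u x)"
    "\<And>x y. x \<le> y \<Longrightarrow> u' y - u' x = (LINT t:{x..y}|lebesgue. q t * u t)"
    using assms unfolding ode_solution_def by metis
  have "set_integrable lebesgue {x..y} (\<lambda>x. q x * u x)" for x y
    using u'(2)[of x y] by (cases "x \<le> y") (auto simp: set_integrable_def)
  then have "AC u' (\<lambda>x. q x * u x)" using u'(3) by (simp add: AC_def)
  from AC_scale[OF AC_affine[OF this, of "-1" 0], of "-1"]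
  have A: "AC (\<lambda>x. - u' (- x)) (\<lambda>x. q (- x) * u (- x))" by simp
  have "((\<lambda>x. u (- x)) has_real_derivative - u' (- x)) (at x)" for x
    using DERIV_chain2[OF u'(1)[of "- x"] DERIV_minus[OF DERIV_ident]] by simp
  then show ?thesis unfolding ode_solution_def using A AC_eq[OF A] AC_integrable[OF A]
    by (intro exI[of _ "\<lambda>x. - u' (- x)"]) auto
qed

lemma bloch_mode_step:
  assumes "bloch_mode W lam k u"
  shows "ode_solution (\<lambda>x. W x - lam) u" "\<exists>x. u x \<noteq> 0" "u (x + 1) = exp k * u x"
proof -
  obtain p where p: "\<And>x. p (x + 1) = p x" "\<And>x. u x = p x * exp (k * x)"
    using assms by (auto simp: bloch_mode_def)
  have "k * (x + 1) = k + k * x" by (simp add: algebra_simps)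
  then show "u (x + 1) = exp k * u x" using p by (simp add: exp_add)
qed (use assms in \<open>auto simp: bloch_mode_def\<close>)

text \<open>The lower bound holds for all translates of the interface form with the same constant,
  and translation far to either side converges to a periodic form on each fixed element.\<close>

lemma form_bound_limits:
  fixes q1 q2 :: "real \<Rightarrow> real"
  assumes q: "q1 \<in> L_infinity" "q2 \<in> L_infinity" and per: "\<And>x. q1 (x + 1) = q1 x" "\<And>x. q2 (x + 1) = q2 x"
    and \<delta>: "\<And>P. P \<in> H1 \<Longrightarrow> \<delta> * nsq (fst P) \<le> form (interface q1 q2) P" and P: "P \<in> H1"
  shows "\<delta> * nsq (fst P) \<le> form q1 P" "\<delta> * nsq (fst P) \<le> form q2 P"
proof -
  let ?q = "interface q1 q2"
  have qL: "?q \<in> L_infinity" using L_infinity_interface q by blast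
  obtain K where K: "AE x in lebesgue. \<bar>?q x\<bar> \<le> K" using qL by (auto simp: L_infinity_def)
  have L: "(\<lambda>x. ?q (real_of_int (k n) + 1 * x)) \<in> L_infinity" "AE x in lebesgue. \<bar>?q (real_of_int (k n) + 1 * x)\<bar> \<le> K" for k :: "nat \<Rightarrow> int" and n
    using L_infinity_affine[OF qL] AE_lebesgue_affine[OF K, of 1] by blast+
  have low: "\<delta> * nsq (fst P) \<le> form (\<lambda>x. ?q (real_of_int (k n) + 1 * x)) P" for k :: "nat \<Rightarrow> int" and n
    unfolding form_shift_arg using \<delta>[OF aff_H1[OF P, of 1 "- real_of_int (k n)"]] by (simp add: nsq_aff)
  have up: "filterlim (\<lambda>n. real_of_int (int n)) at_top sequentially" by (simp add: filterlim_real_sequentially)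
  have dn: "filterlim (\<lambda>n. real_of_int (- int n)) at_bot sequentially"
    using filterlim_real_sequentially by (simp add: filterlim_uminus_at_top)
  show "\<delta> * nsq (fst P) \<le> form q1 P"
    by (rule LIMSEQ_le_const[OF form_tendsto[where q="\<lambda>n x. ?q (real_of_int (int n) + 1 * x)" and Q=q1, OF L[where k=int] interface_shift_limit(1)[where f=q1 and g=q2 and k=int, OF per up] q(1) P]]) (use low in blast)
  show "\<delta> * nsq (fst P) \<le> form q2 P"
    by (rule LIMSEQ_le_const[OF form_tendsto[where q="\<lambda>n x. ?q (real_of_int (- int n) + 1 * x)" and Q=q2, OF L[where k="\<lambda>n. - int n"] interface_shift_limit(2)[where f=q1 and g=q2 and k="\<lambda>n. - int n", OF per dn] q(2) P]]) (use low in blast)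
qed

text \<open>For almost every \<open>x\<close> all translates of \<open>x\<close> by natural numbers
  avoid the exceptional set. One of them lies on the right of the interface, where periodicity
  identifies the value with that of \<open>\<Gamma>0\<close> at \<open>x\<close>.\<close>

lemma interface_not_AE_nonpos:
  fixes \<Gamma>0 :: "real \<Rightarrow> real"
  assumes G: "\<Gamma>0 \<in> L_infinity" and per: "\<And>x. \<Gamma>0 (x + 1) = \<Gamma>0 x" and pos: "0 < esssup lebesgue (\<lambda>x. ereal (\<Gamma>0 x))"
  shows "\<not> (AE x in lebesgue. interface (\<lambda>x. \<Gamma>0 (x + a)) g x \<le> 0)"
proof
  assume le: "AE x in lebesgue. interface (\<lambda>x. \<Gamma>0 (x + a)) g x \<le> 0"
  have "AE x in lebesgue. interface (\<lambda>x. \<Gamma>0 (x + a)) g (real n - a + 1 * x) \<le> 0" for n :: nat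
    using AE_lebesgue_affine[OF le, of 1] by blast
  then have "AE x in lebesgue. \<forall>n::nat. interface (\<lambda>x. \<Gamma>0 (x + a)) g (real n - a + 1 * x) \<le> 0" by (simp add: AE_all_countable)
  then have "AE x in lebesgue. ereal (\<Gamma>0 x) \<le> 0"
  proof eventually_elim
    case (elim x)
    obtain n :: nat where n: "a - x \<le> real n" using real_arch_simple by blast
    have "\<Gamma>0 (real n - a + 1 * x + a) = \<Gamma>0 x" using periodic_int[of \<Gamma>0 x "int n", OF per] by (simp add: algebra_simps)
    then show ?case using elim[rule_format, of n] n by (simp add: interface_def)
  qed
  moreover have "(\<lambda>x. ereal (\<Gamma>0 x)) \<in> borel_measurable lebesgue" using G by (auto simp: L_infinity_def)
  ultimately have "esssup lebesgue (\<lambda>x. ereal (\<Gamma>0 x)) \<le> 0" by (intro esssup_I)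
  then show False using pos by simp
qed

theorem corollary3:
  fixes V0 V1 V2 V u1 u2 :: "real \<Rightarrow> real"
    and \<tau>1 \<tau>2 lam m I1 I2 :: real
  assumes "V0 \<in> L_infinity" and "\<forall>x. V0 (x + 1) = V0 x"
    and "\<tau>1 \<in> {0..1}" and "\<tau>2 \<in> {0..1}"
    and "V1 = (\<lambda>x. V0 (x + \<tau>1))" and "V2 = (\<lambda>x. V0 (x - \<tau>2))"
    and "V = interface V1 V2"
    and "is_minimum m (schroedinger_spectrum V)" and "lam < m"
    and "bloch_mode_decaying_at_minus_infinity V1 lam u1"
    and "bloch_mode_decaying_at_plus_infinity V2 lam u2"
    and "I1 = (LINT x:{-1..0}|lebesgue. (V2 x - V1 x) * (u1 x)\<^sup>2)"
    and "I2 = (LINT x:{0..1}|lebesgue. (V1 x - V2 x) * (u2 x)\<^sup>2)"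
    and "I1 < 0 \<or> I2 < 0"
  shows "\<forall>(p::real) \<Gamma>0.
           1 < p \<and> \<Gamma>0 \<in> L_infinity \<and> (\<forall>x. \<Gamma>0 (x + 1) = \<Gamma>0 x) \<and>
           0 < esssup lebesgue (\<lambda>x. ereal (\<Gamma>0 x)) \<longrightarrow>
           (\<exists>u. strong_ground_state V lam
                  (interface (\<lambda>x. \<Gamma>0 (x + \<tau>1)) (\<lambda>x. \<Gamma>0 (x - \<tau>2))) p u)"
proof (intro allI impI, elim conjE)
  fix p :: real and \<Gamma>0 :: "real \<Rightarrow> real"
  assume p: "1 < p" and \<Gamma>: "\<Gamma>0 \<in> L_infinity" and \<Gamma>per: "\<forall>x. \<Gamma>0 (x + 1) = \<Gamma>0 x"
    and \<Gamma>pos: "0 < esssup lebesgue (\<lambda>x. ereal (\<Gamma>0 x))"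
  have shiftL: "(\<lambda>x. f (x + \<tau>1)) \<in> L_infinity" "(\<lambda>x. f (x - \<tau>2)) \<in> L_infinity" if "f \<in> L_infinity" for f
    using L_infinity_affine[OF that, of 1 \<tau>1] L_infinity_affine[OF that, of 1 "- \<tau>2"] by (simp_all add: add.commute)
  have shiftper: "f (x + 1 + \<tau>1) = f (x + \<tau>1)" "f (x + 1 - \<tau>2) = f (x - \<tau>2)" if "\<forall>x. f (x + 1) = f x" for f :: "real \<Rightarrow> real" and x
    using that[rule_format, of "x + \<tau>1"] that[rule_format, of "x - \<tau>2"] by (simp_all add: algebra_simps)
  define q1 where "q1 x = V1 x - lam" for x
  define q2 where "q2 x = V2 x - lam" for x
  define G1 where "G1 x = \<Gamma>0 (x + \<tau>1)" for x
  define G2 where "G2 x = \<Gamma>0 (x - \<tau>2)" for x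
  have VL: "V1 \<in> L_infinity" "V2 \<in> L_infinity" unfolding assms(5,6) using shiftL[OF assms(1)] by auto
  have VV: "V \<in> L_infinity" unfolding assms(7) using L_infinity_interface VL by blast
  have qL: "q1 \<in> L_infinity" "q2 \<in> L_infinity" unfolding q1_def q2_def using L_infinity_shift VL by auto
  have GL: "G1 \<in> L_infinity" "G2 \<in> L_infinity" unfolding G1_def G2_def using shiftL[OF \<Gamma>] by auto
  have per: "q1 (x + 1) = q1 x" "q2 (x + 1) = q2 x" "G1 (x + 1) = G1 x" "G2 (x + 1) = G2 x" for x
    unfolding q1_def q2_def G1_def G2_def assms(5,6) using shiftper[OF assms(2)] shiftper[OF \<Gamma>per] by auto
  have qV: "interface q1 q2 = (\<lambda>x. V x - lam)" by (auto simp: assms(7) interface_def q1_def q2_def fun_eq_iff)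
  define G where "G = interface (\<lambda>x. \<Gamma>0 (x + \<tau>1)) (\<lambda>x. \<Gamma>0 (x - \<tau>2))"
  have GI: "interface G1 G2 = G" unfolding G_def G1_def[abs_def] G2_def[abs_def] ..
  have G: "G \<in> L_infinity" unfolding GI[symmetric] using L_infinity_interface GL by blast
  define \<delta> where "\<delta> = m - lam"
  have \<delta>: "\<delta> > 0" using assms(9) by (simp add: \<delta>_def)
  \<comment> \<open>The only use of the spectrum: its minimum bounds the form of \<open>V\<close>
    from below, and the distance to \<open>lam\<close> is the constant \<delta>.\<close>
  have low: "\<delta> * nsq (fst P) \<le> form (interface q1 q2) P" if "P \<in> H1" for P
  proof -
    have "m * nsq (fst P) \<le> form V P"
      using assms(8) by (intro spectral_bound[OF VV _ that]) (auto simp: is_minimum_def)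
    then show ?thesis unfolding qV form_shift[OF VV that] \<delta>_def by (simp add: left_diff_distrib)
  qed
  have low1: "\<delta> * nsq (fst P) \<le> form q1 P" and low2: "\<delta> * nsq (fst P) \<le> form q2 P" if "P \<in> H1" for P
    using form_bound_limits[OF qL per(1,2) low that] by auto
  have "\<exists>P\<in>H1. 0 < pot (interface G1 G2) p (fst P)"
    unfolding GI using interface_not_AE_nonpos[OF \<Gamma> _ \<Gamma>pos] \<Gamma>per unfolding G_def[symmetric]
    by (intro pot_positive_exists p G) (auto simp: G_def)
  then obtain S where S: "S > 0" "\<And>P. P \<in> H1 \<Longrightarrow> S * (max 0 (pot (interface G1 G2) p (fst P))) powr (2 / (p + 1)) \<le> form (interface q1 q2) P"
    and alt: "(\<exists>Z\<in>H1. pot (interface G1 G2) p (fst Z) = 1 \<and> form (interface q1 q2) Z = S) \<or>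
     (\<exists>W\<in>H1. pot G1 p (fst W) = 1 \<and> form q1 W = S) \<or> (\<exists>W\<in>H1. pot G2 p (fst W) = 1 \<and> form q2 W = S)"
    using minimizing_sequence_alternative[OF p qL GL per \<delta> low] by metis
  \<comment> \<open>The two periodic problems are translates of each other by this amount, since
    \<open>V1 x = V0 (x + \<tau>1) = V2 (x + \<tau>)\<close>, and likewise for the weights.\<close>
  define \<tau> where "\<tau> = \<tau>1 + \<tau>2"
  have q12: "q1 = (\<lambda>x. q2 (\<tau> + 1 * x))" "G1 = (\<lambda>x. G2 (\<tau> + 1 * x))"
    by (auto simp: q1_def q2_def G1_def G2_def assms(5,6) \<tau>_def fun_eq_iff algebra_simps)
  have q21: "q2 = (\<lambda>x. q1 (- \<tau> + 1 * x))" "G2 = (\<lambda>x. G1 (- \<tau> + 1 * x))"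
    by (auto simp: q1_def q2_def G1_def G2_def assms(5,6) \<tau>_def fun_eq_iff algebra_simps)
  have "\<exists>Z\<in>H1. 0 < pot (interface G1 G2) p (fst Z) \<and>
      form (interface q1 q2) Z \<le> S * pot (interface G1 G2) p (fst Z) powr (2 / (p + 1))"
  proof (cases "\<exists>Z\<in>H1. pot (interface G1 G2) p (fst Z) = 1 \<and> form (interface q1 q2) Z = S")
    case True
    then show ?thesis by force
  next
    case False
    \<comment> \<open>The side to which the minimizing sequence escapes need not be the side whose
      sign condition holds. A translation provides a periodic minimizer for either side.\<close>
    have W: "\<exists>W\<in>H1. pot G1 p (fst W) = 1 \<and> form q1 W = S" "\<exists>W\<in>H1. pot G2 p (fst W) = 1 \<and> form q2 W = S"
    proof -
      have 12: "\<exists>W\<in>H1. pot G1 p (fst W) = 1 \<and> form q1 W = S" if "W \<in> H1" "pot G2 p (fst W) = 1 \<and> form q2 W = S" for W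
        using that aff_H1[OF that(1), of 1 \<tau>] pot_aff[of 1 G2 \<tau> p W] bil_aff[of 1 q2 \<tau> W W] unfolding q12[symmetric] by auto
      have 21: "\<exists>W\<in>H1. pot G2 p (fst W) = 1 \<and> form q2 W = S" if "W \<in> H1" "pot G1 p (fst W) = 1 \<and> form q1 W = S" for W
        using that aff_H1[OF that(1), of 1 "- \<tau>"] pot_aff[of 1 G1 "- \<tau>" p W] bil_aff[of 1 q1 "- \<tau>" W W] unfolding q21[symmetric] by auto
      show "\<exists>W\<in>H1. pot G1 p (fst W) = 1 \<and> form q1 W = S" "\<exists>W\<in>H1. pot G2 p (fst W) = 1 \<and> form q2 W = S"
        using alt False 12 21 by blast+
    qed
    show ?thesis
    proof (cases "I1 < 0")
      case True
      obtain \<kappa> where \<kappa>: "\<kappa> > 0" "bloch_mode V1 lam \<kappa> u1"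
        using assms(10) by (auto simp: bloch_mode_decaying_at_minus_infinity_def)
      obtain W where W1: "W \<in> H1" "pot G1 p (fst W) = 1" "form q1 W = S" using W(1) by blast
      have ode: "ode_solution q1 u1" using bloch_mode_step(1)[OF \<kappa>(2)] unfolding q1_def[abs_def] .
      have "(LINT x:{-1..0}|lebesgue. (q2 x - q1 x) * (u1 x)\<^sup>2) < 0"
        using True unfolding assms(12) q1_def q2_def by simp
      from tail_competitor[OF p qL GL per(1-3) \<delta> low1 S(1) W1(1,3,2) ode bloch_mode_step(2)[OF \<kappa>(2)] \<kappa>(1) bloch_mode_step(3)[OF \<kappa>(2)] this]
      show ?thesis .
    next
      case False
      then have I2: "I2 < 0" using assms(14) by simp
      obtain \<kappa> where \<kappa>: "\<kappa> > 0" "bloch_mode V2 lam (- \<kappa>) u2"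
        using assms(11) by (auto simp: bloch_mode_decaying_at_plus_infinity_def)
      obtain W where W2: "W \<in> H1" "pot G2 p (fst W) = 1" "form q2 W = S" using W(2) by blast
      \<comment> \<open>The case \<open>I2 < 0\<close> becomes the other one under
        \<open>x \<mapsto> -x\<close>: the two sides change places, and the mode that decays at plus
        infinity turns into one that decays at minus infinity.\<close>
      define r1 where "r1 x = q2 (- x)" for x
      define r2 where "r2 x = q1 (- x)" for x
      define F1 where "F1 x = G2 (- x)" for x
      define F2 where "F2 x = G1 (- x)" for x
      have L: "r1 \<in> L_infinity" "r2 \<in> L_infinity" "F1 \<in> L_infinity" "F2 \<in> L_infinity"
        unfolding r1_def r2_def F1_def F2_def using L_infinity_reflect qL GL by auto
      have pr: "f (- (x + 1)) = f (- x)" if "\<And>x. f (x + 1) = f x" for f :: "real \<Rightarrow> real" and x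
        using that[of "- x - 1"] by simp
      have rper: "r1 (x + 1) = r1 x" "r2 (x + 1) = r2 x" "F1 (x + 1) = F1 x" for x
        unfolding r1_def r2_def F1_def by (intro pr per)+
      have rlow: "\<delta> * nsq (fst P) \<le> form r1 P" if "P \<in> H1" for P
        unfolding r1_def using low2[OF aff_H1[OF that, of "-1" 0]] nsq_aff[of "-1" 0 P] form_reflect[of q2 P] by simp
      define W' where "W' = aff (-1) 0 W"
      have W': "W' \<in> H1" "form r1 W' = S" "pot F1 p (fst W') = 1"
        unfolding r1_def F1_def form_reflect[of q2 W'] pot_reflect[of G2 p W'] unfolding W'_def aff_inverse
        using W2 by (auto intro: aff_H1)
      have ode: "ode_solution r1 (\<lambda>x. u2 (- x))"
        using ode_solution_reflect[OF bloch_mode_step(1)[OF \<kappa>(2)]] unfolding r1_def q2_def .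
      have nz: "\<exists>x. u2 (- x) \<noteq> 0" using bloch_mode_step(2)[OF \<kappa>(2)] by (metis minus_minus)
      have step: "u2 (- (x + 1)) = exp \<kappa> * u2 (- x)" for x
        using bloch_mode_step(3)[OF \<kappa>(2), of "- (x + 1)"] by (simp add: exp_minus field_simps)
      have "(LINT x:{-1..0}|lebesgue. (r2 x - r1 x) * (u2 (- x))\<^sup>2) = I2"
      proof -
        have "indicat_real {-1..0} x = indicator {0..1} (0 + (-1) * x)" for x :: real by (auto simp: indicator_def)
        then have "(LINT x:{-1..0}|lebesgue. (r2 x - r1 x) * (u2 (- x))\<^sup>2)
          = (LINT x|lebesgue. indicator {0..1} (0 + (-1) * x) *\<^sub>R ((V1 (0 + (-1) * x) - V2 (0 + (-1) * x)) * (u2 (0 + (-1) * x))\<^sup>2))"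
          unfolding set_lebesgue_integral_def by (simp add: r1_def r2_def q1_def q2_def)
        also have "\<dots> = I2"
          unfolding assms(13) set_lebesgue_integral_def
          using lebesgue_integral_real_affine[of "-1" "\<lambda>x. indicator {0..1} x *\<^sub>R ((V1 x - V2 x) * (u2 x)\<^sup>2)" 0] by simp
        finally show ?thesis .
      qed
      then have neg: "(LINT x:{-1..0}|lebesgue. (r2 x - r1 x) * (u2 (- x))\<^sup>2) < 0" using I2 by simp
      from tail_competitor[OF p L rper \<delta> rlow S(1) W' ode nz \<kappa>(1) step neg]
      obtain Z where Z: "Z \<in> H1" "0 < pot (interface F1 F2) p (fst Z)"
        "form (interface r1 r2) Z \<le> S * pot (interface F1 F2) p (fst Z) powr (2 / (p + 1))" by blast
      \<comment> \<open>Reflection is compatible with the interface except at 0, where the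
        convention \<open>x \<ge> 0\<close> is not symmetric; hence equality only almost
        everywhere.\<close>
      have "AE x in lebesgue. interface r1 r2 x = interface q1 q2 (- x)"
        using AE_neq_real[of 0] by eventually_elim (auto simp: interface_def r1_def r2_def)
      then have e1: "form (interface r1 r2) Z = form (interface q1 q2) (aff (-1) 0 Z)"
        unfolding form_reflect[symmetric] by (intro form_cong_AE L_infinity_interface L_infinity_reflect L qL Z(1))
      have "AE x in lebesgue. interface F1 F2 x = interface G1 G2 (- x)"
        using AE_neq_real[of 0] by eventually_elim (auto simp: interface_def F1_def F2_def)
      then have e2: "pot (interface F1 F2) p (fst Z) = pot (interface G1 G2) p (fst (aff (-1) 0 Z))"
        unfolding pot_reflect[symmetric] by (intro pot_cong_AE L_infinity_interface L_infinity_reflect L GL Z(1) p)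
      have "aff (-1) 0 Z \<in> H1" using Z(1) by (intro aff_H1) auto
      then show ?thesis using Z(2,3) unfolding e1 e2 by blast
    qed
  qed
  then obtain Z where Z: "Z \<in> H1" "0 < pot G p (fst Z)" "form (\<lambda>x. V x - lam) Z \<le> S * pot G p (fst Z) powr (2 / (p + 1))"
    unfolding GI qV by blast
  have "\<exists>u. strong_ground_state V lam G p u"
    by (rule strong_ground_state_of_minimizer[OF p VV G \<delta> low[unfolded qV] S(1) S(2)[unfolded GI qV] Z])
  then show "\<exists>u. strong_ground_state V lam (interface (\<lambda>x. \<Gamma>0 (x + \<tau>1)) (\<lambda>x. \<Gamma>0 (x - \<tau>2))) p u"
    by (simp only: G_def)
qed

end
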